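(* Let $n>2$ be an integer and $\rho=\frac{n-2}{2}$. Assume that for this $n$ and every $z\in(0,1)$ there is $\varepsilon=\varepsilon(z,n)>0$ such that the following two hypotheses hold. (i) As $|k|\to\infty$ with $k$ complex, $\mathrm{Re}\,k\ge-\frac n2-\varepsilon$, $$F(k,-\rho;k+\tfrac n2;z)=(1-z)^\rho+\frac{\frac n2\,\rho}{k+\frac n2}\,z(1-z)^{\rho-1}+O(k^{-2}).$$ (ii) $F_k(z)=F(k,-\rho;k+\frac n2;z)$, as a function of the complex variable $k$, has no zeros in the region $\{\mathrm{Re}\,k\ge-\frac n2-\varepsilon\}$. Let $0<r<1$, $|x|<r$, $|y|=r$, and let $P_r(x,y)$ be the Poisson kernel of the ball $D=\{x\in\mathbb{D}^n:|x|<r\}$ for the hyperbolic Brownian motion on $\mathbb{D}^n$. Let $w_{|x|^2,r^2}$ be the inverse Laplace transform of the function $H_{|x|^2,r^2}$ (both described in the context). Then $$P_r(x,y)=\frac{\Gamma(\frac n2)}{2\pi^{n/2}\,r(1-r^2)^{n-2}}\,\frac{r^2-|x|^2}{|x-y|^n}\int_0^\infty\frac{w_{|x|^2,r^2}(v)\,L(x,y,v)}{|xe^{-v}-y|^{n-2}}\,dv,$$ where $$L(x,y,v)=|xe^{-v/2}-ye^{v/2}|^{2\rho}\,\rho\,h(x,y,v)-|x-y|^2\left[|xe^{-v/2}-ye^{v/2}|^{2\rho}-|x-y|^{2\rho}\right],$$ $$h(x,y,v)=|xe^{-v/2}-ye^{v/2}|^2-|x-y|^2=|x|^2(e^{-v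}-1)+r^2(e^v-1).$$
   Context: $\mathbb{D}^n=\{x\in\mathbb{R}^n:|x|<1\}$ is the ball model of real hyperbolic space with metric $ds^2=|dx|^2/(1-|x|^2)^2$. The hyperbolic Brownian motion $X(t)$ is the diffusion on $\mathbb{D}^n$ with generator the Laplace–Beltrami operator $(1-|x|^2)^2\sum_i\frac{\partial^2}{\partial x_i^2}+2(n-2)(1-|x|^2)\sum_i x_i\frac{\partial}{\partial x_i}$. With $\tau_D=\inf\{t\ge0:|X(t)|\ge r\}$, the Poisson kernel $P_r(x,\cdot)$, $x\in D$, is the (continuous) density, with respect to the $(n-1)$-dimensional Euclidean spherical measure on $\{|y|=r\}$, of the distribution of $X(\tau_D)$ under $P^x$. $F(\alpha,\beta;\gamma;z)=\sum_{i\ge0}\frac{(\alpha)_i(\beta)_i}{(\gamma)_i\,i!}z^i$ is the Gauss hypergeometric function, $(\alpha)_i=\Gamma(\alpha+i)/\Gamma(\alpha)$, and $F_k(z)=F(k,-\rho;k+\frac n2;z)$. Put $f_z(k)=\frac{1}{\Gamma(k+\frac n2)}F_k(z)$, which is an entire function of the complex variable $k$. The function $H_{|x|^2,r^2}(k)$ is defined by $$\frac{k+\rho}{\rho}\,\frac{f_{|x|^2}(k)}{f_{r^2}(k)}=\left(\frac{1-|x|^2}{1-r^2}\right)^{\rho}\left(\frac{k+\rho}{\rho}-\frac n2\,\frac{r^2-|x|^2}{(1-r^2)(1-|x|^2)}\right)+\frac{r^2-|x|^2}{(1-r^2)^{n-2}}\,H_{|x|^2,r^2}(k).$$ Its inverse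 Laplace transform $w_{|x|^2,r^2}$ is the function on $(0,\infty)$ with $$H_{|x|^2,r^2}(k)=\int_0^\infty e^{-kv}\,w_{|x|^2,r^2}(v)\,dv$$ for every complex $k$ with $\mathrm{Re}\,k\ge-\frac n2-\varepsilon$, for some $\varepsilon>0$. *)

theory Defs
  imports "HOL-Probability.Probability"
begin

section \<open>The Laplace--Beltrami operator of the ball model\<close>

definition partial :: "'n::finite \<Rightarrow> (real^'n \<Rightarrow> real) \<Rightarrow> real^'n \<Rightarrow> real" where
  "partial i f z = frechet_derivative f (at z) (axis i 1)"

text \<open>Twice continuously differentiable functions whose support is a compact subset of the open unit
  ball. Differentiability of the first partial derivatives together with continuity of the second
  ones is the usual notion of class C2 on the whole space; functions on the ball with compact support
  are extended by 0.\<close>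

definition C2_compact_support :: "(real^'n::finite \<Rightarrow> real) \<Rightarrow> bool" where
  "C2_compact_support f \<longleftrightarrow>
     (\<forall>z. f differentiable (at z)) \<and>
     (\<forall>i z. partial i f differentiable (at z)) \<and>
     (\<forall>i j. continuous_on UNIV (partial j (partial i f))) \<and>
     (\<exists>K. compact K \<and> K \<subseteq> ball 0 1 \<and> (\<forall>z. z \<notin> K \<longrightarrow> f z = 0))"

text \<open>Laplace--Beltrami operator for the metric with line element |dx| / (1 - |x|^2).\<close>

definition hyp_laplacian :: "(real^'n::finite \<Rightarrow> real) \<Rightarrow> real^'n \<Rightarrow> real" where
  "hyp_laplacian f z =
     (1 - (norm z)\<^sup>2)\<^sup>2 * (\<Sum>i\<in>UNIV. partial i (partial i f) z) +
     2 * (real CARD('n) - 2) * (1 - (norm z)\<^sup>2) * (\<Sum>i\<in>UNIV. z $ i * partial i f z)"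

section \<open>Hyperbolic Brownian motion\<close>

definition natural_filtration ::
    "'w measure \<Rightarrow> (real \<Rightarrow> 'w \<Rightarrow> 'b::topological_space) \<Rightarrow> real \<Rightarrow> 'w measure" where
  "natural_filtration M X t =
     sigma (space M) {X u -` B \<inter> space M | u B. 0 \<le> u \<and> u \<le> t \<and> B \<in> sets borel}"

definition martingale_wrt ::
    "'w measure \<Rightarrow> (real \<Rightarrow> 'w measure) \<Rightarrow> (real \<Rightarrow> 'w \<Rightarrow> real) \<Rightarrow> bool" where
  "martingale_wrt M F Y \<longleftrightarrow>
     (\<forall>t\<ge>0. Y t \<in> borel_measurable (F t) \<and> integrable M (Y t)) \<and>
     (\<forall>s t. 0 \<le> s \<and> s \<le> t \<longrightarrow> (AE \<omega> in M. real_cond_exp M (F s) (Y t) \<omega> = Y s \<omega>))"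

text \<open>The diffusion on the unit ball with the above generator, started at x, in the sense of the
  (Stroock--Varadhan) martingale problem: a continuous process in the open unit ball for which
  Dynkin's formula holds, with C2 functions of compact support as test functions. The coefficients
  are smooth, so this determines the law of X.\<close>

definition hyperbolic_BM ::
    "'w measure \<Rightarrow> (real \<Rightarrow> 'w \<Rightarrow> real^'n::finite) \<Rightarrow> real^'n \<Rightarrow> bool" where
  "hyperbolic_BM M X x \<longleftrightarrow>
     prob_space M \<and>
     (\<forall>t\<ge>0. X t \<in> borel_measurable M) \<and>
     (\<forall>\<omega>\<in>space M. continuous_on {0..} (\<lambda>t. X t \<omega>)) \<and>
     (\<forall>\<omega>\<in>space M. \<forall>t\<ge>0. X t \<omega> \<in> ball 0 1) \<and>
     (AE \<omega> in M. X 0 \<omega> = x) \<and>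
     (\<forall>f. C2_compact_support f \<longrightarrow>
        martingale_wrt M (natural_filtration M X)
          (\<lambda>t \<omega>. f (X t \<omega>) - f (X 0 \<omega>) - (LINT s:{0..t}|lborel. hyp_laplacian f (X s \<omega>))))"

section \<open>The Poisson kernel\<close>

text \<open>Infinite if the process never leaves the ball of radius r.\<close>

definition exit_time :: "(real \<Rightarrow> 'w \<Rightarrow> 'b::real_normed_vector) \<Rightarrow> real \<Rightarrow> 'w \<Rightarrow> ereal" where
  "exit_time X r \<omega> = Inf (ereal ` {t. 0 \<le> t \<and> r \<le> norm (X t \<omega>)})"

text \<open>On paths with infinite exit time this is the starting point, since then the real number
  assigned to the exit time is 0.\<close>

definition exit_position :: "(real \<Rightarrow> 'w \<Rightarrow> 'b::real_normed_vector) \<Rightarrow> real \<Rightarrow> 'w \<Rightarrow> 'b" where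
  "exit_position X r \<omega> = X (real_of_ereal (exit_time X r \<omega>)) \<omega>"

text \<open>The Euclidean surface measure on the sphere of radius r, as a Borel measure on the whole space,
  by polar coordinates: the measure of A is (n/r) times the volume of the cone over A, i.e. of the set of
  all t y with y in A, |y| = r and 0 < t \<le> 1.\<close>

definition spherical_measure :: "real \<Rightarrow> (real^'n::finite) measure" where
  "spherical_measure r =
     scale_measure (ennreal (real CARD('n) / r))
       (distr (restrict_space lborel (cball 0 r - {0})) borel (\<lambda>z. (r / norm z) *\<^sub>R z))"

text \<open>P is the function P_r(x,.), where x is the starting point of X. The density vanishes off the
  sphere, so the exit time is almost surely finite if the starting point is in the open ball of
  radius r.\<close>

definition is_Poisson_kernel ::
    "'w measure \<Rightarrow> (real \<Rightarrow> 'w \<Rightarrow> real^'n::finite) \<Rightarrow> real \<Rightarrow> (real^'n \<Rightarrow> real) \<Rightarrow> bool" where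
  "is_Poisson_kernel M X r P \<longleftrightarrow>
     continuous_on (sphere 0 r) P \<and> (\<forall>y\<in>sphere 0 r. 0 \<le> P y) \<and>
     distributed M (spherical_measure r) (exit_position X r)
       (\<lambda>y. ennreal (indicator (sphere 0 r) y * P y))"

section \<open>Hypergeometric functions\<close>

definition hypergeo_F :: "complex \<Rightarrow> complex \<Rightarrow> complex \<Rightarrow> complex \<Rightarrow> complex" where
  "hypergeo_F \<alpha> \<beta> \<gamma> z =
     (\<Sum>i. pochhammer \<alpha> i * pochhammer \<beta> i / (pochhammer \<gamma> i * fact i) * z ^ i)"

definition rho :: "nat \<Rightarrow> real" where
  "rho n = (real n - 2) / 2"

definition F_k :: "nat \<Rightarrow> complex \<Rightarrow> real \<Rightarrow> complex" where
  "F_k n k z = hypergeo_F k (- of_real (rho n)) (k + of_nat n / 2) (of_real z)"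

text \<open>The entire function of k extending F_k(z) / Gamma(k + n/2): the factor 1 / Gamma(k + n/2) is
  absorbed into the series, which removes the singularities at the poles of Gamma(k + n/2).
  See lemma f_z_eq below.\<close>

definition f_z :: "nat \<Rightarrow> real \<Rightarrow> complex \<Rightarrow> complex" where
  "f_z n z k =
     (\<Sum>i. pochhammer k i * pochhammer (- of_real (rho n)) i *
           rGamma (k + of_nat n / 2 + of_nat i) / fact i * of_real z ^ i)"

lemma summable_hypergeo:
  fixes \<alpha> \<beta> \<gamma> z :: complex
  assumes z: "norm z < 1" and \<gamma>: "\<gamma> \<notin> \<int>\<^sub>\<le>\<^sub>0"
  shows "summable (\<lambda>i. pochhammer \<alpha> i * pochhammer \<beta> i / (pochhammer \<gamma> i * fact i) * z ^ i)"
proof -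
  define a where "a = (\<lambda>i. pochhammer \<alpha> i * pochhammer \<beta> i / (pochhammer \<gamma> i * fact i) * z ^ i)"
  define q where "q = (\<lambda>i::nat. (\<alpha> + of_nat i) / (\<gamma> + of_nat i) * ((\<beta> + of_nat i) / (1 + of_nat i)) * z)"
  have lim: "(\<lambda>i::nat. (u + of_nat i) / (v + of_nat i)) \<longlonglongrightarrow> 1" for u v :: complex
  proof -
    have "(\<lambda>i::nat. (u / of_nat i + 1) / (v / of_nat i + 1)) \<longlonglongrightarrow> (0 + 1) / (0 + 1)"
      by (intro tendsto_intros lim_const_over_n) auto
    moreover have "\<forall>\<^sub>F i::nat in sequentially.
        (u / of_nat i + 1) / (v / of_nat i + 1) = (u + of_nat i) / (v + of_nat i)"
      using eventually_gt_at_top[of 0]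
    proof eventually_elim
      case (elim i)
      then have i: "(of_nat i :: complex) \<noteq> 0"
        by simp
      have "u / of_nat i + 1 = (u + of_nat i) / of_nat i" "v / of_nat i + 1 = (v + of_nat i) / of_nat i"
        using i by (simp_all add: add_divide_distrib)
      then show ?case
        using i by simp
    qed
    ultimately show ?thesis
      by (simp add: tendsto_cong)
  qed
  have "(\<lambda>i. norm (q i)) \<longlonglongrightarrow> norm (1 * 1 * z)"
    unfolding q_def by (intro tendsto_intros lim)
  moreover obtain c where c: "norm z < c" "c < 1"
    using z dense by blast
  ultimately have "\<forall>\<^sub>F i in sequentially. norm (q i) < c"
    by (intro order_tendstoD) auto
  then obtain N where N: "\<And>i. i \<ge> N \<Longrightarrow> norm (q i) < c"
    by (auto simp: eventually_sequentially)
  have step: "a (Suc i) = q i * a i" for i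
    by (simp add: a_def q_def pochhammer_Suc divide_inverse inverse_mult_distrib mult_ac)
  have "summable a"
  proof (rule summable_ratio_test[OF c(2), of N])
    fix i assume "i \<ge> N"
    then show "norm (a (Suc i)) \<le> c * norm (a i)"
      using N[of i] by (simp add: step norm_mult mult_right_mono)
  qed
  then show ?thesis
    by (simp add: a_def)
qed

lemma f_z_eq:
  assumes z: "\<bar>z\<bar> < 1" and k: "k + of_nat n / 2 \<notin> \<int>\<^sub>\<le>\<^sub>0"
  shows "f_z n z k = F_k n k z / Gamma (k + of_nat n / 2)"
proof -
  define \<gamma> where "\<gamma> = k + of_nat n / 2"
  have nz: "pochhammer \<gamma> i \<noteq> 0" for i
    using k unfolding \<gamma>_def by (metis pochhammer_eq_0_imp_nonpos_Int)
  have g: "rGamma (\<gamma> + of_nat i) = rGamma \<gamma> / pochhammer \<gamma> i" for i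
    using pochhammer_rGamma[of \<gamma> i] nz[of i] by (metis nonzero_mult_div_cancel_left)
  have "f_z n z k = (\<Sum>i. rGamma \<gamma> *
      (pochhammer k i * pochhammer (- of_real (rho n)) i / (pochhammer \<gamma> i * fact i) * of_real z ^ i))"
    unfolding f_z_def \<gamma>_def[symmetric] g
    by (rule suminf_cong) (simp only: divide_inverse inverse_mult_distrib mult_ac)
  also have "\<dots> = rGamma \<gamma> * F_k n k z"
    unfolding F_k_def hypergeo_F_def \<gamma>_def[symmetric]
  proof (rule suminf_mult, rule summable_hypergeo)
    show "norm (complex_of_real z) < 1"
      using z by simp
    show "\<gamma> \<notin> \<int>\<^sub>\<le>\<^sub>0"
      using k by (simp only: \<gamma>_def not_False_eq_True)
  qed
  finally show ?thesis
    by (simp only: \<gamma>_def Gamma_def divide_inverse inverse_inverse_eq mult.commute)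
qed

section \<open>The functions H and w\<close>

text \<open>H is the solution of the equation in lemma H_fun_eq below.\<close>

definition H_fun :: "nat \<Rightarrow> real \<Rightarrow> real \<Rightarrow> complex \<Rightarrow> complex" where
  "H_fun n s R k =
     of_real ((1 - R) ^ (n - 2) / (R - s)) *
     ((k + of_real (rho n)) / of_real (rho n) * (f_z n s k / f_z n R k) -
      of_real (((1 - s) / (1 - R)) powr rho n) *
      ((k + of_real (rho n)) / of_real (rho n)
        - of_real (real n / 2 * ((R - s) / ((1 - R) * (1 - s))))))"

lemma H_fun_eq:
  assumes "s < R" "R < 1"
  shows "(k + of_real (rho n)) / of_real (rho n) * (f_z n s k / f_z n R k) =
     of_real (((1 - s) / (1 - R)) powr rho n) *
      ((k + of_real (rho n)) / of_real (rho n)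
        - of_real (real n / 2 * ((R - s) / ((1 - R) * (1 - s)))))
     + of_real ((R - s) / (1 - R) ^ (n - 2)) * H_fun n s R k"
proof -
  have "((R - s) / (1 - R) ^ (n - 2)) * ((1 - R) ^ (n - 2) / (R - s)) = 1"
    using assms by simp
  then have "complex_of_real ((R - s) / (1 - R) ^ (n - 2)) * of_real ((1 - R) ^ (n - 2) / (R - s)) = 1"
    by (metis of_real_1 of_real_mult)
  then show ?thesis
    unfolding H_fun_def mult.assoc[symmetric] by simp
qed

definition inverse_Laplace_of_H :: "nat \<Rightarrow> real \<Rightarrow> real \<Rightarrow> (real \<Rightarrow> real) \<Rightarrow> bool" where
  "inverse_Laplace_of_H n s R w \<longleftrightarrow>
     (\<exists>\<epsilon>>0. \<forall>k::complex. Re k \<ge> - real n / 2 - \<epsilon> \<longrightarrow>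
        set_integrable lborel {0<..} (\<lambda>v. exp (- k * of_real v) * of_real (w v)) \<and>
        H_fun n s R k = (LINT v:{0<..}|lborel. exp (- k * of_real v) * of_real (w v)))"

section \<open>The functions h and L\<close>

definition h_fun :: "real^'n::finite \<Rightarrow> real^'n \<Rightarrow> real \<Rightarrow> real" where
  "h_fun x y v = (norm (exp (- v / 2) *\<^sub>R x - exp (v / 2) *\<^sub>R y))\<^sup>2 - (norm (x - y))\<^sup>2"

lemma h_fun_eq:
  assumes "norm y = r"
  shows "h_fun x y v = (norm x)\<^sup>2 * (exp (- v) - 1) + r\<^sup>2 * (exp v - 1)"
proof -
  have e: "exp (- v / 2) * exp (- v / 2) = exp (- v)" "exp (v / 2) * exp (v / 2) = exp v"
    "exp (- v / 2) * exp (v / 2) = 1"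
    by (simp_all flip: exp_add)
  have "(norm (exp (- v / 2) *\<^sub>R x - exp (v / 2) *\<^sub>R y))\<^sup>2 =
      (exp (- v / 2) * exp (- v / 2)) * (norm x)\<^sup>2 + (exp (v / 2) * exp (v / 2)) * (norm y)\<^sup>2
      - 2 * (exp (- v / 2) * exp (v / 2)) * (x \<bullet> y)"
    by (simp only: power2_norm_eq_inner inner_diff_left inner_diff_right inner_scaleR_left
        inner_scaleR_right) (simp add: algebra_simps inner_commute)
  moreover have "(norm (x - y))\<^sup>2 = (norm x)\<^sup>2 + (norm y)\<^sup>2 - 2 * (x \<bullet> y)"
    by (simp add: power2_norm_eq_inner inner_diff_left inner_diff_right inner_commute)
  ultimately show ?thesis
    unfolding h_fun_def e using assms by (simp add: algebra_simps)
qed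

definition L_fun :: "real^'n::finite \<Rightarrow> real^'n \<Rightarrow> real \<Rightarrow> real" where
  "L_fun x y v =
     norm (exp (- v / 2) *\<^sub>R x - exp (v / 2) *\<^sub>R y) powr (2 * rho CARD('n)) *
       rho CARD('n) * h_fun x y v
     - (norm (x - y))\<^sup>2 *
       (norm (exp (- v / 2) *\<^sub>R x - exp (v / 2) *\<^sub>R y) powr (2 * rho CARD('n))
         - norm (x - y) powr (2 * rho CARD('n)))"

end

theory Submission
  imports Defs
begin

text \<open>
  The proof is separation of variables. For a unit vector \<open>e\<close> let \<open>Z\<^sub>k(z)\<close> be the zonal solid harmonic of
  degree \<open>k\<close> with axis \<open>e\<close>. The functions \<open>Z\<^sub>k(z) F\<^sub>k(|z|\<^sup>2)\<close> are annihilated by the Laplace--Beltrami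
  operator, because the radial equation is the hypergeometric equation of \<open>F\<^sub>k\<close>
  (\<open>hyp_harmonic_test_function\<close>). Stopping Dynkin's formula at the exit time (\<open>exit_mean_value\<close>) then gives
  the moments of the exit distribution against the zonal harmonics: integrating \<open>P\<close> against \<open>Z\<^sub>k\<close> over
  the sphere multiplies \<open>Z\<^sub>k(x)\<close> by \<open>F\<^sub>k(|x|\<^sup>2) / F\<^sub>k(r\<^sup>2)\<close> (\<open>Poisson_kernel_gegenbauer_moment\<close>). The
  denominators do not vanish by the second hypothesis of the theorem.

  These moments determine the continuous density \<open>P\<close>. The Euclidean Poisson kernel is the generating
  function of \<open>(k + \<rho>) / \<rho> Z\<^sub>k\<close>, and it is an approximate identity on the sphere, so with \<open>e = y / r\<close> the
  value \<open>P(y)\<close> times the area of the sphere is the sum over \<open>k\<close> of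
  \<open>(k + \<rho>) / \<rho> r\<^bsup>-k\<^esup> Z\<^sub>k(x) F\<^sub>k(|x|\<^sup>2) / F\<^sub>k(r\<^sup>2)\<close> (\<open>sphere_density_expansion\<close>). That all Poisson kernels
  have the same mass on the sphere rests on the vanishing of the means of the zonal harmonics, which
  follows from the rotation invariance of the surface measure.

  The equation that defines \<open>H\<close> writes \<open>(k + \<rho>) / \<rho> F\<^sub>k(|x|\<^sup>2) / F\<^sub>k(r\<^sup>2)\<close> as an affine function of \<open>k\<close> plus a
  multiple of the Laplace transform of \<open>w\<close> at \<open>k\<close>. The three resulting series are summed by generating
  functions (\<open>Gegenbauer_series_identity\<close>): two of them give powers of \<open>|x - y|\<close>, the third one
  gives the integral of \<open>w(v) / |x e\<^bsup>-v\<^esup> - y|\<^bsup>n-2\<^esup>\<close>. On the other side, the integrand of the theorem is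
  \<open>w(v)\<close> times \<open>e\<^bsup>\<rho>v\<^esup> (\<rho> h - |x - y|\<^sup>2) + |x - y|\<^sup>n / |x e\<^bsup>-v\<^esup> - y|\<^bsup>n-2\<^esup>\<close> (\<open>L_fun_split\<close>). The first summand
  contributes only the values of \<open>H\<close> at \<open>-\<rho>\<close>, \<open>1 - \<rho>\<close> and \<open>-n/2\<close>. There \<open>k + \<rho>\<close> is \<open>0\<close>, \<open>1\<close> and \<open>-1\<close>, and a relation
  between the values of \<open>f\<^sub>z\<close> at \<open>-n/2\<close> and \<open>1 - \<rho>\<close> makes the hypergeometric quotients cancel
  (\<open>H_fun_special_values\<close>); what remains are exactly the two powers of \<open>|x - y|\<close>.
\<close>

section \<open>Gegenbauer polynomials in homogeneous form\<close>

text \<open>The homogeneous form \<open>b\<^bsup>k/2\<^esup> C\<^sub>k(a / \<surd>b)\<close> of the Gegenbauer polynomial \<open>C\<^sub>k\<close> with parameter \<open>l\<close>. For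
  \<open>a = e \<bullet> z\<close> and \<open>b = |z|\<^sup>2\<close> it is a polynomial in \<open>z\<close>; the homogeneous form avoids the quotient \<open>z / |z|\<close> at
  the origin.\<close>

fun gegenbauer :: "real \<Rightarrow> real \<Rightarrow> real \<Rightarrow> nat \<Rightarrow> real" where
  "gegenbauer l a b 0 = 1"
| "gegenbauer l a b (Suc 0) = 2 * l * a"
| "gegenbauer l a b (Suc (Suc k)) =
     (2 * (real k + 1 + l) * (a * gegenbauer l a b (Suc k)) - (real k + 2 * l) * (b * gegenbauer l a b k))
       / (real k + 2)"

text \<open>The quadratic \<open>1 - 2at + bt\<^sup>2\<close> factors as \<open>(1 - wt)(1 - w't)\<close> with \<open>w'\<close> the conjugate of \<open>w\<close>, where
  \<open>a = Re w\<close> and \<open>b = |w|\<^sup>2\<close>. The product of the two binomial series satisfies a first order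
  differential equation, whose coefficients obey the three-term recurrence of the Gegenbauer
  polynomials. The factorization gives convergence up to \<open>|wt| = 1\<close>, while the expansion in powers of
  \<open>2at - bt\<^sup>2\<close> converges only in a smaller disc.\<close>

lemma gegenbauer_eq_convolution:
  fixes w :: complex
  defines "\<beta> \<equiv> (\<lambda>l i. pochhammer l i / fact i :: real)"
  shows "complex_of_real (gegenbauer l (Re w) ((norm w)\<^sup>2) k)
    = (\<Sum>i\<le>k. (of_real (\<beta> l i) * w ^ i) * (of_real (\<beta> l (k - i)) * cnj w ^ (k - i)))"
proof -
  define B where "B = (\<lambda>v::complex. Abs_fps (\<lambda>i. of_real (\<beta> l i) * v ^ i))"
  have B: "(1 - fps_const v * fps_X) * fps_deriv (B v) = fps_const (of_real l * v) * B v" for v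
  proof (rule fps_ext)
    fix m
    have \<beta>: "(real m + 1) * \<beta> l (Suc m) = (l + real m) * \<beta> l m"
      by (simp add: \<beta>_def pochhammer_Suc divide_simps)
    have "fps_nth ((1 - fps_const v * fps_X) * fps_deriv (B v)) m
       = of_real ((real m + 1) * \<beta> l (Suc m)) * v ^ Suc m - of_nat m * (of_real (\<beta> l m) * v ^ Suc m)"
      by (cases m) (simp_all add: B_def left_diff_distrib mult.assoc algebra_simps)
    also have "\<dots> = fps_nth (fps_const (of_real l * v) * B v) m"
      unfolding \<beta> by (simp add: B_def algebra_simps)
    finally show "fps_nth ((1 - fps_const v * fps_X) * fps_deriv (B v)) m = fps_nth (fps_const (of_real l * v) * B v) m" .
  qed
  define G where "G = B w * B (cnj w)"
  have sp: "w + cnj w = of_real (2 * Re w)" "w * cnj w = of_real ((norm w)\<^sup>2)"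
    by (simp_all add: complex_add_cnj complex_norm_square[symmetric])
  define a where "a = Re w"
  define b where "b = (norm w)\<^sup>2"
  have "(1 - fps_const (w + cnj w) * fps_X + fps_const (w * cnj w) * fps_X * fps_X) * fps_deriv G =
     ((1 - fps_const w * fps_X) * fps_deriv (B w)) * ((1 - fps_const (cnj w) * fps_X) * B (cnj w))
     + ((1 - fps_const (cnj w) * fps_X) * fps_deriv (B (cnj w))) * ((1 - fps_const w * fps_X) * B w)"
    unfolding G_def fps_const_add[symmetric] fps_const_mult[symmetric] fps_deriv_mult
    by (simp add: algebra_simps del: fps_const_add fps_const_mult)
  also have "\<dots> = fps_const (of_real l) * (fps_const (w + cnj w) - fps_const (2 * (w * cnj w)) * fps_X) * G"
    unfolding B G_def fps_const_add[symmetric] fps_const_mult[symmetric]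
    by (simp add: algebra_simps numeral_fps_const[symmetric] del: fps_const_add fps_const_mult)
  finally have ode: "(1 - fps_const (of_real (2 * a)) * fps_X + fps_const (of_real b) * fps_X * fps_X) * fps_deriv G =
     fps_const (of_real l) * (fps_const (of_real (2 * a)) - fps_const (2 * of_real b) * fps_X) * G"
    unfolding sp a_def b_def .
  have rec: "(of_nat k + 2) * fps_nth G (Suc (Suc k)) =
     2 * (of_nat k + 1 + of_real l) * (of_real a * fps_nth G (Suc k)) - (of_nat k + 2 * of_real l) * (of_real b * fps_nth G k)" for k
  proof -
    from ode have "fps_nth ((1 - fps_const (of_real (2 * a)) * fps_X + fps_const (of_real b) * fps_X * fps_X) * fps_deriv G) (Suc k) =
      fps_nth (fps_const (of_real l) * (fps_const (of_real (2 * a)) - fps_const (2 * of_real b) * fps_X) * G) (Suc k)"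
      by simp
    then show ?thesis
      by (cases k) (simp_all add: algebra_simps mult.assoc)
  qed
  have "complex_of_real (gegenbauer l a b k) = fps_nth G k \<and> complex_of_real (gegenbauer l a b (Suc k)) = fps_nth G (Suc k)"
  proof (induction k)
    case 0
    have "w * of_real l + cnj w * of_real l = of_real (2 * l * a)"
      using sp(1) by (simp add: a_def distrib_right[symmetric])
    then show ?case
      by (simp add: G_def B_def \<beta>_def fps_mult_nth mult_ac add.commute)
  next
    case (Suc k)
    have "(of_nat k + 2 :: complex) \<noteq> 0"
      using of_nat_eq_0_iff[of "k + 2", where ?'a = complex] by (simp add: add.commute del: of_nat_eq_0_iff)
    then show ?case
      using Suc rec[of k] by (simp add: divide_simps mult.commute)
  qed
  then show ?thesis
    by (simp add: G_def B_def fps_mult_nth atLeast0AtMost a_def b_def)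
qed

lemma gegenbauer_sums_complex:
  fixes w :: complex
  assumes w: "norm w < 1"
  shows "(\<lambda>k. gegenbauer l (Re w) ((norm w)\<^sup>2) k) sums (1 - 2 * Re w + (norm w)\<^sup>2) powr (- l)"
proof -
  define c where "c = (\<lambda>v i. complex_of_real (pochhammer l i / fact i) * v ^ i)"
  have c: "c v sums ((1 - v) powr of_real (- l))" if "norm v < 1" for v
  proof -
    have "c v i = ((of_real (- l)) gchoose i) * (- v) ^ i" for i
    proof -
      have "(-1) ^ i * (-1 :: complex) ^ i = 1"
        by (simp flip: power_mult_distrib)
      then have "c v i = ((-1) ^ i * (-1) ^ i) * complex_of_real (pochhammer l i / fact i) * v ^ i"
        unfolding c_def by simp
      then show ?thesis
        by (simp add: gbinomial_pochhammer power_minus[of v] pochhammer_of_real)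
    qed
    then have "c v = (\<lambda>i. ((of_real (- l)) gchoose i) * (- v) ^ i)"
      by (rule ext)
    then show ?thesis
      using gen_binomial_complex[of "- v" "of_real (- l)"] that by simp
  qed
  have sn: "summable (\<lambda>i. norm (c v i))" if "norm v < 1" for v
  proof -
    obtain K where K: "norm v < K" "K < 1"
      using dense[OF \<open>norm v < 1\<close>] by blast
    then have K0: "0 < K"
      using norm_ge_zero[of v] by linarith
    have K1: "norm (complex_of_real K) < 1"
      using K K0 by simp
    have "summable (\<lambda>i. complex_of_real (pochhammer l i / fact i) * (of_real K) ^ i)"
      using sums_summable[OF c[OF K1]] by (simp only: c_def)
    then show ?thesis
      unfolding c_def by (rule powser_insidea) (use K K0 in simp)
  qed
  have cc: "c (cnj w) i = cnj (c w i)" for i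
    by (simp add: c_def)
  have "c (cnj w) sums cnj ((1 - w) powr of_real (- l))"
    unfolding cc sums_cnj by (rule c[OF w])
  moreover have "(\<lambda>k. \<Sum>i\<le>k. c w i * c (cnj w) (k - i)) sums ((\<Sum>i. c w i) * (\<Sum>i. c (cnj w) i))"
    by (rule Cauchy_product_sums) (use w in \<open>auto intro!: sn\<close>)
  ultimately have "(\<lambda>k. complex_of_real (gegenbauer l (Re w) ((norm w)\<^sup>2) k)) sums
      (((1 - w) powr of_real (- l)) * cnj ((1 - w) powr of_real (- l)))"
    using c[OF w] by (simp add: gegenbauer_eq_convolution c_def sums_iff)
  also have "((1 - w) powr of_real (- l)) * cnj ((1 - w) powr of_real (- l)) =
     of_real ((norm ((1 - w) powr of_real (- l)))\<^sup>2)"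
    by (simp only: complex_norm_square)
  also have "(norm ((1 - w) powr of_real (- l)))\<^sup>2 = (1 - 2 * Re w + (norm w)\<^sup>2) powr (- l)"
  proof -
    have nz: "1 - w \<noteq> 0"
      using w by auto
    have n2: "(norm (1 - w))\<^sup>2 = 1 - 2 * Re w + (norm w)\<^sup>2"
      unfolding cmod_power2 by (simp add: power2_eq_square algebra_simps)
    have "norm ((1 - w) powr of_real (- l)) = norm (1 - w) powr (- l)"
      using nz by (simp add: powr_def Re_Ln)
    then have "(norm ((1 - w) powr of_real (- l)))\<^sup>2 = (norm (1 - w))\<^sup>2 powr (- l)"
      by (simp add: power2_eq_square powr_mult)
    then show ?thesis
      unfolding n2 .
  qed
  finally show ?thesis
    by (simp only: sums_of_real_iff)
qed

lemma gegenbauer_scale: "gegenbauer l (t * a) (t\<^sup>2 * b) k = t ^ k * gegenbauer l a b k"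
  by (induction l a b k rule: gegenbauer.induct) (auto simp: algebra_simps power2_eq_square diff_divide_distrib add_divide_distrib)

lemma gegenbauer_sums:
  assumes ab: "a\<^sup>2 \<le> b" and t: "t\<^sup>2 * b < 1"
  shows "(\<lambda>k. gegenbauer l a b k * t ^ k) sums (1 - 2 * t * a + t\<^sup>2 * b) powr (- l)"
proof -
  define w where "w = of_real t * Complex a (sqrt (b - a\<^sup>2))"
  have re: "Re w = t * a"
    by (simp add: w_def)
  have n: "(norm w)\<^sup>2 = t\<^sup>2 * b"
    using ab by (simp add: w_def norm_mult power_mult_distrib cmod_power2)
  then have "(norm w)\<^sup>2 < 1\<^sup>2"
    using t by simp
  then have "norm w < 1"
    by (rule power2_less_imp_less) simp
  from gegenbauer_sums_complex[OF this, of l] show ?thesis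
    unfolding re n gegenbauer_scale by (simp add: mult_ac)
qed

text \<open>Triangle inequality in the convolution formula, whose coefficients are nonnegative. The bound is the
  value at \<open>a = \<surd>b\<close>, hence again a coefficient of a convergent generating function; it serves as a
  majorant, uniform in \<open>a\<close>, whenever sums and integrals are interchanged.\<close>

lemma gegenbauer_abs_le:
  assumes l: "l > 0" and ab: "a\<^sup>2 \<le> b"
  shows "\<bar>gegenbauer l a b k\<bar> \<le> gegenbauer l (sqrt b) b k"
proof -
  have b: "b \<ge> 0"
    using ab zero_le_power2[of a] by linarith
  define w where "w = Complex a (sqrt (b - a\<^sup>2))"
  define \<beta> where "\<beta> = (\<lambda>i. pochhammer l i / fact i)"
  have \<beta>: "\<beta> i \<ge> 0" for i
    using l by (simp add: \<beta>_def pochhammer_nonneg)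
  have n2: "(norm w)\<^sup>2 = b"
    using ab by (simp add: w_def cmod_power2)
  then have n: "norm w = sqrt b"
    by (metis norm_ge_zero real_sqrt_unique)
  have "norm (complex_of_real (gegenbauer l (Re w) ((norm w)\<^sup>2) k)) \<le>
     (\<Sum>i\<le>k. norm ((of_real (\<beta> i) * w ^ i) * (of_real (\<beta> (k - i)) * cnj w ^ (k - i))))"
    unfolding gegenbauer_eq_convolution \<beta>_def by (rule norm_sum)
  also have "\<dots> = (\<Sum>i\<le>k. (\<beta> i * sqrt b ^ i) * (\<beta> (k - i) * sqrt b ^ (k - i)))"
    using \<beta> by (simp add: norm_mult norm_power n del: of_real_mult)
  also have "complex_of_real \<dots> = of_real (gegenbauer l (sqrt b) b k)"
    using gegenbauer_eq_convolution[of l "of_real (sqrt b)" k] b by (simp add: \<beta>_def)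
  ultimately show ?thesis
    by (simp only: n2 norm_of_real of_real_eq_iff) (simp add: w_def)
qed

text \<open>Obtained from the generating function \<open>D(t)\<^bsup>-l\<^esup>\<close> by applying \<open>1 + (t/l) d/dt\<close>. For
  \<open>l = n/2 - 1\<close> the sum is, up to normalization, the Euclidean Poisson kernel.\<close>

lemma gegenbauer_poisson_sums:
  assumes l: "l > 0" and ab: "a\<^sup>2 \<le> b" and t: "t\<^sup>2 * b < 1"
  shows "(\<lambda>k. (real k + l) / l * gegenbauer l a b k * t ^ k) sums
     ((1 - t\<^sup>2 * b) * (1 - 2 * t * a + t\<^sup>2 * b) powr (- l - 1))"
proof -
  define c where "c = gegenbauer l a b"
  define D where "D = (\<lambda>t. 1 - 2 * t * a + t\<^sup>2 * b)"
  have b: "b \<ge> 0"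
    using ab zero_le_power2[of a] by linarith
  have s: "(\<lambda>k. c k * v ^ k) sums D v powr (- l)" if "v\<^sup>2 * b < 1" for v
    unfolding c_def D_def by (rule gegenbauer_sums[OF ab that])
  have Dpos: "D v > 0" if "v\<^sup>2 * b < 1" for v
  proof -
    have "(v * a)\<^sup>2 < 1"
      using that ab by (smt (verit) mult_left_mono power_mult_distrib zero_le_power2)
    then have "(1 - v * a) > 0"
      by (smt (verit) one_le_power)
    then have "0 < (1 - v * a)\<^sup>2"
      by simp
    also have "\<dots> \<le> D v"
      using mult_left_mono[OF ab, of "v\<^sup>2"] by (simp add: D_def power2_eq_square algebra_simps)
    finally show ?thesis .
  qed
  have op: "open {v. v\<^sup>2 * b < 1}"
    by (intro open_Collect_less continuous_intros)
  obtain K where K: "\<bar>t\<bar> < K" "K\<^sup>2 * b < 1"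
  proof -
    have "\<forall>\<^sub>F K in at_right \<bar>t\<bar>. K\<^sup>2 * b < 1"
    proof (rule order_tendstoD)
      show "((\<lambda>K. K\<^sup>2 * b) \<longlongrightarrow> \<bar>t\<bar>\<^sup>2 * b) (at_right \<bar>t\<bar>)"
        by (intro tendsto_intros)
    qed (use t in simp)
    moreover have "\<forall>\<^sub>F K in at_right \<bar>t\<bar>. \<bar>t\<bar> < K"
      by (simp add: eventually_at_filter)
    ultimately have "\<forall>\<^sub>F K in at_right \<bar>t\<bar>. \<bar>t\<bar> < K \<and> K\<^sup>2 * b < 1"
      by eventually_elim simp
    then show ?thesis
      using that eventually_happens'[OF trivial_limit_at_right_real] by blast
  qed
  have sK: "summable (\<lambda>n. c n * K ^ n)"
    using s[OF K(2)] by (simp add: sums_iff)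
  have d1: "((\<lambda>v. \<Sum>n. c n * v ^ n) has_real_derivative (\<Sum>n. diffs c n * t ^ n)) (at t)"
    by (rule termdiffs_strong[OF sK]) (use K in simp)
  have d2: "((\<lambda>v. \<Sum>n. c n * v ^ n) has_real_derivative (- l) * D t powr (- l - 1) * (2 * t * b - 2 * a)) (at t)"
  proof (rule has_field_derivative_transform_within_open[OF _ op])
    show "((\<lambda>v. D v powr (- l)) has_real_derivative (- l) * D t powr (- l - 1) * (2 * t * b - 2 * a)) (at t)"
      using Dpos[OF t] unfolding D_def by (auto intro!: derivative_eq_intros simp: algebra_simps)
  qed (use s t in \<open>auto simp: sums_iff\<close>)
  have e: "(\<Sum>n. diffs c n * t ^ n) = (- l) * D t powr (- l - 1) * (2 * t * b - 2 * a)"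
    by (rule DERIV_unique[OF d1 d2])
  have "summable (\<lambda>n. diffs c n * t ^ n)"
    by (rule termdiff_converges[where K = K]) (use K sK in \<open>auto intro: powser_inside\<close>)
  then have "(\<lambda>n. diffs c n * t ^ n) sums ((- l) * D t powr (- l - 1) * (2 * t * b - 2 * a))"
    using e by (simp add: sums_iff)
  from sums_mult[OF this, of t]
  have "(\<lambda>n. real (Suc n) * c (Suc n) * t ^ Suc n) sums (t * ((- l) * D t powr (- l - 1) * (2 * t * b - 2 * a)))"
    by (simp add: diffs_def mult_ac)
  then have "(\<lambda>n. real n * c n * t ^ n) sums (t * ((- l) * D t powr (- l - 1) * (2 * t * b - 2 * a)))"
    by (subst (asm) sums_Suc_iff) simp
  from sums_add[OF sums_divide[OF this, of l] s[OF t]]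
  have "(\<lambda>n. (real n + l) / l * c n * t ^ n) sums
     (t * ((- l) * D t powr (- l - 1) * (2 * t * b - 2 * a)) / l + D t powr (- l))"
    using l by (simp add: add_divide_distrib distrib_right)
  also have "D t powr (- l) = D t * D t powr (- l - 1)"
    using Dpos[OF t] powr_mult_base[of "D t" "- l - 1"] by simp
  also have "t * ((- l) * D t powr (- l - 1) * (2 * t * b - 2 * a)) / l + D t * D t powr (- l - 1)
     = (1 - t\<^sup>2 * b) * D t powr (- l - 1)"
  proof -
    have "t * ((- l) * E * (2 * t * b - 2 * a)) / l + (1 - 2 * t * a + t\<^sup>2 * b) * E = (1 - t\<^sup>2 * b) * E" for E
      using l by (simp add: power2_eq_square field_simps)
    then show ?thesis
      unfolding D_def .
  qed
  finally show ?thesis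
    unfolding c_def D_def .
qed

text \<open>The Gegenbauer polynomials as polynomials in \<open>a\<close> alone, in order to differentiate in \<open>a\<close> and to
  integrate monomial by monomial.\<close>

fun gegenbauer_poly :: "real \<Rightarrow> real \<Rightarrow> nat \<Rightarrow> real poly" where
  "gegenbauer_poly l b 0 = 1"
| "gegenbauer_poly l b (Suc 0) = [:0, 2 * l:]"
| "gegenbauer_poly l b (Suc (Suc k)) =
     smult (2 * (real k + 1 + l) / (real k + 2)) (pCons 0 (gegenbauer_poly l b (Suc k)))
     - smult ((real k + 2 * l) * b / (real k + 2)) (gegenbauer_poly l b k)"

lemma poly_gegenbauer_poly: "poly (gegenbauer_poly l b k) a = gegenbauer l a b k"
  by (induction l b k rule: gegenbauer_poly.induct) (simp_all add: diff_divide_distrib mult_ac)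

lemma gegenbauer_poly_deriv:
  "(b - a\<^sup>2) * poly (pderiv (gegenbauer_poly l b (Suc k))) a + (real k + 1) * (a * gegenbauer l a b (Suc k))
     = (real k + 2 * l) * b * gegenbauer l a b k"
proof -
  define Z where "Z = gegenbauer l a b"
  define D where "D = (\<lambda>k. poly (pderiv (gegenbauer_poly l b k)) a)"
  have D2: "(real k + 2) * D (Suc (Suc k)) = 2 * (real k + 1 + l) * (Z (Suc k) + a * D (Suc k)) - (real k + 2 * l) * b * D k" for k
  proof -
    have "D (Suc (Suc k)) = (2 * (real k + 1 + l) / (real k + 2)) * (Z (Suc k) + a * D (Suc k))
       - ((real k + 2 * l) * b / (real k + 2)) * D k"
      by (simp only: D_def Z_def gegenbauer_poly.simps pderiv_diff pderiv_smult pderiv_pCons poly_diff poly_smult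
          poly_add poly_pCons poly_gegenbauer_poly) simp
    moreover have "real k + 2 \<noteq> 0"
      by simp
    ultimately show ?thesis
      by (simp add: divide_simps) (simp add: algebra_simps)
  qed
  have Z2: "(real k + 2) * Z (Suc (Suc k)) = 2 * (real k + 1 + l) * (a * Z (Suc k)) - (real k + 2 * l) * (b * Z k)" for k
    by (simp add: Z_def)
  have "(b - a\<^sup>2) * D (Suc k) + (real k + 1) * (a * Z (Suc k)) = (real k + 2 * l) * b * Z k \<and>
     (b - a\<^sup>2) * D (Suc (Suc k)) + (real k + 2) * (a * Z (Suc (Suc k))) = (real k + 1 + 2 * l) * b * Z (Suc k)"
  proof (induction k)
    case 0
    have v: "D 0 = 0" "D (Suc 0) = 2 * l" "Z 0 = 1" "Z (Suc 0) = 2 * l * a"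
      by (simp_all add: D_def Z_def pderiv_pCons)
    have w: "D (Suc (Suc 0)) = 4 * a * l * (1 + l)" "Z (Suc (Suc 0)) = 2 * a\<^sup>2 * l * (1 + l) - l * b"
      using D2[of 0] Z2[of 0] v by (simp_all add: power2_eq_square algebra_simps)
    then show ?case
      by (simp only: v w of_nat_0) (simp add: power2_eq_square algebra_simps)
  next
    case (Suc k)
    have "(real k + 3) * ((b - a\<^sup>2) * D (Suc (Suc (Suc k))) + (real k + 3) * (a * Z (Suc (Suc (Suc k)))))
       = (real k + 3) * ((real k + 2 + 2 * l) * b * Z (Suc (Suc k)))"
      using Suc.IH D2[of "Suc k"] Z2[of "Suc k"] Z2[of k] unfolding of_nat_Suc by algebra
    moreover have "real k + 3 \<noteq> 0"
      by simp
    ultimately have "(b - a\<^sup>2) * D (Suc (Suc (Suc k))) + (real k + 3) * (a * Z (Suc (Suc (Suc k))))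
       = (real k + 2 + 2 * l) * b * Z (Suc (Suc k))"
      by (metis mult_left_cancel)
    then show ?case
      using Suc by (simp add: add_ac)
  qed
  then show ?thesis
    by (simp add: D_def Z_def)
qed

section \<open>Gradient and Laplacian of functions of class C2\<close>

text \<open>The regularity part of the condition on test functions, without the condition on the support.\<close>

definition C2 :: "(real^'n::finite \<Rightarrow> real) \<Rightarrow> bool" where
  "C2 f \<longleftrightarrow> (\<forall>z. f differentiable (at z)) \<and> (\<forall>i z. partial i f differentiable (at z)) \<and>
     (\<forall>i j. continuous_on UNIV (partial j (partial i f)))"

definition grad :: "(real^'n::finite \<Rightarrow> real) \<Rightarrow> real^'n \<Rightarrow> real^'n" where
  "grad f z = (\<chi> i. partial i f z)"

definition laplacian :: "(real^'n::finite \<Rightarrow> real) \<Rightarrow> real^'n \<Rightarrow> real" where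
  "laplacian f z = (\<Sum>i\<in>UNIV. partial i (partial i f) z)"

lemma hyp_laplacian_eq:
  fixes f :: "real^'n::finite \<Rightarrow> real"
  shows "hyp_laplacian f z = (1 - (norm z)\<^sup>2)\<^sup>2 * laplacian f z
     + 2 * (real CARD('n) - 2) * (1 - (norm z)\<^sup>2) * (z \<bullet> grad f z)"
  by (simp add: hyp_laplacian_def laplacian_def grad_def inner_vec_def)

lemma partial_eqI: "(f has_derivative D) (at z) \<Longrightarrow> partial i f z = D (axis i 1)"
  by (simp add: partial_def frechet_derivative_at[symmetric])

lemma differentiable_has_partials:
  "f differentiable (at z) \<Longrightarrow> (f has_derivative frechet_derivative f (at z)) (at z)"
  by (simp add: frechet_derivative_works)

lemma partial_mult:
  assumes "f differentiable (at z)" "g differentiable (at z)"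
  shows "partial i (\<lambda>z. f z * g z) z = f z * partial i g z + partial i f z * g z"
  using has_derivative_mult[OF assms[THEN differentiable_has_partials]]
  by (subst partial_eqI) (auto simp: partial_def)

lemma partial_add:
  assumes "f differentiable (at z)" "g differentiable (at z)"
  shows "partial i (\<lambda>z. f z + g z) z = partial i f z + partial i g z"
  using has_derivative_add[OF assms[THEN differentiable_has_partials]]
  by (subst partial_eqI) (auto simp: partial_def)

lemma partial_const [simp]: "partial i (\<lambda>z. c) = (\<lambda>z. 0)"
  by (rule ext, subst partial_eqI) (auto intro: derivative_eq_intros)

lemma C2_const: "C2 (\<lambda>z. c)"
  by (simp add: C2_def)

lemma C2_continuous:
  assumes "C2 f"
  shows "continuous_on UNIV f" "continuous_on UNIV (partial i f)"
  using assms unfolding C2_def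
  by (meson differentiable_imp_continuous_within continuous_at_imp_continuous_on)+

lemma C2_mult:
  assumes "C2 f" "C2 g"
  shows "C2 (\<lambda>z. f z * g z)"
proof -
  have d: "f differentiable (at z)" "g differentiable (at z)"
    "partial i f differentiable (at z)" "partial i g differentiable (at z)" for i z
    using assms by (auto simp: C2_def)
  have c: "continuous_on UNIV (partial j (partial i f))" "continuous_on UNIV (partial j (partial i g))" for i j
    using assms by (auto simp: C2_def)
  have p: "partial i (\<lambda>z. f z * g z) = (\<lambda>z. f z * partial i g z + partial i f z * g z)" for i
    by (rule ext, rule partial_mult) (auto simp: d)
  have pp: "partial j (\<lambda>z. f z * partial i g z + partial i f z * g z) = (\<lambda>z. (f z * partial j (partial i g) z
     + partial j f z * partial i g z) + (partial i f z * partial j g z + partial j (partial i f) z * g z))" for i j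
    by (rule ext, subst partial_add) (auto simp: d partial_mult)
  show ?thesis
    unfolding C2_def p pp by (auto simp: d intro!: continuous_intros C2_continuous[OF assms(1)] C2_continuous[OF assms(2)] c)
qed

lemma C2_add:
  assumes "C2 f" "C2 g"
  shows "C2 (\<lambda>z. f z + g z)"
proof -
  have d: "f differentiable (at z)" "g differentiable (at z)"
    "partial i f differentiable (at z)" "partial i g differentiable (at z)" for i z
    using assms by (auto simp: C2_def)
  have c: "continuous_on UNIV (partial j (partial i f))" "continuous_on UNIV (partial j (partial i g))" for i j
    using assms by (auto simp: C2_def)
  have p: "partial i (\<lambda>z. f z + g z) = (\<lambda>z. partial i f z + partial i g z)" for i
    by (rule ext, rule partial_add) (auto simp: d)
  have pp: "partial j (\<lambda>z. partial i f z + partial i g z) = (\<lambda>z. partial j (partial i f) z + partial j (partial i g) z)" for i j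
    by (rule ext, subst partial_add) (auto simp: d)
  show ?thesis
    unfolding C2_def p pp by (auto simp: d intro!: continuous_intros c)
qed

lemma grad_mult:
  assumes "C2 f" "C2 g"
  shows "grad (\<lambda>z. f z * g z) z = f z *\<^sub>R grad g z + g z *\<^sub>R grad f z"
  using assms by (simp add: grad_def vec_eq_iff partial_mult C2_def)

lemma grad_add:
  assumes "C2 f" "C2 g"
  shows "grad (\<lambda>z. f z + g z) z = grad f z + grad g z"
  using assms by (simp add: grad_def vec_eq_iff partial_add C2_def)

lemma grad_const [simp]: "grad (\<lambda>z. c) z = 0"
  by (simp add: grad_def vec_eq_iff)

lemma laplacian_const [simp]: "laplacian (\<lambda>z. c) z = 0"
  by (simp add: laplacian_def)

lemma laplacian_mult:
  assumes "C2 f" "C2 g"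
  shows "laplacian (\<lambda>z. f z * g z) z = f z * laplacian g z + g z * laplacian f z + 2 * (grad f z \<bullet> grad g z)"
proof -
  have d: "f differentiable (at z)" "g differentiable (at z)"
    "partial i f differentiable (at z)" "partial i g differentiable (at z)" for i z
    using assms by (auto simp: C2_def)
  have p: "partial i (\<lambda>z. f z * g z) = (\<lambda>z. f z * partial i g z + partial i f z * g z)" for i
    by (rule ext, rule partial_mult) (auto simp: d)
  have pp: "partial j (\<lambda>z. f z * partial i g z + partial i f z * g z) = (\<lambda>z. (f z * partial j (partial i g) z
     + partial j f z * partial i g z) + (partial i f z * partial j g z + partial j (partial i f) z * g z))" for i j
    by (rule ext, subst partial_add) (auto simp: d partial_mult)
  show ?thesis
    unfolding laplacian_def p pp
    by (simp add: grad_def inner_vec_def sum.distrib sum_distrib_left algebra_simps)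
qed

lemma laplacian_add:
  assumes "C2 f" "C2 g"
  shows "laplacian (\<lambda>z. f z + g z) z = laplacian f z + laplacian g z"
proof -
  have d: "f differentiable (at z)" "g differentiable (at z)"
    "partial i f differentiable (at z)" "partial i g differentiable (at z)" for i z
    using assms by (auto simp: C2_def)
  have p: "partial i (\<lambda>z. f z + g z) = (\<lambda>z. partial i f z + partial i g z)" for i
    by (rule ext, rule partial_add) (auto simp: d)
  show ?thesis
    unfolding laplacian_def p by (subst partial_add) (auto simp: d sum.distrib)
qed

lemma partial_inner: "partial i (\<lambda>z. e \<bullet> z) = (\<lambda>z. e $ i)"
  proof
  show "partial i (\<lambda>z. e \<bullet> z) z = e $ i" for z
    using partial_eqI[of "\<lambda>z. e \<bullet> z" "\<lambda>z. e \<bullet> z" z i]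
    by (simp add: inner_axis bounded_linear_imp_has_derivative bounded_linear_inner_right)
qed

lemma C2_inner: "C2 (\<lambda>z. e \<bullet> z)"
  unfolding C2_def partial_inner by (auto intro!: derivative_intros)

lemma grad_inner [simp]: "grad (\<lambda>z. e \<bullet> z) z = e"
  by (simp add: grad_def partial_inner vec_eq_iff)

lemma laplacian_inner [simp]: "laplacian (\<lambda>z. e \<bullet> z) z = 0"
  by (simp add: laplacian_def partial_inner)

text \<open>The domain \<open>s > -1\<close> is an open neighbourhood of the values of \<open>|z|\<^sup>2\<close> on which profiles built from a power
  series with radius of convergence \<open>1\<close> are defined.\<close>

lemma radial_calculus:
  fixes p p' p'' :: "real \<Rightarrow> real"
  assumes p: "\<And>s. s > -1 \<Longrightarrow> (p has_real_derivative p' s) (at s)"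
    and p': "\<And>s. s > -1 \<Longrightarrow> (p' has_real_derivative p'' s) (at s)"
    and c: "continuous_on {-1<..} p''"
  shows "C2 (\<lambda>z::real^'n::finite. p ((norm z)\<^sup>2))"
    and "grad (\<lambda>z::real^'n. p ((norm z)\<^sup>2)) z = (2 * p' ((norm z)\<^sup>2)) *\<^sub>R z"
    and "laplacian (\<lambda>z::real^'n. p ((norm z)\<^sup>2)) z
      = 4 * (norm z)\<^sup>2 * p'' ((norm z)\<^sup>2) + 2 * real CARD('n) * p' ((norm z)\<^sup>2)"
proof -
  have s: "(norm z)\<^sup>2 > -1" for z :: "real^'n"
    by (rule less_le_trans[of _ 0]) auto
  have D: "((\<lambda>z::real^'n. q ((norm z)\<^sup>2)) has_derivative (\<lambda>h. (2 * (z \<bullet> h)) * q')) (at z)"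
    if "(q has_real_derivative q') (at ((norm z)\<^sup>2))" for q q' z
  proof -
    have "((\<lambda>z. z \<bullet> z) has_derivative (\<lambda>h. 2 * (z \<bullet> h))) (at z)"
      by (auto intro!: derivative_eq_intros simp: inner_commute)
    with that have "(q \<circ> (\<lambda>z. z \<bullet> z) has_derivative (\<lambda>h. q' * h) \<circ> (\<lambda>h. 2 * (z \<bullet> h))) (at z)"
      by (intro diff_chain_at) (auto simp: has_field_derivative_def power2_norm_eq_inner)
    then show ?thesis
      by (simp add: o_def power2_norm_eq_inner mult_ac)
  qed
  have 1: "partial i (\<lambda>z::real^'n. p ((norm z)\<^sup>2)) = (\<lambda>z. p' ((norm z)\<^sup>2) * (2 * z $ i))" for i
    by (rule ext, subst partial_eqI[OF D[OF p[OF s]]]) (simp add: inner_axis)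
  have d1: "(\<lambda>z::real^'n. p' ((norm z)\<^sup>2)) differentiable (at z)" for z
    using D[OF p'[OF s]] by (auto simp: differentiable_def)
  have d0: "(\<lambda>z::real^'n. p ((norm z)\<^sup>2)) differentiable (at z)" for z
    using D[OF p[OF s]] by (auto simp: differentiable_def)
  have dc: "(\<lambda>z::real^'n. 2 * z $ i) differentiable (at z)" for z i
    by (auto intro!: derivative_intros bounded_linear_imp_differentiable bounded_linear_vec_nth)
  have pc: "partial j (\<lambda>z::real^'n. 2 * z $ i) = (\<lambda>z. if i = j then 2 else 0)" for i j
  proof
    have "((\<lambda>z::real^'n. 2 * z $ i) has_derivative (\<lambda>z. 2 * z $ i)) (at z)" for z
      by (intro bounded_linear_imp_has_derivative bounded_linear_const_mult bounded_linear_vec_nth)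
    from partial_eqI[OF this]
    show "partial j (\<lambda>z::real^'n. 2 * z $ i) z = (if i = j then 2 else 0)" for z
      by (simp add: axis_def)
  qed
  have 2: "partial j (\<lambda>z::real^'n. p' ((norm z)\<^sup>2) * (2 * z $ i)) =
     (\<lambda>z. p' ((norm z)\<^sup>2) * (if i = j then 2 else 0) + p'' ((norm z)\<^sup>2) * (2 * z $ j) * (2 * z $ i))" for i j
    by (rule ext, subst partial_mult[OF d1 dc])
      (auto simp: pc partial_eqI[OF D[OF p'[OF s]]] inner_axis)
  have c2: "continuous_on UNIV (\<lambda>z::real^'n. p'' ((norm z)\<^sup>2))"
    by (rule continuous_on_compose2[OF c]) (auto intro!: continuous_intros simp: s)
  have c1: "continuous_on UNIV (\<lambda>z::real^'n. p' ((norm z)\<^sup>2))"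
    using d1 by (meson differentiable_imp_continuous_within continuous_at_imp_continuous_on)
  show "C2 (\<lambda>z::real^'n. p ((norm z)\<^sup>2))"
    unfolding C2_def 1 2 by (intro conjI allI differentiable_mult continuous_intros c1 c2 d0 d1 dc)
  show "grad (\<lambda>z::real^'n. p ((norm z)\<^sup>2)) z = (2 * p' ((norm z)\<^sup>2)) *\<^sub>R z"
    by (simp add: grad_def 1 vec_eq_iff)
  show "laplacian (\<lambda>z::real^'n. p ((norm z)\<^sup>2)) z
      = 4 * (norm z)\<^sup>2 * p'' ((norm z)\<^sup>2) + 2 * real CARD('n) * p' ((norm z)\<^sup>2)"
    unfolding laplacian_def 1 2
    by (simp add: sum.distrib power2_norm_eq_inner inner_vec_def sum_distrib_left mult_ac)
qed

lemmas norm2_calculus = radial_calculus[of "\<lambda>s. s" "\<lambda>s. 1" "\<lambda>s. 0", simplified]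

lemma gegenbauer_vec_step:
  "(\<lambda>z. gegenbauer l (e \<bullet> z) ((norm z)\<^sup>2) (Suc (Suc k))) =
     (\<lambda>z. (2 * (real k + 1 + l) / (real k + 2)) * ((e \<bullet> z) * gegenbauer l (e \<bullet> z) ((norm z)\<^sup>2) (Suc k))
        + - ((real k + 2 * l) / (real k + 2)) * ((norm z)\<^sup>2 * gegenbauer l (e \<bullet> z) ((norm z)\<^sup>2) k))"
  by (rule ext) (simp add: diff_divide_distrib)

section \<open>Zonal harmonic polynomials\<close>

text \<open>All derivatives are controlled by the recurrence. Applying the Laplacian to it, the terms combine to
  a multiple of \<open>e \<bullet> grad Z\<^bsub>k+1\<^esub> - (k + 2l) Z\<^sub>k\<close>, and exactly in dimension \<open>2l + 2\<close>; so harmonicity, homogeneity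
  (Euler's identity) and the formula for the derivative along the axis are proved in one induction.\<close>

lemma gegenbauer_harmonic:
  fixes e :: "real^'n::finite"
  assumes e: "norm e = 1" and l: "real CARD('n) = 2 * l + 2"
  defines "Z \<equiv> (\<lambda>k (z::real^'n). gegenbauer l (e \<bullet> z) ((norm z)\<^sup>2) k)"
  shows "C2 (Z k) \<and> C2 (Z (Suc k)) \<and>
     (\<forall>z. z \<bullet> grad (Z k) z = real k * Z k z) \<and> (\<forall>z. z \<bullet> grad (Z (Suc k)) z = real (Suc k) * Z (Suc k) z) \<and>
     (\<forall>z. laplacian (Z k) z = 0) \<and> (\<forall>z. laplacian (Z (Suc k)) z = 0) \<and>
     (\<forall>z. e \<bullet> grad (Z (Suc k)) z = (real k + 2 * l) * Z k z) \<and>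
     (\<forall>z. k > 0 \<longrightarrow> e \<bullet> grad (Z k) z = (real k - 1 + 2 * l) * Z (k - 1) z)"
proof (induction k)
  case 0
  have "Z 0 = (\<lambda>z. 1)" "Z (Suc 0) = (\<lambda>z. (2 * l) * (e \<bullet> z))"
    by (auto simp: Z_def)
  moreover have "e \<bullet> e = 1"
    using e by (simp add: norm_eq_1)
  moreover have "grad (\<lambda>z. (2 * l) * (e \<bullet> z)) z = (2 * l) *\<^sub>R e" for z
    by (simp add: C2_const C2_inner grad_mult)
  ultimately show ?case
    by (simp add: C2_const C2_mult C2_inner laplacian_mult) (simp add: inner_commute)
next
  case (Suc k)
  define A where "A = 2 * (real k + 1 + l) / (real k + 2)"
  define B where "B = - ((real k + 2 * l) / (real k + 2))"
  have ee: "e \<bullet> e = 1"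
    using e by (simp add: norm_eq_1)
  have Z2: "Z (Suc (Suc k)) = (\<lambda>z. A * ((e \<bullet> z) * Z (Suc k) z) + B * ((norm z)\<^sup>2 * Z k z))"
    unfolding Z_def A_def B_def by (rule gegenbauer_vec_step)
  have IH: "C2 (Z k)" "C2 (Z (Suc k))" "\<And>z. z \<bullet> grad (Z k) z = real k * Z k z"
     "\<And>z. z \<bullet> grad (Z (Suc k)) z = real (Suc k) * Z (Suc k) z"
     "\<And>z. laplacian (Z k) z = 0" "\<And>z. laplacian (Z (Suc k)) z = 0"
     "\<And>z. e \<bullet> grad (Z (Suc k)) z = (real k + 2 * l) * Z k z"
     "\<And>z. k > 0 \<Longrightarrow> e \<bullet> grad (Z k) z = (real k - 1 + 2 * l) * Z (k - 1) z"
    using Suc.IH by auto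
  have C: "C2 (\<lambda>z. (e \<bullet> z) * Z (Suc k) z)" "C2 (\<lambda>z. (norm z)\<^sup>2 * Z k z)"
    "C2 (\<lambda>z. A * ((e \<bullet> z) * Z (Suc k) z))" "C2 (\<lambda>z. B * ((norm z)\<^sup>2 * Z k z))" "C2 (Z (Suc (Suc k)))"
    unfolding Z2 by (intro C2_mult C2_add C2_const C2_inner norm2_calculus IH)+
  have G: "grad (Z (Suc (Suc k))) z = A *\<^sub>R ((e \<bullet> z) *\<^sub>R grad (Z (Suc k)) z + Z (Suc k) z *\<^sub>R e)
      + B *\<^sub>R ((norm z)\<^sup>2 *\<^sub>R grad (Z k) z + (2 * Z k z) *\<^sub>R z)" for z
    unfolding Z2
    by (simp add: grad_add grad_mult C C2_const C2_inner IH norm2_calculus mult.commute[of 2])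
  have L: "laplacian (Z (Suc (Suc k))) z = A * (2 * (real k + 2 * l) * Z k z)
      + B * (2 * real CARD('n) * Z k z + 4 * real k * Z k z)" for z
    unfolding Z2
    by (simp add: laplacian_add laplacian_mult C C2_const C2_inner IH norm2_calculus inner_commute[of z])
      (simp add: IH algebra_simps)
  have k2: "real k + 2 \<noteq> 0"
    by simp
  have 1: "laplacian (Z (Suc (Suc k))) z = 0" for z
    unfolding L l A_def B_def using k2 by (simp add: divide_simps) (simp add: algebra_simps)
  have 2: "z \<bullet> grad (Z (Suc (Suc k))) z = real (Suc (Suc k)) * Z (Suc (Suc k)) z" for z
    unfolding G unfolding Z2 by (simp add: inner_add_right IH power2_norm_eq_inner inner_commute[of z e]) (simp add: algebra_simps)
  have 3: "e \<bullet> grad (Z (Suc (Suc k))) z = (real (Suc k) + 2 * l) * Z (Suc k) z" for z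
  proof (cases k)
    case 0
    have Z0: "Z 0 = (\<lambda>z. 1)" and Z1: "Z (Suc 0) z = 2 * l * (e \<bullet> z)"
      by (auto simp: Z_def)
    have "e \<bullet> grad (Z (Suc (Suc k))) z = A * ((e \<bullet> z) * (2 * l) + 2 * l * (e \<bullet> z)) + B * (2 * (e \<bullet> z))"
      unfolding G using IH(7)[of z] by (simp add: inner_add_right ee Z0 Z1 0)
    moreover have "A = 1 + l" "B = - l"
      by (auto simp: A_def B_def 0)
    ultimately show ?thesis
      by (simp add: Z1 0 algebra_simps)
  next
    case (Suc m)
    have k0: "0 < k"
      using Suc by simp
    have r: "(real k + 1) * Z (Suc k) z = 2 * (real k + l) * ((e \<bullet> z) * Z k z) - (real k - 1 + 2 * l) * ((norm z)\<^sup>2 * Z (k - 1) z)"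
      unfolding Suc Z_def by (simp add: field_simps)
    have "e \<bullet> grad (Z (Suc (Suc k))) z = A * ((e \<bullet> z) * ((real k + 2 * l) * Z k z) + Z (Suc k) z)
       + B * ((norm z)\<^sup>2 * ((real k - 1 + 2 * l) * Z (k - 1) z) + 2 * Z k z * (e \<bullet> z))"
      unfolding G by (simp add: inner_add_right IH(7) IH(8)[OF k0] ee)
    also have "(real k + 2) * \<dots> = 2 * (real k + 1 + l) * Z (Suc k) z + (real k + 2 * l) *
        (2 * (real k + l) * ((e \<bullet> z) * Z k z) - (real k - 1 + 2 * l) * ((norm z)\<^sup>2 * Z (k - 1) z))"
      unfolding A_def B_def using k2 by (simp add: divide_simps) (simp add: algebra_simps)
    also have "\<dots> = (real k + 2) * ((real (Suc k) + 2 * l) * Z (Suc k) z)"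
      unfolding r[symmetric] by (simp add: algebra_simps)
    finally show ?thesis
      using k2 by (metis mult_left_cancel)
  qed
  show ?case
    using C(5) IH 1 2 3 by auto
qed

section \<open>Hypergeometric series and harmonic functions for the Laplace--Beltrami operator\<close>

text \<open>A real formal power series, so that the hypergeometric equation can be checked coefficientwise and
  then evaluated.\<close>

definition hypergeo_fps :: "real \<Rightarrow> real \<Rightarrow> real \<Rightarrow> real fps" where
  "hypergeo_fps a b c = Abs_fps (\<lambda>i. pochhammer a i * pochhammer b i / (pochhammer c i * fact i))"

lemma summable_hypergeo_fps:
  assumes "c > 0" "\<bar>s\<bar> < 1"
  shows "summable (\<lambda>i. fps_nth (hypergeo_fps a b c) i * s ^ i)"
proof -
  have "complex_of_real c \<notin> \<int>\<^sub>\<le>\<^sub>0"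
    using assms(1) by (auto elim!: nonpos_Ints_cases simp: complex_eq_iff)
  then have "summable (\<lambda>i. pochhammer (of_real a) i * pochhammer (of_real b) i /
     (pochhammer (of_real c) i * fact i) * (of_real s :: complex) ^ i)"
    using assms by (intro summable_hypergeo) auto
  also have "(\<lambda>i. pochhammer (of_real a) i * pochhammer (of_real b) i /
     (pochhammer (of_real c) i * fact i) * (of_real s :: complex) ^ i) =
     (\<lambda>i. of_real (fps_nth (hypergeo_fps a b c) i * s ^ i))"
    by (simp add: hypergeo_fps_def pochhammer_of_real)
  finally show ?thesis
    by (simp only: summable_complex_of_real)
qed

lemma conv_radius_hypergeo_fps:
  assumes "c > 0"
  shows "fps_conv_radius (hypergeo_fps a b c) \<ge> 1"
  unfolding fps_conv_radius_def
  by (rule conv_radius_geI_ex') (use summable_hypergeo_fps[OF assms] in auto)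

lemma F_k_of_nat:
  assumes "\<bar>s\<bar> < 1" "n > 0"
  shows "F_k n (of_nat k) s = of_real (eval_fps (hypergeo_fps (real k) (- rho n) (real k + real n / 2)) s)"
proof -
  have c: "real k + real n / 2 > 0"
    using assms by (simp add: add_nonneg_pos)
  have e: "pochhammer (of_nat k) i * pochhammer (- of_real (rho n)) i / (pochhammer (of_nat k + of_nat n / 2) i * fact i)
      * complex_of_real s ^ i
     = of_real (fps_nth (hypergeo_fps (real k) (- rho n) (real k + real n / 2)) i * s ^ i)" for i
    using pochhammer_of_real[of "real k + real n / 2" i, where ?'a = complex]
      pochhammer_of_real[of "real k" i, where ?'a = complex]
      pochhammer_of_real[of "- rho n" i, where ?'a = complex]
    by (simp add: hypergeo_fps_def)
  show ?thesis
    unfolding F_k_def hypergeo_F_def e eval_fps_def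
    by (rule suminf_of_real[symmetric]) (rule summable_hypergeo_fps[OF c assms(1)])
qed

lemma hypergeo_fps_ode:
  assumes "c > 0"
  shows "fps_X * (1 - fps_X) * fps_deriv (fps_deriv (hypergeo_fps a b c))
     + (fps_const c - fps_const (a + b + 1) * fps_X) * fps_deriv (hypergeo_fps a b c)
     = fps_const (a * b) * hypergeo_fps a b c"
proof (rule fps_ext)
  fix m
  define h where "h = fps_nth (hypergeo_fps a b c)"
  have "pochhammer c (Suc i) \<noteq> 0" for i
    using assms pochhammer_pos[of c "Suc i"] by auto
  then have rec: "(real i + 1) * ((c + real i) * h (Suc i)) = (a + real i) * (b + real i) * h i" for i
    by (simp add: h_def hypergeo_fps_def pochhammer_Suc divide_simps)

  show "fps_nth (fps_X * (1 - fps_X) * fps_deriv (fps_deriv (hypergeo_fps a b c))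
     + (fps_const c - fps_const (a + b + 1) * fps_X) * fps_deriv (hypergeo_fps a b c)) m
     = fps_nth (fps_const (a * b) * hypergeo_fps a b c) m"
    using rec[of m]
    by (cases m; cases "m - 1") (simp_all add: h_def[symmetric] algebra_simps fps_mult_fps_X_nonzero)
qed

lemma hypergeo_ode:
  fixes a b c s :: real
  assumes c: "c > 0" and s: "\<bar>s\<bar> < 1"
  defines "H \<equiv> hypergeo_fps a b c"
  shows "s * (1 - s) * eval_fps (fps_deriv (fps_deriv H)) s + (c - (a + b + 1) * s) * eval_fps (fps_deriv H) s
     = a * b * eval_fps H s"
proof -
  have R: "fps_conv_radius H \<ge> 1" "fps_conv_radius (fps_deriv H) \<ge> 1" "fps_conv_radius (fps_deriv (fps_deriv H)) \<ge> 1"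
    using conv_radius_hypergeo_fps[OF c, of a b] fps_conv_radius_deriv[of H] fps_conv_radius_deriv[of "fps_deriv H"]
    by (auto simp: H_def intro: order_trans)
  define r where "r = (\<lambda>f :: real fps. ereal (norm s) < fps_conv_radius f)"
  have r0: "r H" "r (fps_deriv H)" "r (fps_deriv (fps_deriv H))" "r fps_X" "r 1" "r (fps_const x)" for x
    using s R by (auto simp: r_def intro: less_le_trans[of "ereal \<bar>s\<bar>" 1])
  have closed: "r (f * g)" "r (f + g)" "r (f - g)" if "r f" "r g" for f g
    using that unfolding r_def
    by (auto intro!: less_le_trans[OF _ fps_conv_radius_mult] less_le_trans[OF _ fps_conv_radius_add]
        less_le_trans[OF _ fps_conv_radius_diff])
  have ev: "eval_fps (f * g) s = eval_fps f s * eval_fps g s" "eval_fps (f + g) s = eval_fps f s + eval_fps g s"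
     "eval_fps (f - g) s = eval_fps f s - eval_fps g s" if "r f" "r g" for f g
    using that unfolding r_def by (auto simp: eval_fps_mult eval_fps_add eval_fps_diff)
  have "eval_fps (fps_X * (1 - fps_X) * fps_deriv (fps_deriv H)
     + (fps_const c - fps_const (a + b + 1) * fps_X) * fps_deriv H) s = eval_fps (fps_const (a * b) * H) s"
    unfolding H_def hypergeo_fps_ode[OF c] ..
  then show ?thesis
    by (simp add: ev r0 closed del: fps_const_add fps_const_mult)
qed

lemma DERIV_zero_quadratic:
  fixes f :: "real \<Rightarrow> real"
  assumes "f 0 = 0" "\<And>h. \<bar>h\<bar> < 1 \<Longrightarrow> \<bar>f h\<bar> \<le> h\<^sup>2"
  shows "(f has_real_derivative 0) (at 0)"
proof -
  have "((\<lambda>h. f h / h) \<longlongrightarrow> 0) (at 0)"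
  proof (rule tendsto_sandwich[of "\<lambda>h. - \<bar>h\<bar>" _ _ "\<lambda>h. \<bar>h\<bar>"])
    have "\<forall>\<^sub>F h::real in at 0. \<bar>h\<bar> < 1 \<and> h \<noteq> 0"
      by (auto simp: eventually_at dist_real_def intro!: exI[of _ 1])
    then have *: "\<forall>\<^sub>F h in at 0. \<bar>f h / h\<bar> \<le> \<bar>h\<bar>"
    proof eventually_elim
      case (elim h)
      then show ?case
        using assms(2)[of h] by (simp add: divide_simps power2_eq_square abs_mult[symmetric])
    qed
    show "\<forall>\<^sub>F h in at 0. - \<bar>h\<bar> \<le> f h / h" "\<forall>\<^sub>F h in at 0. f h / h \<le> \<bar>h\<bar>"
      by (rule eventually_mono[OF *], linarith)+
  qed (auto intro!: tendsto_eq_intros)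
  then show ?thesis
    using assms(1) by (simp add: DERIV_def)
qed

lemma DERIV_pos_part_power:
  assumes "m \<ge> 2"
  shows "((\<lambda>y. (max 0 y) ^ m) has_real_derivative real m * (max 0 y) ^ (m - 1)) (at y)"
proof -
  consider "y > 0" | "y < 0" | "y = 0" by linarith
  then show ?thesis
  proof cases
    case 1
    have "((\<lambda>y. y ^ m) has_real_derivative real m * y ^ (m - 1)) (at y)"
      by (auto intro!: derivative_eq_intros)
    then have "((\<lambda>y. (max 0 y) ^ m) has_real_derivative real m * y ^ (m - 1)) (at y)"
      by (rule has_field_derivative_transform_within_open[of _ _ _ "{0<..}"]) (use 1 in auto)
    then show ?thesis
      using 1 by simp
  next
    case 2
    have "((\<lambda>y. 0) has_real_derivative 0) (at y)"
      by simp
    then have "((\<lambda>y. (max 0 y) ^ m) has_real_derivative 0) (at y)"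
      by (rule has_field_derivative_transform_within_open[of _ _ _ "{..<0}"]) (use 2 assms in \<open>auto simp: zero_power\<close>)
    then show ?thesis
      using 2 assms by (simp add: zero_power)
  next
    case 3
    have "\<bar>(max 0 h) ^ m\<bar> \<le> h\<^sup>2" if "\<bar>h\<bar> < 1" for h :: real
    proof (cases "h \<le> 0")
      case False
      then have "h ^ m \<le> h ^ 2"
        using that assms by (intro power_decreasing) auto
      then show ?thesis
        using False by simp
    qed (use assms in \<open>auto simp: zero_power max_def\<close>)
    then have "((\<lambda>y. (max 0 y) ^ m) has_real_derivative 0) (at 0)"
      using assms by (intro DERIV_zero_quadratic) (auto simp: zero_power)
    then show ?thesis
      using 3 assms by (simp add: zero_power)
  qed
qed

text \<open>Test functions must have compact support in the unit ball, and the hypergeometric series converges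
  only for \<open>|s| < 1\<close>. The profile is multiplied by \<open>(1 - t\<^sup>3)\<^sup>3\<close>, \<open>t\<close> being the position between \<open>R\<close> and \<open>b\<close>, with negative
  parts truncated to zero. Cubes of positive parts are of class C2. Agreement
  up to and including \<open>R\<close> suffices, since the process is stopped on the closed ball.\<close>

lemma C2_cutoff:
  fixes f f' f'' :: "real \<Rightarrow> real"
  assumes R: "0 < R" "R < b" "b < 1"
    and f: "\<And>s. \<bar>s\<bar> < 1 \<Longrightarrow> (f has_real_derivative f' s) (at s)"
    and f': "\<And>s. \<bar>s\<bar> < 1 \<Longrightarrow> (f' has_real_derivative f'' s) (at s)"
    and c: "continuous_on {-1<..<1} f''"
  obtains p p' p'' where "\<And>s. s > -1 \<Longrightarrow> (p has_real_derivative p' s) (at s)"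
    "\<And>s. s > -1 \<Longrightarrow> (p' has_real_derivative p'' s) (at s)" "continuous_on {-1<..} p''"
    "\<And>s. s \<le> R \<Longrightarrow> p s = f s \<and> p' s = f' s \<and> p'' s = f'' s" "\<And>s. b \<le> s \<Longrightarrow> p s = 0"
proof -
  define d where "d = 1 / (b - R)"
  define w where "w = (\<lambda>s. (s - R) * d)"
  define g g' g'' where "g = (\<lambda>s. (max 0 (w s)) ^ 3)" and "g' = (\<lambda>s. 3 * (max 0 (w s)) ^ 2 * d)"
    and "g'' = (\<lambda>s. 6 * max 0 (w s) * d\<^sup>2)"
  define q q' q'' where "q = (\<lambda>s. (max 0 (1 - g s)) ^ 3)" and "q' = (\<lambda>s. - (3 * (max 0 (1 - g s)) ^ 2 * g' s))"
    and "q'' = (\<lambda>s. 6 * max 0 (1 - g s) * (g' s)\<^sup>2 - 3 * (max 0 (1 - g s)) ^ 2 * g'' s)"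
  have w: "(w has_real_derivative d) (at s)" for s
    unfolding w_def by (auto intro!: derivative_eq_intros)
  have P3: "((\<lambda>s. (max 0 (h s)) ^ 3) has_real_derivative 3 * (max 0 (h s)) ^ 2 * h') (at s)"
    if "(h has_real_derivative h') (at s)" for h h' and s :: real
    using DERIV_chain2[OF DERIV_pos_part_power[of 3 "h s"] that] by simp
  have P2: "((\<lambda>s. (max 0 (h s)) ^ 2) has_real_derivative 2 * max 0 (h s) * h') (at s)"
    if "(h has_real_derivative h') (at s)" for h h' and s :: real
    using DERIV_chain2[OF DERIV_pos_part_power[of 2 "h s"] that] by simp
  have g: "(g has_real_derivative g' s) (at s)" for s
    unfolding g_def g'_def by (rule P3[OF w])
  have g': "(g' has_real_derivative g'' s) (at s)" for s
    unfolding g'_def g''_def by (rule derivative_eq_intros P2[OF w] refl)+ (simp add: power2_eq_square)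
  have g1: "((\<lambda>s. 1 - g s) has_real_derivative - g' s) (at s)" for s
    using DERIV_diff[OF DERIV_const g] by simp
  have q: "(q has_real_derivative q' s) (at s)" for s
    using P3[OF g1] by (simp add: q_def q'_def)
  have q': "(q' has_real_derivative q'' s) (at s)" for s
    unfolding q'_def q''_def
    by (rule derivative_eq_intros P2[OF g1] g' refl)+ (simp add: power2_eq_square)
  have cq: "continuous_on A q''" for A
    unfolding q''_def g'_def g''_def g_def w_def by (intro continuous_intros)
  have z: "q s = 0 \<and> q' s = 0 \<and> q'' s = 0" if "b \<le> s" for s
  proof -
    have "w s \<ge> 1"
      using that R by (simp add: w_def d_def divide_simps)
    then have "g s \<ge> 1"
      by (simp add: g_def)
    then show ?thesis
      by (simp add: q_def q'_def q''_def)
  qed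
  have o: "q s = 1 \<and> q' s = 0 \<and> q'' s = 0" if "s \<le> R" for s
  proof -
    have "w s \<le> 0"
      using that R by (simp add: w_def d_def divide_simps)
    then show ?thesis
      by (simp add: q_def q'_def q''_def g_def g'_def g''_def)
  qed
  define p p' p'' where "p = (\<lambda>s. q s * f s)" and "p' = (\<lambda>s. q' s * f s + q s * f' s)"
    and "p'' = (\<lambda>s. q'' s * f s + 2 * q' s * f' s + q s * f'' s)"
  show ?thesis
  proof (rule that[of p p' p''])
    have zd: "(h has_real_derivative 0) (at s)" if "s > b" "\<And>s. b \<le> s \<Longrightarrow> h s = 0" for h and s :: real
      by (rule has_field_derivative_transform_within_open[of "\<lambda>s. 0" _ _ "{b<..}"]) (use that in auto)
    have zz: "p s = 0" "p' s = 0" "p'' s = 0" if "b \<le> s" for s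
      using z[OF that] by (auto simp: p_def p'_def p''_def)
    show "(p has_real_derivative p' s) (at s)" if "s > -1" for s
    proof (cases "s < 1")
      case True
      then have "\<bar>s\<bar> < 1" using that by auto
      then show ?thesis
        using DERIV_mult[OF q[of s] f[of s]] unfolding p_def p'_def by (simp add: mult.commute)
    next
      case False
      then show ?thesis
        using zd[of s p] zz R by auto
    qed
    show "(p' has_real_derivative p'' s) (at s)" if "s > -1" for s
    proof (cases "s < 1")
      case True
      then have "\<bar>s\<bar> < 1" using that by auto
      then show ?thesis
        using DERIV_add[OF DERIV_mult[OF q'[of s] f[of s]] DERIV_mult[OF q[of s] f'[of s]]]
          unfolding p'_def p''_def by (simp add: algebra_simps)
    next
      case False
      then show ?thesis
        using zd[of s p'] zz R by auto
    qed
    have cd: "continuous_on A h" if "\<And>s. s \<in> A \<Longrightarrow> (h has_real_derivative h' s) (at s)" for h h' and A :: "real set"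
      using that by (meson DERIV_isCont continuous_at_imp_continuous_on)
    have "continuous_on {-1<..<1} p''"
      unfolding p''_def
      by (intro continuous_intros cq c cd[of _ q' q''] cd[of _ q q'] cd[of _ f f'] cd[of _ f' f''] q q' f f') auto
    moreover have "continuous_on {b<..} p''"
      using zz by (subst continuous_on_cong[of _ "{b<..}" _ "\<lambda>_. 0"]) auto
    moreover have "{-1<..} = {-1<..<1} \<union> {b<..}"
      using R by auto
    ultimately show "continuous_on {-1<..} p''"
      using continuous_on_open_Un[of "{-1<..<1}" "{b<..}" p''] by (simp only: open_greaterThan open_greaterThanLessThan)
    show "p s = f s \<and> p' s = f' s \<and> p'' s = f'' s" if "s \<le> R" for s
      using o[OF that] by (simp add: p_def p'_def p''_def)
    show "p s = 0" if "b \<le> s" for s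
      using zz that by auto
  qed
qed

text \<open>For \<open>u = Z \<phi>(|z|\<^sup>2)\<close> with \<open>Z\<close> harmonic and homogeneous of degree \<open>k\<close>, the Laplace--Beltrami operator equals
  \<open>4 (1 - s) Z\<close> times the hypergeometric operator with parameters \<open>k\<close>, \<open>-\<rho>\<close>, \<open>k + n/2\<close> applied to \<open>\<phi>\<close> at \<open>s = |z|\<^sup>2\<close>.\<close>

lemma hyp_harmonic_test_function:
  fixes e :: "real^'n::finite" and r :: real and k :: nat
  assumes e: "norm e = 1" and n: "CARD('n) > 2" and r: "0 < r" "r < 1"
  defines "\<phi> \<equiv> eval_fps (hypergeo_fps (real k) (- rho CARD('n)) (real k + real CARD('n) / 2))"
  obtains u where "C2_compact_support u"
    "\<And>z. norm z \<le> r \<Longrightarrow> u z = gegenbauer (rho CARD('n)) (e \<bullet> z) ((norm z)\<^sup>2) k * \<phi> ((norm z)\<^sup>2)"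
    "\<And>z. norm z \<le> r \<Longrightarrow> hyp_laplacian u z = 0"
proof -
  define l where "l = rho CARD('n)"
  have nl: "real CARD('n) = 2 * l + 2"
    by (simp add: l_def rho_def field_simps)
  define H where "H = hypergeo_fps (real k) (- l) (real k + real CARD('n) / 2)"
  have c0: "real k + real CARD('n) / 2 > 0"
    using n by simp
  have cr: "fps_conv_radius H \<ge> 1" "fps_conv_radius (fps_deriv H) \<ge> 1" "fps_conv_radius (fps_deriv (fps_deriv H)) \<ge> 1"
    using conv_radius_hypergeo_fps[OF c0, of "real k" "- l"] fps_conv_radius_deriv[of H] fps_conv_radius_deriv[of "fps_deriv H"]
    by (auto simp: H_def intro: order_trans)
  have cr': "ereal \<bar>s\<bar> < fps_conv_radius H" "ereal \<bar>s\<bar> < fps_conv_radius (fps_deriv H)"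
    "ereal \<bar>s\<bar> < fps_conv_radius (fps_deriv (fps_deriv H))" if "\<bar>s\<bar> < 1" for s
    using that cr by (auto intro: less_le_trans[of _ 1])
  define f f' f'' where "f = eval_fps H" and "f' = eval_fps (fps_deriv H)" and "f'' = eval_fps (fps_deriv (fps_deriv H))"
  have f: "(f has_real_derivative f' s) (at s)" and f': "(f' has_real_derivative f'' s) (at s)" if "\<bar>s\<bar> < 1" for s
    unfolding f_def f'_def f''_def using cr'[OF that] by (auto intro!: has_field_derivative_eval_fps)
  have c: "continuous_on {-1<..<1} f''"
    unfolding f''_def
    by (rule continuous_on_subset[OF continuous_on_eval_fps]) (use cr' in \<open>auto simp: in_eball_iff abs_less_iff\<close>)
  define R b where "R = r\<^sup>2" and "b = (1 + R) / 2"
  have R: "0 < R" "R < b" "b < 1"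
    using r by (auto simp: R_def b_def power_less_one_iff)
  obtain p p' p'' where p: "\<And>s. s > -1 \<Longrightarrow> (p has_real_derivative p' s) (at s)"
    "\<And>s. s > -1 \<Longrightarrow> (p' has_real_derivative p'' s) (at s)" "continuous_on {-1<..} p''"
    "\<And>s. s \<le> R \<Longrightarrow> p s = f s \<and> p' s = f' s \<and> p'' s = f'' s" "\<And>s. b \<le> s \<Longrightarrow> p s = 0"
    using C2_cutoff[OF R f f' c] by blast
  define Z where "Z = (\<lambda>z::real^'n. gegenbauer l (e \<bullet> z) ((norm z)\<^sup>2) k)"
  have Z: "C2 Z" "z \<bullet> grad Z z = real k * Z z" "laplacian Z z = 0" for z
    using gegenbauer_harmonic[OF e nl, of k] unfolding Z_def by auto
  note rad = radial_calculus[OF p(1-3), where ?'n = 'n]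
  define u where "u = (\<lambda>z. Z z * p ((norm z)\<^sup>2))"
  have C2u: "C2 u"
    unfolding u_def by (intro C2_mult Z rad)
  show ?thesis
  proof (rule that[of u])
    have "u z = 0" if "z \<notin> cball 0 (sqrt b)" for z
    proof -
      have "sqrt b < sqrt ((norm z)\<^sup>2)"
        using that by simp
      then have "b < (norm z)\<^sup>2"
        by (simp only: real_sqrt_less_iff)
      then show ?thesis
        using p(5)[of "(norm z)\<^sup>2"] by (simp add: u_def)
    qed
    moreover have "compact (cball 0 (sqrt b) :: (real^'n) set)" "cball 0 (sqrt b) \<subseteq> (ball 0 1 :: (real^'n) set)"
      using R by (simp_all add: cball_subset_ball_iff)
    ultimately show "C2_compact_support u"
      using C2u unfolding C2_compact_support_def C2_def by blast
    show "u z = gegenbauer (rho CARD('n)) (e \<bullet> z) ((norm z)\<^sup>2) k * \<phi> ((norm z)\<^sup>2)" if "norm z \<le> r" for z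
      using p(4)[of "(norm z)\<^sup>2"] that by (simp add: u_def Z_def \<phi>_def f_def H_def l_def R_def power_mono)
    show "hyp_laplacian u z = 0" if z: "norm z \<le> r" for z
    proof -
      define s where "s = (norm z)\<^sup>2"
      have s: "s \<le> R" "0 \<le> s" "\<bar>s\<bar> < 1"
      proof -
        show "s \<le> R" "0 \<le> s"
          using z by (auto simp: s_def R_def power_mono)
        then show "\<bar>s\<bar> < 1"
          using R by linarith
      qed
      note ps = p(4)[OF s(1)]
      have sz: "z \<bullet> z = s"
        by (simp add: s_def power2_norm_eq_inner)
      have zz: "z \<bullet> grad u z = Z z * (real k * f s + 2 * s * f' s)"
      proof -
        have "grad u z = Z z *\<^sub>R grad (\<lambda>z. p ((norm z)\<^sup>2)) z + p ((norm z)\<^sup>2) *\<^sub>R grad Z z"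
          unfolding u_def by (rule grad_mult[OF Z(1) rad(1)])
        then show ?thesis
          using ps by (simp add: rad(2) inner_add_right Z(2) sz s_def[symmetric] algebra_simps)
      qed
      have lap: "laplacian u z = Z z * (4 * s * f'' s + 2 * real CARD('n) * f' s + 4 * real k * f' s)"
      proof -
        have "laplacian u z = Z z * laplacian (\<lambda>z. p ((norm z)\<^sup>2)) z + p ((norm z)\<^sup>2) * laplacian Z z
            + 2 * (grad Z z \<bullet> grad (\<lambda>z. p ((norm z)\<^sup>2)) z)"
          unfolding u_def by (rule laplacian_mult[OF Z(1) rad(1)])
        then show ?thesis
          using ps by (simp add: rad(2,3) Z(2,3) s_def[symmetric] inner_commute[of "grad Z z" z] algebra_simps)
      qed
      have ode: "s * (1 - s) * f'' s + (real k + (l + 1) - (real k + (- l) + 1) * s) * f' s = real k * (- l) * f s"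
        using hypergeo_ode[OF c0 s(3), of "real k" "- l"]
        unfolding f_def f'_def f''_def H_def nl by (simp add: add_divide_distrib)
      have "hyp_laplacian u z = 4 * (1 - s) * Z z *
         (s * (1 - s) * f'' s + (real k + (l + 1) - (real k + (- l) + 1) * s) * f' s - real k * (- l) * f s)"
        unfolding hyp_laplacian_eq zz lap s_def[symmetric] nl by (simp add: algebra_simps power2_eq_square)
      then show ?thesis
        using ode by simp
    qed
  qed
qed

section \<open>Optional stopping at the exit time\<close>

lemma subalgebra_natural_filtration:
  assumes X: "\<forall>t\<ge>0. X t \<in> borel_measurable M"
  shows "subalgebra M (natural_filtration M X s)"
proof -
  have "{X u -` B \<inter> space M | u B. 0 \<le> u \<and> u \<le> s \<and> B \<in> sets borel} \<subseteq> sets M"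
    using X by (auto intro: measurable_sets)
  then show ?thesis
    unfolding subalgebra_def natural_filtration_def
    using sets.sigma_sets_subset[of _ M] by (auto simp: space_measure_of_conv sets_measure_of_conv)
qed

lemma sets_natural_filtration_vimage:
  assumes "0 \<le> u" "u \<le> s" "B \<in> sets borel"
  shows "X u -` B \<inter> space M \<in> sets (natural_filtration M X s)"
  unfolding natural_filtration_def using assms
  by (subst sets_measure_of) auto

text \<open>The defining property of the conditional expectation, tested on an event of the past.\<close>

lemma martingale_increment_integral:
  assumes M: "prob_space M" and X: "\<forall>t\<ge>0. X t \<in> borel_measurable M"
    and Y: "martingale_wrt M (natural_filtration M X) Y"
    and s: "0 \<le> s" "s \<le> t" and A: "A \<in> sets (natural_filtration M X s)"
  shows "integrable M (\<lambda>\<omega>. indicator A \<omega> * (Y t \<omega> - Y s \<omega>))"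
    and "(\<integral>\<omega>. indicator A \<omega> * (Y t \<omega> - Y s \<omega>) \<partial>M) = 0"
proof -
  interpret prob_space M by fact
  interpret finite_measure_subalgebra M "natural_filtration M X s"
    by unfold_locales (rule subalgebra_natural_filtration[OF X])
  have AM: "A \<in> sets M"
    using A subalg by (auto simp: subalgebra_def)
  have Yi: "integrable M (Y s)" "integrable M (Y t)"
    using Y s by (auto simp: martingale_wrt_def)
  have Yc: "AE \<omega> in M. real_cond_exp M (natural_filtration M X s) (Y t) \<omega> = Y s \<omega>"
    using Y s by (auto simp: martingale_wrt_def)
  have i: "integrable M (\<lambda>\<omega>. indicator A \<omega> * Y s \<omega>)" "integrable M (\<lambda>\<omega>. indicator A \<omega> * Y t \<omega>)"
    using integrable_mult_indicator[OF AM Yi(1)] integrable_mult_indicator[OF AM Yi(2)] by auto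
  show "integrable M (\<lambda>\<omega>. indicator A \<omega> * (Y t \<omega> - Y s \<omega>))"
    using Bochner_Integration.integrable_diff[OF i(2,1)] by (simp add: right_diff_distrib)
  have "(LINT \<omega>:A|M. Y t \<omega>) = (LINT \<omega>:A|M. real_cond_exp M (natural_filtration M X s) (Y t) \<omega>)"
    by (rule real_cond_exp_intA[OF Yi(2) A])
  also have "\<dots> = (LINT \<omega>:A|M. Y s \<omega>)"
    unfolding set_lebesgue_integral_def
    by (rule integral_cong_AE)
      (use Yc AM Yi borel_measurable_cond_exp2 in \<open>auto intro!: borel_measurable_times borel_measurable_indicator\<close>)
  finally show "(\<integral>\<omega>. indicator A \<omega> * (Y t \<omega> - Y s \<omega>) \<partial>M) = 0"
    using i by (simp add: right_diff_distrib set_lebesgue_integral_def)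
qed

lemma closed_hitting_times:
  fixes c :: "real \<Rightarrow> 'b::real_normed_vector"
  assumes c: "continuous_on {0..} c"
  shows "closed {s. 0 \<le> s \<and> r \<le> norm (c s)}"
proof -
  have "continuous_on {0..} (\<lambda>s. norm (c s))"
    by (intro continuous_intros c)
  from continuous_closed_preimage[OF this, of "{r..}"]
  have "closed ({0..} \<inter> (\<lambda>s. norm (c s)) -` {r..})"
    by auto
  also have "{0..} \<inter> (\<lambda>s. norm (c s)) -` {r..} = {s. 0 \<le> s \<and> r \<le> norm (c s)}"
    by auto
  finally show ?thesis .
qed

text \<open>By continuity and compactness, a path reaches norm \<open>r\<close> before \<open>t\<close> iff at times of a countable dense set it
  exceeds every level below \<open>r\<close>. Hence the exit time is a stopping time for the natural filtration itself, without
  completing it or making it right continuous.\<close>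

lemma hitting_event_measurable:
  fixes X :: "real \<Rightarrow> 'w \<Rightarrow> real^'n::finite"
  assumes c: "\<forall>\<omega>\<in>space M. continuous_on {0..} (\<lambda>t. X t \<omega>)" and t: "0 \<le> t"
  shows "{\<omega>\<in>space M. \<exists>s\<in>{0..t}. r \<le> norm (X s \<omega>)} \<in> sets (natural_filtration M X t)" (is "?H \<in> _")
proof -
  obtain D :: "real set" where D: "countable D" "D \<subseteq> {0..t}" "{0..t} \<subseteq> closure D"
    using separable[of "{0..t}"] by metis
  define G where "G = (\<lambda>(m::nat) q. X q -` {z. r - 1 / (real m + 1) < norm z} \<inter> space M)"
  have sp: "space (natural_filtration M X t) = space M"
    by (simp add: natural_filtration_def space_measure_of_conv)
  have G: "G m q \<in> sets (natural_filtration M X t)" if "q \<in> D" for m q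
    unfolding G_def using that D(2)
    by (intro sets_natural_filtration_vimage) (auto intro!: borel_open open_Collect_less continuous_intros)
  have "?H = (\<Inter>m. \<Union>q\<in>D. G m q)"
  proof (intro equalityI subsetI)
    fix \<omega> assume "\<omega> \<in> ?H"
    then obtain s where s: "s \<in> {0..t}" "r \<le> norm (X s \<omega>)" and w: "\<omega> \<in> space M"
      by auto
    have "\<exists>q\<in>D. \<omega> \<in> G m q" for m
    proof -
      obtain q where q: "\<And>n. q n \<in> D" "q \<longlonglongrightarrow> s"
        using s D(3) closure_sequential[of s D] by auto
      have "(\<lambda>n. X (q n) \<omega>) \<longlonglongrightarrow> X s \<omega>"
        by (rule continuous_on_tendsto_compose[of "{0..}" "\<lambda>t. X t \<omega>" q s])
          (use c w s q D(2) in \<open>auto simp: subset_iff\<close>)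
      then have "(\<lambda>n. norm (X (q n) \<omega>)) \<longlonglongrightarrow> norm (X s \<omega>)"
        by (rule tendsto_norm)
      moreover have "r - 1 / (real m + 1) < norm (X s \<omega>)"
        using s(2) by (smt (verit) divide_pos_pos of_nat_0_le_iff)
      ultimately have "\<forall>\<^sub>F n in sequentially. r - 1 / (real m + 1) < norm (X (q n) \<omega>)"
        by (rule order_tendstoD)
      then obtain n where "r - 1 / (real m + 1) < norm (X (q n) \<omega>)"
        by (auto dest: eventually_happens)
      then show ?thesis
        using q(1)[of n] w by (auto simp: G_def)
    qed
    then show "\<omega> \<in> (\<Inter>m. \<Union>q\<in>D. G m q)"
      by auto
  next
    fix \<omega> assume *: "\<omega> \<in> (\<Inter>m. \<Union>q\<in>D. G m q)"
    then have w: "\<omega> \<in> space M"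
      by (auto simp: G_def)
    have "continuous_on {0..t} (\<lambda>s. norm (X s \<omega>))"
      using c w by (intro continuous_on_norm) (auto intro: continuous_on_subset)
    then obtain s where s: "s \<in> {0..t}" "\<And>q. q \<in> {0..t} \<Longrightarrow> norm (X q \<omega>) \<le> norm (X s \<omega>)"
      using continuous_attains_sup[of "{0..t}" "\<lambda>s. norm (X s \<omega>)"] t by auto
    have "r - 1 / (real m + 1) < norm (X s \<omega>)" for m
    proof -
      obtain q where "q \<in> D" "\<omega> \<in> G m q"
        using * by auto
      then show ?thesis
        using s(2)[of q] D(2) by (auto simp: G_def)
    qed
    then have "r \<le> norm (X s \<omega>)"
    proof (rule_tac ccontr)
      assume a: "\<not> r \<le> norm (X s \<omega>)" and b: "\<And>m::nat. r - 1 / (real m + 1) < norm (X s \<omega>)"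
      then obtain m :: nat where "1 / (real m + 1) < r - norm (X s \<omega>)"
        using reals_Archimedean[of "r - norm (X s \<omega>)"] by (auto simp: divide_inverse add.commute)
      with b[of m] show False by auto
    qed
    then show "\<omega> \<in> ?H"
      using s w by auto
  qed
  also have "\<dots> \<in> sets (natural_filtration M X t)"
    using D(1) G by (intro sets.countable_INT image_subsetI sets.countable_UN') auto
  finally show ?thesis .
qed

text \<open>Rounding \<open>\<theta>\<close> up to the grid turns a sum of increments, each switched on by an event known at its left
  end point, into a single increment.\<close>

lemma grid_telescope:
  fixes F :: "real \<Rightarrow> real"
  assumes T: "T > 0" and \<theta>: "0 \<le> \<theta>" "\<theta> \<le> T" and N: "N > 0"
  obtains t where "0 \<le> t" "t \<le> T" "\<bar>t - \<theta>\<bar> \<le> T / real N"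
    "(\<Sum>j<N. (if real j * T / real N < \<theta> then 1 else 0) * (F (real (Suc j) * T / real N) - F (real j * T / real N))) = F t - F 0"
proof -
  define J where "J = nat \<lceil>\<theta> * real N / T\<rceil>"
  have J: "real J = of_int \<lceil>\<theta> * real N / T\<rceil>"
    using \<theta> T by (simp add: J_def)
  have lt: "j < J \<longleftrightarrow> real j * T / real N < \<theta>" for j
  proof -
    have "j < J \<longleftrightarrow> int j < \<lceil>\<theta> * real N / T\<rceil>"
      by (auto simp: J_def)
    also have "\<dots> \<longleftrightarrow> real j < \<theta> * real N / T"
      by (simp add: less_ceiling_iff)
    finally show ?thesis
      using T N by (simp add: field_simps)
  qed
  have JN: "J \<le> N"
  proof -
    have "\<theta> * real N / T \<le> real N"
      using \<theta> T by (simp add: divide_simps mult_right_mono mult.commute)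
    then show ?thesis
      by (simp add: J_def nat_le_iff ceiling_le_iff)
  qed
  have "\<theta> * real N / T \<le> real J" "real J \<le> \<theta> * real N / T + 1"
    unfolding J by linarith+
  then have "\<theta> \<le> real J * T / real N" "real J * T / real N \<le> \<theta> + T / real N"
    using T N by (simp_all add: field_simps)
  then have close: "\<bar>real J * T / real N - \<theta>\<bar> \<le> T / real N"
    using T by auto
  have "(\<Sum>j<N. (if real j * T / real N < \<theta> then 1 else 0) * (F (real (Suc j) * T / real N) - F (real j * T / real N)))
      = (\<Sum>j\<in>{..<N}. if j < J then F (real (Suc j) * T / real N) - F (real j * T / real N) else 0)"
    by (rule sum.cong) (auto simp: lt)
  also have "\<dots> = (\<Sum>j\<in>{..<N} \<inter> {j. j < J}. F (real (Suc j) * T / real N) - F (real j * T / real N))"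
    by (subst sum.inter_restrict) (auto simp del: of_nat_Suc)
  also have "{..<N} \<inter> {j. j < J} = {..<J}"
    using JN by auto
  also have "(\<Sum>j<J. F (real (Suc j) * T / real N) - F (real j * T / real N)) = F (real J * T / real N) - F 0"
    using sum_lessThan_telescope[of "\<lambda>j. F (real j * T / real N)" J] by simp
  finally show ?thesis
    using that[of "real J * T / real N"] close JN T N by (simp add: field_simps mult_right_mono)
qed

text \<open>Optional stopping by discretization. The martingale increments over a grid, switched off after the
  exit, have mean zero, and along each path they telescope to the value of the martingale at the rounded exit
  time. Refining the grid and then letting the time horizon grow, dominated convergence applies, since
  the path stays in the unit ball, on which the test function and its image under the operator are bounded. The integral term
  vanishes because the operator annihilates the test function on the closed ball of radius \<open>r\<close>. Paths that never leave
  the ball are negligible: their exit position is the starting point, which does not lie on the sphere.\<close>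

lemma exit_mean_value:
  fixes X :: "real \<Rightarrow> 'w \<Rightarrow> real^'n::finite"
  assumes BM: "hyperbolic_BM M X x" and u: "C2_compact_support u"
    and h: "\<And>z. norm z \<le> r \<Longrightarrow> hyp_laplacian u z = 0"
    and x: "norm x < r"
    and em: "exit_position X r \<in> borel_measurable M"
    and es: "AE \<omega> in M. norm (exit_position X r \<omega>) = r"
  shows "(\<integral>\<omega>. u (exit_position X r \<omega>) \<partial>M) = u x"
proof -
  have BM': "prob_space M" "\<forall>t\<ge>0. X t \<in> borel_measurable M" "\<forall>\<omega>\<in>space M. continuous_on {0..} (\<lambda>t. X t \<omega>)"
    "\<forall>\<omega>\<in>space M. \<forall>t\<ge>0. X t \<omega> \<in> ball 0 1" "AE \<omega> in M. X 0 \<omega> = x"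
    using BM unfolding hyperbolic_BM_def by blast+
  interpret prob_space M by fact
  define g where "g = hyp_laplacian u"
  define Y where "Y = (\<lambda>t \<omega>. u (X t \<omega>) - u (X 0 \<omega>) - (LINT s:{0..t}|lborel. g (X s \<omega>)))"
  have mart: "martingale_wrt M (natural_filtration M X) Y"
    using BM u unfolding hyperbolic_BM_def Y_def g_def by blast
  have cu: "continuous_on UNIV u" and cp: "continuous_on UNIV (partial i u)"
    and cpp: "continuous_on UNIV (partial j (partial i u))" for i j
    using u unfolding C2_compact_support_def
    by (auto intro!: continuous_at_imp_continuous_on differentiable_imp_continuous_within)
  have cg: "continuous_on UNIV g"
    unfolding g_def hyp_laplacian_def by (intro continuous_intros cp cpp)
  have um[measurable]: "u \<in> borel_measurable borel"
    using cu by (rule borel_measurable_continuous_onI)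
  have bounded: "\<exists>B\<ge>0. \<forall>z\<in>cball 0 1. \<bar>f z\<bar> \<le> B" if "continuous_on UNIV f" for f :: "real^'n \<Rightarrow> real"
  proof -
    have "bounded (f ` cball 0 1)"
      using that by (intro compact_imp_bounded compact_continuous_image) (auto intro: continuous_on_subset)
    then show ?thesis
      unfolding bounded_pos by (auto intro: less_imp_le)
  qed
  obtain Bu where Bu: "Bu \<ge> 0" "\<And>z. z \<in> cball 0 1 \<Longrightarrow> \<bar>u z\<bar> \<le> Bu"
    using bounded[OF cu] by auto
  obtain Bg where Bg: "Bg \<ge> 0" "\<And>z. z \<in> cball 0 1 \<Longrightarrow> \<bar>g z\<bar> \<le> Bg"
    using bounded[OF cg] by auto
  define S where "S = (\<lambda>\<omega>. {s. 0 \<le> s \<and> r \<le> norm (X s \<omega>)})"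
  have S_Inf: "Inf (S \<omega>) \<in> S \<omega>" if "S \<omega> \<noteq> {}" "\<omega> \<in> space M" for \<omega>
    using closed_contains_Inf[of "S \<omega>"] closed_hitting_times[of "\<lambda>t. X t \<omega>" r] that BM'(3)
    by (auto simp: S_def bdd_below_def)
  have S_low: "Inf (S \<omega>) \<le> s" if "s \<in> S \<omega>" for \<omega> s
    using that by (intro cInf_lower) (auto simp: S_def bdd_below_def)
  define \<theta> where "\<theta> = (\<lambda>T \<omega>. if S \<omega> \<inter> {0..T} \<noteq> {} then Inf (S \<omega>) else T)"
  have stopped: "(\<integral>\<omega>. u (X (\<theta> T \<omega>) \<omega>) \<partial>M) = u x \<and> (\<lambda>\<omega>. u (X (\<theta> T \<omega>) \<omega>)) \<in> borel_measurable M"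
    if T: "T > 0" for T
  proof -
    have \<theta>: "0 \<le> \<theta> T \<omega>" "\<theta> T \<omega> \<le> T" if "\<omega> \<in> space M" for \<omega>
    proof -
      show "0 \<le> \<theta> T \<omega>"
        using S_Inf[OF _ that] T by (auto simp: \<theta>_def S_def)
      show "\<theta> T \<omega> \<le> T"
      proof (cases "S \<omega> \<inter> {0..T} = {}")
        case False
        then obtain s where "s \<in> S \<omega>" "s \<le> T"
          by auto
        with False S_low[of s \<omega>] show ?thesis
          by (simp add: \<theta>_def)
      qed (simp add: \<theta>_def)
    qed
    have hit: "(\<exists>s\<in>{0..t}. r \<le> norm (X s \<omega>)) \<longleftrightarrow> \<theta> T \<omega> \<le> t" if "\<omega> \<in> space M" "0 \<le> t" "t < T" for t \<omega>
    proof
      assume "\<exists>s\<in>{0..t}. r \<le> norm (X s \<omega>)"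
      then obtain s where s: "s \<in> S \<omega>" "s \<le> t"
        by (auto simp: S_def)
      then have "s \<in> S \<omega> \<inter> {0..T}"
        using that by (auto simp: S_def)
      then have "\<theta> T \<omega> = Inf (S \<omega>)"
        unfolding \<theta>_def by auto
      then show "\<theta> T \<omega> \<le> t"
        using S_low[OF s(1)] s by auto
    next
      assume "\<theta> T \<omega> \<le> t"
      then have ne: "S \<omega> \<noteq> {}" "Inf (S \<omega>) \<le> t"
        using that by (auto simp: \<theta>_def split: if_splits)
      then show "\<exists>s\<in>{0..t}. r \<le> norm (X s \<omega>)"
        using S_Inf[OF ne(1) that(1)] by (auto simp: S_def)
    qed
    have gX: "continuous_on {0..t} (\<lambda>s. g (X s \<omega>))" and uX: "continuous_on {0..t} (\<lambda>s. u (X s \<omega>))"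
      if "\<omega> \<in> space M" for t \<omega>
      using BM'(3) that
      by (auto intro!: continuous_on_compose2[OF cg] continuous_on_compose2[OF cu] intro: continuous_on_subset)
    have LI: "(LINT s:{0..t}|lborel. g (X s \<omega>)) = integral {0..t} (\<lambda>s. g (X s \<omega>))"
      if "\<omega> \<in> space M" for t \<omega>
      by (rule set_borel_integral_eq_integral(2)) (intro borel_integrable_atLeastAtMost' gX that)
    have cY: "continuous_on {0..T} (\<lambda>t. Y t \<omega>)" if "\<omega> \<in> space M" for \<omega>
      unfolding Y_def LI[OF that]
      by (intro continuous_intros uX that indefinite_integral_continuous_1 integrable_continuous_real gX)
    have Y0: "Y 0 \<omega> = 0" if "\<omega> \<in> space M" for \<omega>
      unfolding Y_def LI[OF that] by simp
    have Xball: "X t \<omega> \<in> cball 0 1" if "\<omega> \<in> space M" "t \<ge> 0" for t \<omega>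
      using BM'(4) that by (auto simp: less_imp_le)
    have bY: "\<bar>Y t \<omega>\<bar> \<le> 2 * Bu + Bg * T" if "\<omega> \<in> space M" "0 \<le> t" "t \<le> T" for t \<omega>
    proof -
      have "norm (integral {0..t} (\<lambda>s. g (X s \<omega>))) \<le> Bg * (t - 0)"
        by (rule integral_bound) (use that gX Bg Xball in auto)
      also have "\<dots> \<le> Bg * T"
        using that Bg by (simp add: mult_left_mono)
      finally have "\<bar>integral {0..t} (\<lambda>s. g (X s \<omega>))\<bar> \<le> Bg * T"
        by simp
      moreover have "\<bar>u (X t \<omega>)\<bar> \<le> Bu" "\<bar>u (X 0 \<omega>)\<bar> \<le> Bu"
        using Bu(2) Xball that by auto
      ultimately show ?thesis
        unfolding Y_def LI[OF that(1)] by linarith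
    qed
    define A where "A = (\<lambda>t. space M - {\<omega>\<in>space M. \<exists>s\<in>{0..t}. r \<le> norm (X s \<omega>)})"
    have A: "A t \<in> sets (natural_filtration M X t)" if "t \<ge> 0" for t
      using sets.compl_sets[OF hitting_event_measurable[OF BM'(3) that, of r]]
      by (simp add: A_def natural_filtration_def space_measure_of_conv)
    \<comment> \<open>the increments over the grid of mesh \<open>T / Suc N\<close>, switched off after the exit\<close>
    define Q where "Q = (\<lambda>N \<omega>. \<Sum>j<Suc N. indicator (A (real j * T / real (Suc N))) \<omega> *
        (Y (real (Suc j) * T / real (Suc N)) \<omega> - Y (real j * T / real (Suc N)) \<omega>))"
    have inc: "integrable M (\<lambda>\<omega>. indicator (A (real j * T / real (Suc N))) \<omega> *
        (Y (real (Suc j) * T / real (Suc N)) \<omega> - Y (real j * T / real (Suc N)) \<omega>))"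
       "(\<integral>\<omega>. indicator (A (real j * T / real (Suc N))) \<omega> *
        (Y (real (Suc j) * T / real (Suc N)) \<omega> - Y (real j * T / real (Suc N)) \<omega>) \<partial>M) = 0" for j N
      using T by (intro martingale_increment_integral[OF BM'(1,2) mart _ _ A] divide_nonneg_nonneg
          divide_right_mono mult_right_mono; simp)+
    have Qi: "integrable M (Q N)" "(\<integral>\<omega>. Q N \<omega> \<partial>M) = 0" for N
    proof -
      show "integrable M (Q N)"
        unfolding Q_def by (intro Bochner_Integration.integrable_sum inc)
      show "(\<integral>\<omega>. Q N \<omega> \<partial>M) = 0"
        unfolding Q_def by (subst Bochner_Integration.integral_sum) (simp_all only: inc sum.neutral_const)
    qed
    have Qeq: "\<exists>t. 0 \<le> t \<and> t \<le> T \<and> \<bar>t - \<theta> T \<omega>\<bar> \<le> T / real (Suc N) \<and> Q N \<omega> = Y t \<omega>" if w: "\<omega> \<in> space M" for N \<omega>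
    proof -
      obtain t where t: "0 \<le> t" "t \<le> T" "\<bar>t - \<theta> T \<omega>\<bar> \<le> T / real (Suc N)"
        "(\<Sum>j<Suc N. (if real j * T / real (Suc N) < \<theta> T \<omega> then 1 else 0) *
           (Y (real (Suc j) * T / real (Suc N)) \<omega> - Y (real j * T / real (Suc N)) \<omega>)) = Y t \<omega> - Y 0 \<omega>"
        using grid_telescope[OF T \<theta>[OF w], of "Suc N" "\<lambda>t. Y t \<omega>"] by blast
      have "indicator (A (real j * T / real (Suc N))) \<omega> = (if real j * T / real (Suc N) < \<theta> T \<omega> then 1 else 0 :: real)"
        if "j < Suc N" for j
      proof -
        have "0 \<le> real j * T / real (Suc N)" "real j * T / real (Suc N) < T"
          using that T by (auto simp: divide_simps simp del: of_nat_Suc)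
        from hit[OF w this] show ?thesis
          using w by (auto simp: A_def indicator_def not_le)
      qed
      then have "Q N \<omega> = Y t \<omega> - Y 0 \<omega>"
        unfolding Q_def t(4)[symmetric] by (intro sum.cong) auto
      then show ?thesis
        using t Y0[OF w] by auto
    qed
    have Qlim: "(\<lambda>N. Q N \<omega>) \<longlonglongrightarrow> Y (\<theta> T \<omega>) \<omega>" if w: "\<omega> \<in> space M" for \<omega>
    proof -
      obtain t where t: "\<And>N. 0 \<le> t N \<and> t N \<le> T \<and> \<bar>t N - \<theta> T \<omega>\<bar> \<le> T / real (Suc N) \<and> Q N \<omega> = Y (t N) \<omega>"
        using Qeq[OF w] by metis
      have "(\<lambda>N. T / real (Suc N)) \<longlonglongrightarrow> 0"
        by (rule LIMSEQ_Suc[OF lim_const_over_n])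
      then have "(\<lambda>N. t N - \<theta> T \<omega>) \<longlonglongrightarrow> 0"
        by (rule Lim_null_comparison[rotated]) (use t in auto)
      then have "t \<longlonglongrightarrow> \<theta> T \<omega>"
        by (simp add: LIM_zero_iff)
      then have "(\<lambda>N. Y (t N) \<omega>) \<longlonglongrightarrow> Y (\<theta> T \<omega>) \<omega>"
        by (intro continuous_on_tendsto_compose[OF cY[OF w]]) (use t \<theta>[OF w] in auto)
      then show ?thesis
        using t by simp
    qed
    have m1: "(\<lambda>\<omega>. Y (\<theta> T \<omega>) \<omega>) \<in> borel_measurable M"
      by (rule borel_measurable_LIMSEQ_real[of M Q]) (use Qlim Qi in auto)
    have "(\<lambda>N. \<integral>\<omega>. Q N \<omega> \<partial>M) \<longlonglongrightarrow> (\<integral>\<omega>. Y (\<theta> T \<omega>) \<omega> \<partial>M)"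
    proof (rule integral_dominated_convergence[where w = "\<lambda>_. 2 * Bu + Bg * T"])
      show "AE \<omega> in M. norm (Q N \<omega>) \<le> 2 * Bu + Bg * T" for N
        using Qeq bY by (intro AE_I2) (metis real_norm_def)
    qed (use Qlim Qi m1 in auto)
    then have int0: "(\<integral>\<omega>. Y (\<theta> T \<omega>) \<omega> \<partial>M) = 0"
      using Qi(2) by (simp add: LIMSEQ_const_iff)
    have Yeq: "Y (\<theta> T \<omega>) \<omega> = u (X (\<theta> T \<omega>) \<omega>) - u (X 0 \<omega>)" if w: "\<omega> \<in> space M" for \<omega>
    proof -
      have "g (X s \<omega>) = 0" if "s \<in> {0..\<theta> T \<omega>} - {\<theta> T \<omega>}" for s
      proof -
        have "\<not> r \<le> norm (X s \<omega>)"
          using hit[OF w, of s] that \<theta>[OF w] by auto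
        then show ?thesis
          using h[of "X s \<omega>"] by (simp add: g_def)
      qed
      then have "integral {0..\<theta> T \<omega>} (\<lambda>s. g (X s \<omega>)) = integral {0..\<theta> T \<omega>} (\<lambda>s. 0)"
        by (intro integral_spike[of "{\<theta> T \<omega>}"]) auto
      then show ?thesis
        by (simp add: Y_def LI[OF w])
    qed
    have X0m: "(\<lambda>\<omega>. u (X 0 \<omega>)) \<in> borel_measurable M"
      using BM'(2) by (intro measurable_compose[OF _ um]) auto
    have "(\<lambda>\<omega>. Y (\<theta> T \<omega>) \<omega> + u (X 0 \<omega>)) \<in> borel_measurable M"
      using m1 X0m by (rule borel_measurable_add)
    then have m2: "(\<lambda>\<omega>. u (X (\<theta> T \<omega>) \<omega>)) \<in> borel_measurable M"
      by (rule measurable_cong[THEN iffD1, rotated]) (simp add: Yeq)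
    have i: "integrable M (\<lambda>\<omega>. u (X (\<theta> T \<omega>) \<omega>))" "integrable M (\<lambda>\<omega>. u (X 0 \<omega>))"
      by (rule integrable_const_bound[where B = Bu]; use m2 X0m Bu Xball \<theta> in \<open>auto intro!: AE_I2\<close>)+
    have "(\<integral>\<omega>. Y (\<theta> T \<omega>) \<omega> \<partial>M) = (\<integral>\<omega>. u (X (\<theta> T \<omega>) \<omega>) - u (X 0 \<omega>) \<partial>M)"
      by (rule Bochner_Integration.integral_cong) (auto simp: Yeq)
    also have "\<dots> = (\<integral>\<omega>. u (X (\<theta> T \<omega>) \<omega>) \<partial>M) - (\<integral>\<omega>. u (X 0 \<omega>) \<partial>M)"
      by (rule Bochner_Integration.integral_diff[OF i])
    also have "(\<integral>\<omega>. u (X 0 \<omega>) \<partial>M) = (\<integral>\<omega>. u x \<partial>M)"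
      using BM'(5) X0m by (intro integral_cong_AE) auto
    finally show ?thesis
      using m2 int0 by (simp add: prob_space)
  qed
  have lim: "AE \<omega> in M. (\<lambda>m. u (X (\<theta> (real (Suc m)) \<omega>) \<omega>)) \<longlonglongrightarrow> u (exit_position X r \<omega>)"
    using es BM'(5) AE_space
  proof (eventually_elim, goal_cases)
    case (1 \<omega>)
    have et: "exit_time X r \<omega> = Inf (ereal ` S \<omega>)"
      by (simp add: exit_time_def S_def)
    have ne: "S \<omega> \<noteq> {}"
    proof
      assume "S \<omega> = {}"
      then have "exit_time X r \<omega> = \<infinity>"
        unfolding et by (simp add: top_ereal_def)
      then show False
        using 1 x by (simp add: exit_position_def)
    qed
    have "exit_time X r \<omega> = ereal (Inf (S \<omega>))"
      unfolding et by (rule Inf_eqI) (use S_low S_Inf[OF ne 1(3)] in auto)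
    then have ep: "exit_position X r \<omega> = X (Inf (S \<omega>)) \<omega>"
      by (simp add: exit_position_def)
    have "\<theta> (real (Suc m)) \<omega> = Inf (S \<omega>)" if "m \<ge> nat \<lceil>Inf (S \<omega>)\<rceil>" for m
    proof -
      have "Inf (S \<omega>) \<le> real (Suc m)"
        using that by linarith
      then have "Inf (S \<omega>) \<in> S \<omega> \<inter> {0..real (Suc m)}"
        using S_Inf[OF ne 1(3)] by (auto simp: S_def)
      then show ?thesis
        unfolding \<theta>_def by auto
    qed
    then show ?case
      unfolding ep
      by (intro tendsto_eventually eventually_sequentiallyI[of "nat \<lceil>Inf (S \<omega>)\<rceil>"]) (simp del: of_nat_Suc)
  qed
  have "(\<lambda>m. \<integral>\<omega>. u (X (\<theta> (real (Suc m)) \<omega>) \<omega>) \<partial>M) \<longlonglongrightarrow> (\<integral>\<omega>. u (exit_position X r \<omega>) \<partial>M)"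
  proof (rule integral_dominated_convergence[where w = "\<lambda>_. Bu"])
    have "\<theta> (real (Suc m)) \<omega> \<ge> 0" if "\<omega> \<in> space M" for m \<omega>
      using S_Inf[OF _ that] by (auto simp: \<theta>_def S_def)
    then show "AE \<omega> in M. norm (u (X (\<theta> (real (Suc m)) \<omega>) \<omega>)) \<le> Bu" for m
      using Bu(2) BM'(4) by (intro AE_I2) (auto simp: less_imp_le)
    show "(\<lambda>\<omega>. u (exit_position X r \<omega>)) \<in> borel_measurable M"
      by (rule measurable_compose[OF em um])
  qed (use stopped lim in auto)
  then show ?thesis
    using stopped by (simp add: LIMSEQ_const_iff del: of_nat_Suc)
qed

section \<open>Rotation invariance and moments of the surface measure\<close>

lemma nn_integral_lborel_translate:
  fixes c :: "'a::euclidean_space"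
  assumes [measurable]: "f \<in> borel_measurable borel"
  shows "(\<integral>\<^sup>+y. f (c + y) \<partial>lborel) = (\<integral>\<^sup>+y. f y \<partial>lborel)"
proof -
  have "(\<integral>\<^sup>+y. f y \<partial>lborel) = (\<integral>\<^sup>+y. f y \<partial>distr lborel borel ((+) c))"
    by (simp add: lborel_distr_plus)
  also have "\<dots> = (\<integral>\<^sup>+y. f (c + y) \<partial>lborel)"
    by (rule nn_integral_distr) auto
  finally show ?thesis by simp
qed

lemma nn_integral_lborel_reflect:
  fixes c :: "'a::euclidean_space"
  assumes [measurable]: "f \<in> borel_measurable borel"
  shows "(\<integral>\<^sup>+y. f (c - y) \<partial>lborel) = (\<integral>\<^sup>+y. f y \<partial>lborel)"
proof -
  have L: "lborel = density (distr lborel borel (\<lambda>x. c - x)) (\<lambda>_. 1 :: ennreal)"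
    using lborel_affine[of "-1" c] by simp
  have "(\<integral>\<^sup>+y. f y \<partial>lborel) = (\<integral>\<^sup>+y. f y \<partial>density (distr lborel borel (\<lambda>x. c - x)) (\<lambda>_. 1))"
    by (rule arg_cong[OF L])
  also have "\<dots> = (\<integral>\<^sup>+y. f (c - y) \<partial>lborel)"
    by (simp add: nn_integral_density nn_integral_distr)
  finally show ?thesis by simp
qed

text \<open>Orthogonal maps preserve Lebesgue measure by the uniqueness argument for Haar measure: the image
  measure \<open>\<mu>\<close> is translation invariant, and Lebesgue measure \<open>\<lambda>\<close> is invariant under translations and
  reflections, so that \<open>\<mu>(A) \<lambda>(B) = \<mu>(B) \<lambda>(A)\<close> by Fubini. With \<open>B\<close> the unit ball, which is invariant, the two
  measures agree.\<close>

lemma emeasure_lborel_orthogonal_vimage: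
  fixes T :: "'a::euclidean_space \<Rightarrow> 'a"
  assumes T: "orthogonal_transformation T" and A: "A \<in> sets borel"
  shows "emeasure lborel (T -` A) = emeasure lborel A"
proof -
  have lin: "linear T"
    using T by (rule orthogonal_transformation_linear)
  have cT: "continuous_on UNIV T"
    using lin by (simp add: linear_continuous_on linear_conv_bounded_linear)
  have [measurable]: "T \<in> borel_measurable borel"
    using cT by (rule borel_measurable_continuous_onI)
  note [measurable] = A
  obtain T' where T': "\<And>y. T (T' y) = y"
    using orthogonal_transformation_surj[OF T] by (metis surj_f_inv_f)
  define B where "B = ball (0::'a) 1"
  have [measurable]: "B \<in> sets borel"
    by (simp add: B_def)
  have TB: "indicator B (T x) = (indicator B x :: ennreal)" for x
    using T by (simp add: B_def indicator_def orthogonal_transformation_norm)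
  have TA: "emeasure lborel (T -` A) = (\<integral>\<^sup>+x. indicator A (T x) \<partial>lborel)"
  proof -
    have "(\<lambda>x. indicator A (T x) :: ennreal) = indicator (T -` A)"
      by (auto simp: indicator_def)
    then show ?thesis
      using measurable_sets_borel[of T borel A] by simp
  qed
  have "emeasure lborel (T -` A) * emeasure lborel B = (\<integral>\<^sup>+x. indicator A (T x) * emeasure lborel B \<partial>lborel)"
    unfolding TA by (rule nn_integral_multc[symmetric]) simp
  also have "\<dots> = (\<integral>\<^sup>+x. indicator A (T x) * (\<integral>\<^sup>+y. indicator B (T x + y) \<partial>lborel) \<partial>lborel)"
    by (subst nn_integral_lborel_translate) auto
  also have "\<dots> = (\<integral>\<^sup>+x. (\<integral>\<^sup>+y. indicator A (T x) * indicator B (T x + y) \<partial>lborel) \<partial>lborel)"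
    by (subst nn_integral_cmult) auto
  also have "\<dots> = (\<integral>\<^sup>+y. (\<integral>\<^sup>+x. indicator A (T x) * indicator B (T x + y) \<partial>lborel) \<partial>lborel)"
    by (rule lborel_pair.Fubini') simp
  also have "\<dots> = (\<integral>\<^sup>+y. (\<integral>\<^sup>+x. indicator A (T x - y) * indicator B (T x) \<partial>lborel) \<partial>lborel)"
  proof (rule nn_integral_cong)
    fix y :: 'a
    have "(\<integral>\<^sup>+x. indicator A (T x) * indicator B (T x + y) \<partial>lborel) =
      (\<integral>\<^sup>+x. indicator A (T (T' (- y) + x)) * indicator B (T (T' (- y) + x) + y) \<partial>lborel)"
      by (rule nn_integral_lborel_translate[symmetric]) simp
    also have "\<dots> = (\<integral>\<^sup>+x. indicator A (T x - y) * indicator B (T x) \<partial>lborel)"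
      by (simp add: linear_add[OF lin] T' add.commute)
    finally show "(\<integral>\<^sup>+x. indicator A (T x) * indicator B (T x + y) \<partial>lborel) =
      (\<integral>\<^sup>+x. indicator A (T x - y) * indicator B (T x) \<partial>lborel)" .
  qed
  also have "\<dots> = (\<integral>\<^sup>+x. (\<integral>\<^sup>+y. indicator A (T x - y) * indicator B (T x) \<partial>lborel) \<partial>lborel)"
    by (rule lborel_pair.Fubini') simp
  also have "\<dots> = (\<integral>\<^sup>+x. emeasure lborel A * indicator B x \<partial>lborel)"
    by (subst nn_integral_multc, simp, subst nn_integral_lborel_reflect) (auto simp: TB)
  also have "\<dots> = emeasure lborel A * emeasure lborel B"
    by (simp add: nn_integral_cmult)
  finally have "emeasure lborel (T -` A) * emeasure lborel B = emeasure lborel A * emeasure lborel B" .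
  moreover have "emeasure lborel B \<noteq> 0" "emeasure lborel B < \<infinity>"
  proof -
    have "\<not> unit_ball_vol (real DIM('a)) \<le> 0"
      by (simp add: not_le)
    then show "emeasure lborel B \<noteq> 0" "emeasure lborel B < \<infinity>"
      unfolding B_def using emeasure_ball[of 1 "0::'a"] by (auto simp: ennreal_eq_0_iff)
  qed
  ultimately show ?thesis
    using ennreal_mult_cancel_left[of "emeasure lborel B" "emeasure lborel (T -` A)" "emeasure lborel A"]
    by (auto simp: mult.commute)
qed

lemma sets_spherical_measure [simp, measurable_cong]: "sets (spherical_measure r) = sets borel"
  by (simp add: spherical_measure_def)

lemma space_spherical_measure [simp]: "space (spherical_measure r) = UNIV"
  by (simp add: spherical_measure_def space_scale_measure)

lemma emeasure_spherical_measure: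
  fixes A :: "(real^'n::finite) set"
  assumes A: "A \<in> sets borel"
  shows "emeasure (spherical_measure r) A =
     ennreal (real CARD('n) / r) * emeasure lborel {z \<in> cball 0 r - {0}. (r / norm z) *\<^sub>R z \<in> A}"
proof -
  have m: "(\<lambda>z::real^'n. (r / norm z) *\<^sub>R z) \<in> measurable (restrict_space lborel (cball 0 r - {0})) borel"
    by (intro measurable_restrict_space1) simp
  have s: "(\<lambda>z::real^'n. (r / norm z) *\<^sub>R z) -` A \<inter> space (restrict_space lborel (cball 0 r - {0}))
     = {z \<in> cball 0 r - {0}. (r / norm z) *\<^sub>R z \<in> A}"
    by (auto simp: space_restrict_space)
  show ?thesis
    unfolding spherical_measure_def emeasure_scale_measure emeasure_distr[OF m A] s
    by (subst emeasure_restrict_space) auto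
qed

lemma spherical_measure_total:
  assumes r: "r > 0"
  shows "emeasure (spherical_measure r :: (real^'n::finite) measure) UNIV
     = ennreal (2 * pi powr (real CARD('n) / 2) / Gamma (real CARD('n) / 2) * r ^ (CARD('n) - 1))"
proof -
  have "{z::real^'n. z \<in> cball 0 r - {0} \<and> (r / norm z) *\<^sub>R z \<in> UNIV} = cball 0 r - {0}"
    by auto
  moreover have "emeasure lborel (cball (0::real^'n) r - {0}) = emeasure lborel (cball (0::real^'n) r)"
    by (rule emeasure_Diff_null_set) auto
  ultimately have "emeasure (spherical_measure r :: (real^'n) measure) UNIV =
      ennreal (real CARD('n) / r) * ennreal (unit_ball_vol CARD('n) * r ^ CARD('n))"
    using r by (simp add: emeasure_spherical_measure emeasure_cball)
  also have "\<dots> = ennreal (real CARD('n) / r * (unit_ball_vol CARD('n) * r ^ CARD('n)))"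
    using r by (intro ennreal_mult'[symmetric]) simp
  also have "real CARD('n) / r * (unit_ball_vol CARD('n) * r ^ CARD('n)) =
     2 * pi powr (real CARD('n) / 2) / Gamma (real CARD('n) / 2) * r ^ (CARD('n) - 1)"
  proof -
    have G1: "Gamma (real CARD('n) / 2 + 1) = real CARD('n) / 2 * Gamma (real CARD('n) / 2)"
      using nonpos_Ints_nonpos[of "real CARD('n) / 2"] by (intro Gamma_plus1) auto
    have r1: "r ^ CARD('n) = r * r ^ (CARD('n) - 1)"
      by (metis power_eq_if zero_less_card_finite less_numeral_extra(3))
    have "Gamma (real CARD('n) / 2) > 0"
      by (rule Gamma_real_pos) simp
    then show ?thesis
      unfolding unit_ball_vol_def G1 r1 using r by (simp add: field_simps)
  qed
  finally show ?thesis .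
qed

lemma finite_spherical_measure:
  "r > 0 \<Longrightarrow> finite_measure (spherical_measure r :: (real^'n::finite) measure)"
  by (rule finite_measureI) (simp add: spherical_measure_total)

lemma AE_spherical_measure:
  assumes r: "r > 0"
  shows "AE y in (spherical_measure r :: (real^'n::finite) measure). norm y = r"
proof (rule AE_I)
  show "{y \<in> space (spherical_measure r :: (real^'n) measure). norm y \<noteq> r} \<subseteq> {y. norm y \<noteq> r}"
    by auto
  have m: "{y::real^'n. norm y \<noteq> r} \<in> sets borel"
    by simp
  then show "{y::real^'n. norm y \<noteq> r} \<in> sets (spherical_measure r)"
    by simp
  have "{z::real^'n. z \<in> cball 0 r - {0} \<and> (r / norm z) *\<^sub>R z \<in> {y. norm y \<noteq> r}} = {}"
    using r by auto
  then show "emeasure (spherical_measure r) {y::real^'n. norm y \<noteq> r} = 0"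
    unfolding emeasure_spherical_measure[OF m] by (simp only: emeasure_empty mult_zero_right)
qed

lemma spherical_measure_orthogonal:
  fixes T :: "real^'n::finite \<Rightarrow> real^'n"
  assumes T: "orthogonal_transformation T"
  shows "distr (spherical_measure r) borel T = spherical_measure r"
proof (rule measure_eqI)
  fix A :: "(real^'n) set"
  assume "A \<in> sets (distr (spherical_measure r) borel T)"
  then have A[measurable]: "A \<in> sets borel"
    by simp
  have lin: "linear T"
    using T by (rule orthogonal_transformation_linear)
  have cT: "continuous_on UNIV T"
    using lin by (simp add: linear_continuous_on linear_conv_bounded_linear)
  have [measurable]: "T \<in> borel_measurable borel"
    using cT by (rule borel_measurable_continuous_onI)
  have mT: "T -` A \<in> sets borel"
    by (rule measurable_sets_borel[of T borel]) simp_all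
  \<comment> \<open>cones over sets on the sphere are mapped to cones\<close>
  have e: "{z \<in> cball 0 r - {0}. (r / norm z) *\<^sub>R z \<in> T -` A} = T -` {z \<in> cball 0 r - {0}. (r / norm z) *\<^sub>R z \<in> A}"
  proof -
    have "T z = 0 \<longleftrightarrow> z = 0" for z
      using orthogonal_transformation_norm[OF T, of z] by (metis norm_eq_zero)
    then show ?thesis
      by (auto simp: linear_scale[OF lin] orthogonal_transformation_norm[OF T])
  qed
  have m: "{z \<in> cball 0 r - {0}. (r / norm z) *\<^sub>R z \<in> A} \<in> sets borel"
    by measurable
  have "emeasure (distr (spherical_measure r) borel T) A = emeasure (spherical_measure r) (T -` A)"
    by (subst emeasure_distr) auto
  also have "\<dots> = emeasure (spherical_measure r) A"
    unfolding emeasure_spherical_measure[OF mT] emeasure_spherical_measure[OF A] e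
      emeasure_lborel_orthogonal_vimage[OF T m] ..
  finally show "emeasure (distr (spherical_measure r) borel T) A = emeasure (spherical_measure r) A" .
qed simp

lemma integrable_spherical_measure:
  fixes f :: "real^'n::finite \<Rightarrow> real"
  assumes r: "r > 0" and f: "continuous_on UNIV f"
  shows "integrable (spherical_measure r) f"
proof -
  interpret finite_measure "spherical_measure r :: (real^'n) measure"
    by (rule finite_spherical_measure[OF r])
  have "bounded (f ` sphere 0 r)"
    using f by (intro compact_imp_bounded compact_continuous_image) (auto intro: continuous_on_subset)
  then obtain B where "\<forall>v\<in>f ` sphere 0 r. norm v \<le> B"
    unfolding bounded_iff by blast
  then have B: "norm (f y) \<le> B" if "norm y = r" for y
    using that by auto
  show ?thesis
  proof (intro integrable_const_bound[where B = B])
    show "AE y in spherical_measure r. norm (f y) \<le> B"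
      by (rule eventually_mono[OF AE_spherical_measure[OF r]]) (rule B)
  qed (use borel_measurable_continuous_onI[OF f] in simp)
qed

lemma integral_spherical_orthogonal:
  fixes f :: "real^'n::finite \<Rightarrow> real" and T :: "real^'n \<Rightarrow> real^'n"
  assumes T: "orthogonal_transformation T" and [measurable]: "f \<in> borel_measurable borel"
  shows "(\<integral>y. f (T y) \<partial>spherical_measure r) = (\<integral>y. f y \<partial>spherical_measure r)"
proof -
  have [measurable]: "T \<in> borel_measurable borel"
    using orthogonal_transformation_linear[OF T]
    by (intro borel_measurable_continuous_onI) (simp add: linear_continuous_on linear_conv_bounded_linear)
  have "(\<integral>y. f y \<partial>spherical_measure r) = (\<integral>y. f y \<partial>distr (spherical_measure r) borel T)"
    by (simp add: spherical_measure_orthogonal[OF T])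
  also have "\<dots> = (\<integral>y. f (T y) \<partial>spherical_measure r)"
    by (rule integral_distr) auto
  finally show ?thesis by simp
qed

text \<open>Some orthogonal map sends \<open>|v|\<close> times a coordinate vector to \<open>v\<close>.\<close>

lemma integral_inner_power_sphere:
  fixes v :: "real^'n::finite" and k :: 'n
  shows "(\<integral>y. (v \<bullet> y) ^ p \<partial>spherical_measure r) = norm v ^ p * (\<integral>y. (y $ k) ^ p \<partial>spherical_measure r)"
proof -
  define a where "a = norm v *\<^sub>R (axis k 1 :: real^'n)"
  have "norm a = norm v"
    by (simp add: a_def norm_axis_1)
  then obtain T where T: "orthogonal_transformation T" "T a = v"
    by (rule orthogonal_transformation_exists)
  have m: "(\<lambda>y. (v \<bullet> y) ^ p) \<in> borel_measurable borel"
    by (intro borel_measurable_continuous_onI continuous_intros)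
  have "(\<integral>y. (v \<bullet> y) ^ p \<partial>spherical_measure r) = (\<integral>y. (v \<bullet> T y) ^ p \<partial>spherical_measure r)"
    by (rule integral_spherical_orthogonal[OF T(1) m, symmetric])
  also have "\<dots> = (\<integral>y. norm v ^ p * (y $ k) ^ p \<partial>spherical_measure r)"
  proof -
    have "v \<bullet> T y = norm v * y $ k" for y
    proof -
      have "v \<bullet> T y = a \<bullet> y"
        using T by (metis orthogonal_transformation_def)
      then show ?thesis
        by (simp add: a_def inner_axis')
    qed
    then show ?thesis
      by (simp add: power_mult_distrib)
  qed
  finally show ?thesis
    by simp
qed

lemma coeff_square_binomial:
  fixes P :: "real poly"
  assumes "P = [:1, 0, 1:]"
  shows "coeff (P ^ q) 0 = 1 \<and> coeff (P ^ q) 1 = 0 \<and> coeff (P ^ q) 2 = real q"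
proof (induction q)
  case (Suc q)
  have "P ^ Suc q = P ^ q + pCons 0 (pCons 0 (P ^ q))"
    by (simp add: assms)
  then show ?case
    using Suc by (simp add: numeral_2_eq_2)
qed (simp add: numeral_2_eq_2)

text \<open>Apply the previous formula to \<open>v = e\<^sub>k + s e\<^sub>j\<close>, which has norm \<open>(1 + s\<^sup>2)\<^bsup>1/2\<^esup>\<close>, and compare the
  coefficients of \<open>s\<^sup>2\<close>.\<close>

lemma spherical_moment_mixed:
  fixes k j :: "'n::finite"
  assumes r: "r > 0" and kj: "k \<noteq> j" and q: "q > 0"
  shows "(2 * real q - 1) * (\<integral>y. (y $ j)\<^sup>2 * (y $ k) ^ (2 * q - 2) \<partial>spherical_measure r)
      = (\<integral>y. (y $ k) ^ (2 * q) \<partial>spherical_measure r)"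
proof -
  define S where "S = (spherical_measure r :: (real^'n) measure)"
  define m where "m = (\<integral>y. (y $ k) ^ (2 * q) \<partial>S)"
  define I where "I = (\<lambda>i. \<integral>y. (y $ j) ^ i * (y $ k) ^ (2 * q - i) \<partial>S)"
  define Q where "Q = (\<Sum>i\<le>2 * q. monom (real (2 * q choose i) * I i) i)"
  have "poly Q s = poly (smult m ([:1, 0, 1:] ^ q)) s" for s
  proof -
    define v where "v = axis k 1 + s *\<^sub>R (axis j 1 :: real^'n)"
    have "(norm v)\<^sup>2 = 1 + s\<^sup>2"
      using kj unfolding power2_norm_eq_inner v_def
      by (simp add: inner_add_left inner_add_right inner_axis_axis power2_eq_square)
    then have nv: "norm v ^ (2 * q) = (1 + s\<^sup>2) ^ q"
      by (simp add: power_mult)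
    have vy: "v \<bullet> y = s * y $ j + y $ k" for y
      by (simp add: v_def inner_add_left inner_axis' )
    have int: "integrable S (\<lambda>y. real (2 * q choose i) * (s * y $ j) ^ i * (y $ k) ^ (2 * q - i))" for i
      unfolding S_def by (intro integrable_spherical_measure r continuous_intros)
    have "(\<integral>y. (v \<bullet> y) ^ (2 * q) \<partial>S) = (\<integral>y. (\<Sum>i\<le>2 * q. real (2 * q choose i) * (s * y $ j) ^ i * (y $ k) ^ (2 * q - i)) \<partial>S)"
      unfolding vy by (simp add: binomial_ring)
    also have "\<dots> = (\<Sum>i\<le>2 * q. \<integral>y. real (2 * q choose i) * (s * y $ j) ^ i * (y $ k) ^ (2 * q - i) \<partial>S)"
      by (rule Bochner_Integration.integral_sum) (rule int)
    also have "\<dots> = poly Q s"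
      unfolding Q_def poly_sum I_def
    proof (rule sum.cong)
      fix i
      have "(\<integral>y. real (2 * q choose i) * (s * y $ j) ^ i * (y $ k) ^ (2 * q - i) \<partial>S)
        = (\<integral>y. (real (2 * q choose i) * s ^ i) * ((y $ j) ^ i * (y $ k) ^ (2 * q - i)) \<partial>S)"
        by (simp only: power_mult_distrib mult_ac)
      also have "\<dots> = (real (2 * q choose i) * s ^ i) * (\<integral>y. (y $ j) ^ i * (y $ k) ^ (2 * q - i) \<partial>S)"
        by (rule integral_mult_right_zero)
      finally show "(\<integral>y. real (2 * q choose i) * (s * y $ j) ^ i * (y $ k) ^ (2 * q - i) \<partial>S)
        = poly (monom (real (2 * q choose i) * (\<integral>y. (y $ j) ^ i * (y $ k) ^ (2 * q - i) \<partial>S)) i) s"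
        by (simp add: poly_monom mult_ac)
    qed simp
    finally show ?thesis
      unfolding S_def integral_inner_power_sphere[where v = v and p = "2 * q" and r = r and k = k] nv
      by (simp add: m_def S_def power2_eq_square poly_power mult.commute)
  qed
  then have "Q = smult m ([:1, 0, 1:] ^ q)"
    by (intro poly_ext)
  then have "coeff Q 2 = m * real q"
    using coeff_square_binomial[OF refl, of q] by simp
  moreover have "coeff Q 2 = real (2 * q choose 2) * I 2"
    using q by (simp add: Q_def coeff_sum if_distrib sum.delta cong: if_cong)
  moreover have "real (2 * q choose 2) = real q * (2 * real q - 1)"
  proof -
    have "2 * q choose 2 = q * (2 * q - 1)"
      unfolding choose_two by (simp add: mult.assoc)
    then show ?thesis
      using q by (simp add: of_nat_diff)
  qed
  ultimately have "real q * ((2 * real q - 1) * I 2) = real q * m"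
    by (simp add: mult_ac)
  then show ?thesis
    using q by (simp add: I_def m_def S_def)
qed

text \<open>Sum the mixed moments over all \<open>j\<close>, using that the squares of the coordinates add up to \<open>r\<^sup>2\<close>. Odd moments
  vanish by symmetry.\<close>

lemma spherical_moment_rec:
  fixes k :: "'n::finite"
  assumes r: "r > 0"
  shows "(real p + 1) * (r\<^sup>2 * (\<integral>y. (y $ k) ^ p \<partial>spherical_measure r) - (\<integral>y. (y $ k) ^ (p + 2) \<partial>spherical_measure r))
    = (real CARD('n) - 1) * (\<integral>y. (y $ k) ^ (p + 2) \<partial>spherical_measure r)"
proof (cases "even p")
  case False
  have odd0: "(\<integral>y. (y $ k) ^ i \<partial>(spherical_measure r :: (real^'n) measure)) = 0" if "odd i" for i
  proof -
    have "orthogonal_transformation (\<lambda>y::real^'n. - y)"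
      by (simp add: orthogonal_transformation_def linear_uminus)
    from integral_spherical_orthogonal[OF this, of "\<lambda>y::real^'n. (y $ k) ^ i" r] show ?thesis
      using that by (simp add: borel_measurable_continuous_onI continuous_intros)
  qed
  show ?thesis
    using odd0[of p] odd0[of "p + 2"] False by (simp del: power_Suc add_2_eq_Suc')
next
  case True
  then obtain q' where q': "p = 2 * q'"
    by auto
  define q where "q = Suc q'"
  define S where "S = (spherical_measure r :: (real^'n) measure)"
  have pq: "p = 2 * q - 2" "p + 2 = 2 * q" "q > 0" "real p + 1 = 2 * real q - 1"
    by (auto simp: q' q_def)
  have int: "integrable S (\<lambda>y. (y $ j)\<^sup>2 * (y $ k) ^ p)" for j
    unfolding S_def by (intro integrable_spherical_measure r continuous_intros)
  have intp: "integrable S (\<lambda>y. (y $ k) ^ i)" for i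
    unfolding S_def by (intro integrable_spherical_measure r continuous_intros)
  have "(\<integral>y. r\<^sup>2 * (y $ k) ^ p \<partial>S) = (\<integral>y. (\<Sum>j\<in>UNIV. (y $ j)\<^sup>2 * (y $ k) ^ p) \<partial>S)"
  proof (rule integral_cong_AE)
    have "(norm y)\<^sup>2 = (\<Sum>j\<in>UNIV. (y $ j)\<^sup>2)" for y :: "real^'n"
      unfolding power2_norm_eq_inner inner_vec_def by (simp add: power2_eq_square)
    then show "AE y in S. r\<^sup>2 * (y $ k) ^ p = (\<Sum>j\<in>UNIV. (y $ j)\<^sup>2 * (y $ k) ^ p)"
      unfolding S_def sum_distrib_right[symmetric]
      by (intro eventually_mono[OF AE_spherical_measure[OF r]]) metis
  qed (use int intp in auto)
  also have "\<dots> = (\<Sum>j\<in>UNIV. \<integral>y. (y $ j)\<^sup>2 * (y $ k) ^ p \<partial>S)"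
    by (rule Bochner_Integration.integral_sum) (rule int)
  also have "\<dots> = (\<integral>y. (y $ k)\<^sup>2 * (y $ k) ^ p \<partial>S) + (\<Sum>j\<in>UNIV - {k}. \<integral>y. (y $ j)\<^sup>2 * (y $ k) ^ p \<partial>S)"
    by (simp add: sum.remove[of UNIV k])
  also have "(\<Sum>j\<in>UNIV - {k}. \<integral>y. (y $ j)\<^sup>2 * (y $ k) ^ p \<partial>S)
      = (\<Sum>j\<in>UNIV - {k}. (\<integral>y. (y $ k) ^ (p + 2) \<partial>S) / (2 * real q - 1))"
  proof (rule sum.cong)
    fix j assume "j \<in> UNIV - {k}"
    then have "(2 * real q - 1) * (\<integral>y. (y $ j)\<^sup>2 * (y $ k) ^ p \<partial>S) = (\<integral>y. (y $ k) ^ (p + 2) \<partial>S)"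
      unfolding S_def pq(2) unfolding pq(1) by (intro spherical_moment_mixed r pq(3)) auto
    moreover have "2 * real q - 1 \<noteq> 0"
      using pq(4) by linarith
    ultimately show "(\<integral>y. (y $ j)\<^sup>2 * (y $ k) ^ p \<partial>S) = (\<integral>y. (y $ k) ^ (p + 2) \<partial>S) / (2 * real q - 1)"
      by (simp add: field_simps)
  qed simp
  also have "\<dots> = (real CARD('n) - 1) * ((\<integral>y. (y $ k) ^ (p + 2) \<partial>S) / (real p + 1))"
    using zero_less_card_finite[where ?'a = 'n] pq(4) by (simp add: card_Diff_singleton of_nat_diff)
  also have "(\<lambda>y::real^'n. (y $ k)\<^sup>2 * (y $ k) ^ p) = (\<lambda>y. (y $ k) ^ (p + 2))"
    by (simp add: power2_eq_square mult_ac)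
  finally have "r\<^sup>2 * (\<integral>y. (y $ k) ^ p \<partial>S) = (\<integral>y. (y $ k) ^ (p + 2) \<partial>S)
      + (real CARD('n) - 1) * ((\<integral>y. (y $ k) ^ (p + 2) \<partial>S) / (real p + 1))"
    by (simp only: integral_mult_right_zero)
  then show ?thesis
    unfolding S_def by (simp add: field_simps del: power_Suc add_2_eq_Suc')
qed

text \<open>On monomials this is the recursion of the moments. It expresses that the divergence of the tangential
  part of \<open>g(e \<bullet> y) e\<close> integrates to zero over the sphere.\<close>

lemma spherical_integration_by_parts:
  fixes e :: "real^'n::finite" and g :: "real poly"
  assumes r: "r > 0" and e: "norm e = 1"
  shows "(\<integral>y. (r\<^sup>2 - (e \<bullet> y)\<^sup>2) * poly (pderiv g) (e \<bullet> y) \<partial>spherical_measure r)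
    = (real CARD('n) - 1) * (\<integral>y. (e \<bullet> y) * poly g (e \<bullet> y) \<partial>spherical_measure r)"
proof -
  define S where "S = (spherical_measure r :: (real^'n) measure)"
  define P where "P = (\<lambda>g :: real poly. (\<integral>y. (r\<^sup>2 - (e \<bullet> y)\<^sup>2) * poly (pderiv g) (e \<bullet> y) \<partial>S)
    = (real CARD('n) - 1) * (\<integral>y. (e \<bullet> y) * poly g (e \<bullet> y) \<partial>S))"
  have int: "integrable S (\<lambda>y. (r\<^sup>2 - (e \<bullet> y)\<^sup>2) * poly g (e \<bullet> y))" "integrable S (\<lambda>y. (e \<bullet> y) * poly g (e \<bullet> y))"
    "integrable S (\<lambda>y. (e \<bullet> y) ^ i)" for g i
    unfolding S_def by (intro integrable_spherical_measure r continuous_intros)+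
  have add: "P (g + h)" if "P g" "P h" for g h
    using that int by (simp add: P_def pderiv_add distrib_left)
  \<comment> \<open>any coordinate will do: all moments in unit directions agree\<close>
  define k where "k = (undefined :: 'n)"
  have mon: "P (monom c p)" for c p
  proof (cases p)
    case 0
    have "(\<integral>y. (e \<bullet> y) * c \<partial>S) = c * (\<integral>y. (e \<bullet> y) ^ 1 \<partial>S)"
      by (simp add: mult.commute)
    moreover have "(\<integral>y. (e \<bullet> y) ^ 1 \<partial>S) = 0"
    proof -
      have "orthogonal_transformation (\<lambda>y::real^'n. - y)"
        by (simp add: orthogonal_transformation_def linear_uminus)
      from integral_spherical_orthogonal[OF this, of "\<lambda>y. e \<bullet> y" r] show ?thesis
        by (simp add: borel_measurable_continuous_onI continuous_intros S_def)
    qed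
    ultimately show ?thesis
      using 0 by (simp add: P_def poly_monom monom_0)
  next
    case (Suc q)
    have 1: "(r\<^sup>2 - (e \<bullet> y)\<^sup>2) * poly (pderiv (monom c p)) (e \<bullet> y) = (c * (real q + 1)) * (r\<^sup>2 * (e \<bullet> y) ^ q - (e \<bullet> y) ^ (q + 2))"
      "(e \<bullet> y) * poly (monom c p) (e \<bullet> y) = c * (e \<bullet> y) ^ (q + 2)" for y
      by (simp_all add: Suc pderiv_monom poly_monom power2_eq_square algebra_simps)
    have m: "(\<integral>y. (e \<bullet> y) ^ i \<partial>S) = (\<integral>y. (y $ k) ^ i \<partial>S)" for i
      using integral_inner_power_sphere[where v = e and p = i and r = r and k = k] e by (simp add: S_def)
    have "(\<integral>y. (c * (real q + 1)) * (r\<^sup>2 * (e \<bullet> y) ^ q - (e \<bullet> y) ^ (q + 2)) \<partial>S) =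
       c * ((real q + 1) * (r\<^sup>2 * (\<integral>y. (y $ k) ^ q \<partial>S) - (\<integral>y. (y $ k) ^ (q + 2) \<partial>S)))"
      using int(3) unfolding m[symmetric] by (simp add: mult.assoc del: power_Suc)
    also have "\<dots> = c * ((real CARD('n) - 1) * (\<integral>y. (y $ k) ^ (q + 2) \<partial>S))"
      unfolding S_def by (subst spherical_moment_rec[OF r]) (rule refl)
    finally show ?thesis
      unfolding P_def 1 unfolding m[symmetric] by simp
  qed
  have "P (\<Sum>i\<in>A. monom (coeff g i) i)" if "finite A" for A
    using that
  proof induction
    case empty
    then show ?case by (simp add: P_def)
  next
    case (insert x F)
    then show ?case by (simp add: add mon)
  qed
  from this[of "{..degree g}"] have "P g"
    by (simp add: poly_as_sum_of_monoms)
  then show ?thesis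
    unfolding P_def S_def .
qed

section \<open>Recovering a density on the sphere from its Gegenbauer moments\<close>

text \<open>The mean value property of the zonal harmonic. Integration by parts on the sphere
  and \<open>gegenbauer_poly_deriv\<close> express the integral of \<open>(e \<bullet> y) Z\<^sub>k\<close> by that of \<open>Z\<^bsub>k-1\<^esub>\<close>; inserted into the recurrence
  this makes the mean of \<open>Z\<^bsub>k+1\<^esub>\<close> a multiple of \<open>k - 1\<close> times the mean of \<open>Z\<^bsub>k-1\<^esub>\<close>. So the mean of \<open>Z\<^sub>2\<close> is zero, like
  that of the odd function \<open>Z\<^sub>1\<close>, and the higher ones follow.\<close>

lemma integral_gegenbauer_sphere:
  fixes e :: "real^'n::finite"
  assumes r: "r > 0" and e: "norm e = 1" and l: "real CARD('n) = 2 * l + 2" "l > 0" and k: "k > 0"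
  shows "(\<integral>y. gegenbauer l (e \<bullet> y) (r\<^sup>2) k \<partial>spherical_measure r) = 0"
proof -
  define S where "S = (spherical_measure r :: (real^'n) measure)"
  define Z where "Z = (\<lambda>k y. gegenbauer l (e \<bullet> y) (r\<^sup>2) k)"
  have Zp: "Z k y = poly (gegenbauer_poly l (r\<^sup>2) k) (e \<bullet> y)" for k y
    by (simp add: Z_def poly_gegenbauer_poly)
  have int: "integrable S (Z k)" "integrable S (\<lambda>y. (e \<bullet> y) * Z k y)" for k
    unfolding S_def Zp by (intro integrable_spherical_measure r continuous_intros)+
  define J where "J = (\<lambda>k. \<integral>y. Z k y \<partial>S)"
  define A where "A = (\<lambda>k. \<integral>y. (e \<bullet> y) * Z k y \<partial>S)"
  have A: "(real k + 2 + 2 * l) * A (Suc k) = (real k + 2 * l) * r\<^sup>2 * J k" for k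
  proof -
    have "(2 * l + 1) * A (Suc k) = (\<integral>y. (r\<^sup>2 - (e \<bullet> y)\<^sup>2) * poly (pderiv (gegenbauer_poly l (r\<^sup>2) (Suc k))) (e \<bullet> y) \<partial>S)"
      unfolding A_def Zp S_def spherical_integration_by_parts[OF r e] using l by simp
    also have "\<dots> = (\<integral>y. (real k + 2 * l) * r\<^sup>2 * Z k y - (real k + 1) * ((e \<bullet> y) * Z (Suc k) y) \<partial>S)"
    proof (rule Bochner_Integration.integral_cong[OF refl])
      fix y
      show "(r\<^sup>2 - (e \<bullet> y)\<^sup>2) * poly (pderiv (gegenbauer_poly l (r\<^sup>2) (Suc k))) (e \<bullet> y)
        = (real k + 2 * l) * r\<^sup>2 * Z k y - (real k + 1) * ((e \<bullet> y) * Z (Suc k) y)"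
        using gegenbauer_poly_deriv[of "r\<^sup>2" "e \<bullet> y" l k] unfolding Z_def by linarith
    qed
    also have "\<dots> = (real k + 2 * l) * r\<^sup>2 * J k - (real k + 1) * A (Suc k)"
      unfolding J_def A_def using int by (subst Bochner_Integration.integral_diff) (auto intro!: integrable_mult_right)
    finally show ?thesis
      by (simp add: algebra_simps)
  qed
  have J: "(real k + 2) * J (Suc (Suc k)) = 2 * (real k + 1 + l) * A (Suc k) - (real k + 2 * l) * (r\<^sup>2 * J k)" for k
  proof -
    have "(real k + 2) * J (Suc (Suc k)) = (\<integral>y. (real k + 2) * Z (Suc (Suc k)) y \<partial>S)"
      unfolding J_def by (rule integral_mult_right_zero[symmetric])
    also have "\<dots> = (\<integral>y. 2 * (real k + 1 + l) * ((e \<bullet> y) * Z (Suc k) y) - (real k + 2 * l) * (r\<^sup>2 * Z k y) \<partial>S)"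
      by (rule Bochner_Integration.integral_cong[OF refl]) (simp add: Z_def)
    also have "\<dots> = 2 * (real k + 1 + l) * A (Suc k) - (real k + 2 * l) * (r\<^sup>2 * J k)"
      unfolding J_def A_def using int by (subst Bochner_Integration.integral_diff) (auto intro!: integrable_mult_right)
    finally show ?thesis .
  qed
  have "J (Suc k) = 0 \<and> J (Suc (Suc k)) = 0" for k
  proof (induction k)
    case 0
    have "orthogonal_transformation (\<lambda>y::real^'n. - y)"
      by (simp add: orthogonal_transformation_def linear_uminus)
    from integral_spherical_orthogonal[OF this, of "Z 1" r] have "J 1 = 0"
      using int(1)[of 1] by (simp add: J_def S_def Z_def)
    moreover have "J 2 = 0"
      using J[of 0] A[of 0] l by (simp add: numeral_2_eq_2)
    ultimately show ?case
      by (simp add: numeral_2_eq_2)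
  next
    case (Suc k)
    have "A (Suc (Suc k)) = 0"
      using A[of "Suc k"] Suc l by auto
    then have "J (Suc (Suc (Suc k))) = 0"
      using J[of "Suc k"] Suc by auto
    then show ?case
      using Suc by simp
  qed
  then show ?thesis
    using k unfolding J_def Z_def S_def by (cases k) auto
qed

text \<open>The kernel is the sum of the series of \<open>gegenbauer_poisson_sums\<close> at \<open>t / r\<close>; the uniform
  majorant of the Gegenbauer polynomials allows integration term by term.\<close>

lemma sphere_gegenbauer_sums:
  fixes e :: "real^'n::finite" and f :: "real^'n \<Rightarrow> real"
  assumes r: "r > 0" and e: "norm e = 1" and l: "l > 0" and t: "0 \<le> t" "t < 1"
    and f: "integrable (spherical_measure r) f"
  shows "(\<lambda>k. (real k + l) / l * (\<integral>y. f y * gegenbauer l (e \<bullet> y) (r\<^sup>2) k \<partial>spherical_measure r) / r ^ k * t ^ k) sums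
    (\<integral>y. f y * ((1 - t\<^sup>2) * (1 - 2 * t * (e \<bullet> y) / r + t\<^sup>2) powr (- l - 1)) \<partial>spherical_measure r)"
proof -
  define S where "S = (spherical_measure r :: (real^'n) measure)"
  define Z where "Z = (\<lambda>k y. gegenbauer l (e \<bullet> y) (r\<^sup>2) k)"
  define m where "m = (\<lambda>k. (real k + l) / l * (t / r) ^ k)"
  define g where "g = (\<lambda>k y. f y * (m k * Z k y))"
  have m0: "m k \<ge> 0" for k
    using l t r by (simp add: m_def)
  have Zc: "continuous_on UNIV (Z k)" for k
    unfolding Z_def poly_gegenbauer_poly[symmetric] by (intro continuous_intros)
  have Zm: "Z k \<in> borel_measurable S" for k
    using borel_measurable_continuous_onI[OF Zc] by (simp add: S_def)
  have fm: "f \<in> borel_measurable S" and fi: "integrable S f"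
    using f by (auto simp: S_def)
  define B where "B = (\<lambda>k. m k * gegenbauer l r (r\<^sup>2) k)"
  have ab: "(e \<bullet> y)\<^sup>2 \<le> r\<^sup>2" if "norm y = r" for y
    using Cauchy_Schwarz_ineq[of e y] e that by (simp add: power2_norm_eq_inner[symmetric])
  have tb: "(t / r)\<^sup>2 * r\<^sup>2 < 1"
    using t r by (simp add: power_divide power_less_one_iff)
  have Bs: "summable B"
    using gegenbauer_poisson_sums[OF l _ tb, of r] by (simp add: B_def m_def mult_ac sums_iff)
  have bound: "\<bar>m k * Z k y\<bar> \<le> B k" if "norm y = r" for k y
    using mult_left_mono[OF gegenbauer_abs_le[OF l ab[OF that], of k] m0[of k]] r m0[of k]
    by (simp add: B_def Z_def abs_mult)
  have B0: "B k \<ge> 0" for k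
    using bound[of "r *\<^sub>R e" k] e r by (metis abs_ge_zero norm_scaleR abs_of_pos mult_1_right order_trans)
  have gb: "AE y in S. norm (g k y) \<le> B k * norm (f y)" for k
    unfolding S_def
    by (rule eventually_mono[OF AE_spherical_measure[OF r]])
      (use bound in \<open>auto simp: g_def abs_mult mult.commute[of "\<bar>f _\<bar>"] intro!: mult_right_mono\<close>)
  have gi: "integrable S (g k)" for k
    by (rule Bochner_Integration.integrable_bound[of _ "\<lambda>y. B k * f y"])
      (use gb[of k] fi fm Zm B0[of k] in \<open>auto simp: g_def abs_mult\<close>)
  have s1: "AE y in S. summable (\<lambda>k. norm (g k y))"
    unfolding S_def
  proof (rule eventually_mono[OF AE_spherical_measure[OF r]])
    fix y :: "real^'n" assume y: "norm y = r"
    show "summable (\<lambda>k. norm (g k y))"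
      by (rule summable_comparison_test'[OF summable_mult[OF Bs, of "\<bar>f y\<bar>"]])
        (use bound[OF y] in \<open>auto simp: g_def abs_mult intro!: mult_left_mono\<close>)
  qed
  have s2: "summable (\<lambda>k. \<integral>y. norm (g k y) \<partial>S)"
  proof (rule summable_comparison_test'[OF summable_mult2[OF Bs, of "\<integral>y. norm (f y) \<partial>S"]])
    fix k
    have "(\<integral>y. norm (g k y) \<partial>S) \<le> (\<integral>y. B k * norm (f y) \<partial>S)"
      by (rule integral_mono_AE) (use gi fi gb in auto)
    then show "norm (\<integral>y. norm (g k y) \<partial>S) \<le> B k * (\<integral>y. norm (f y) \<partial>S)"
      by simp
  qed
  have "(\<lambda>k. \<integral>y. g k y \<partial>S) sums (\<integral>y. (\<Sum>k. g k y) \<partial>S)"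
    by (rule sums_integral[OF gi s1 s2])
  also have "(\<integral>y. (\<Sum>k. g k y) \<partial>S) = (\<integral>y. f y * ((1 - t\<^sup>2) * (1 - 2 * t * (e \<bullet> y) / r + t\<^sup>2) powr (- l - 1)) \<partial>S)"
  proof (rule integral_cong_AE)
    show "AE y in S. (\<Sum>k. g k y) = f y * ((1 - t\<^sup>2) * (1 - 2 * t * (e \<bullet> y) / r + t\<^sup>2) powr (- l - 1))"
      unfolding S_def
    proof (rule eventually_mono[OF AE_spherical_measure[OF r]])
      fix y :: "real^'n" assume y: "norm y = r"
      have "(t / r)\<^sup>2 * r\<^sup>2 = t\<^sup>2"
        using r by (simp add: power_divide)
      then have "(\<lambda>k. m k * Z k y) sums ((1 - t\<^sup>2) * (1 - 2 * t * (e \<bullet> y) / r + t\<^sup>2) powr (- l - 1))"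
        using gegenbauer_poisson_sums[OF l ab[OF y] tb] by (simp add: m_def Z_def mult_ac)
      from sums_mult[OF this, of "f y"] show "(\<Sum>k. g k y) = f y * ((1 - t\<^sup>2) * (1 - 2 * t * (e \<bullet> y) / r + t\<^sup>2) powr (- l - 1))"
        by (simp add: g_def sums_iff)
    qed
  qed (use gi fm in \<open>auto simp: S_def\<close>)
  also have "(\<lambda>k. \<integral>y. g k y \<partial>S) = (\<lambda>k. (real k + l) / l * (\<integral>y. f y * Z k y \<partial>S) / r ^ k * t ^ k)"
  proof
    fix k
    have "(\<integral>y. g k y \<partial>S) = (\<integral>y. m k * (f y * Z k y) \<partial>S)"
      by (simp add: g_def mult.left_commute)
    also have "\<dots> = m k * (\<integral>y. f y * Z k y \<partial>S)"
      by (rule integral_mult_right_zero)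
    finally show "(\<integral>y. g k y \<partial>S) = (real k + l) / l * (\<integral>y. f y * Z k y \<partial>S) / r ^ k * t ^ k"
      by (simp add: m_def power_divide)
  qed
  finally show ?thesis
    unfolding S_def Z_def .
qed

text \<open>As \<open>t \<rightarrow> 1\<close>, the Poisson integral of \<open>P\<close> at \<open>t y\<close> tends to \<open>P(y)\<close> times the area: the kernels are
  nonnegative, have constant mass (all means of \<open>Z\<^sub>k\<close> with \<open>k > 0\<close> vanish), and tend to zero uniformly away from \<open>y\<close>.
  The same integral is a power series in \<open>t\<close>, continuous at \<open>1\<close> by the assumption on its radius of convergence.\<close>

lemma sphere_density_expansion:
  fixes P :: "real^'n::finite \<Rightarrow> real" and y :: "real^'n"
  assumes r: "r > 0" and P: "continuous_on (sphere 0 r) P" and y: "norm y = r"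
    and l: "real CARD('n) = 2 * l + 2" "l > 0"
  defines "c \<equiv> (\<lambda>k. (real k + l) / l * (\<integral>z. (indicator (sphere 0 r) z * P z) *
      gegenbauer l ((y /\<^sub>R r) \<bullet> z) (r\<^sup>2) k \<partial>spherical_measure r) / r ^ k)"
  assumes K: "K > 1" "summable (\<lambda>k. c k * K ^ k)"
  shows "P y * measure (spherical_measure r :: (real^'n) measure) UNIV = (\<Sum>k. c k)"
proof -
  define S where "S = (spherical_measure r :: (real^'n) measure)"
  define e where "e = y /\<^sub>R r"
  define f where "f = (\<lambda>z. indicator (sphere 0 r) z * P z)"
  define m where "m = measure S UNIV"
  have e: "norm e = 1"
    using r y by (simp add: e_def)
  have ye: "y = r *\<^sub>R e"
    using r by (simp add: e_def)
  interpret finite_measure S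
    unfolding S_def by (rule finite_spherical_measure[OF r])
  have sp: "space S = UNIV"
    by (simp add: S_def)
  have AES: "AE z in S. norm z = r"
    unfolding S_def by (rule AE_spherical_measure[OF r])
  have f1: "f z = P z" if "norm z = r" for z
    using that by (simp add: f_def)
  have fm: "f \<in> borel_measurable S"
    using borel_measurable_continuous_on_indicator[OF _ P] by (simp add: f_def S_def)
  have "bounded (P ` sphere 0 r)"
    using P by (intro compact_imp_bounded compact_continuous_image) auto
  then obtain B where "\<forall>v\<in>P ` sphere 0 r. norm v \<le> B"
    unfolding bounded_iff by blast
  then have B: "\<bar>P z\<bar> \<le> B" if "norm z = r" for z
    using that by auto
  have B0: "B \<ge> 0"
    using B[OF y] by linarith
  have fi: "integrable S f"
  proof (rule integrable_const_bound[where B = B])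
    show "AE z in S. norm (f z) \<le> B"
      by (rule eventually_mono[OF AES]) (simp add: B f1)
  qed (rule fm)
  define D where "D = (\<lambda>t z. 1 - 2 * t * (e \<bullet> z) / r + t\<^sup>2)"
  define H where "H = (\<lambda>t z. (1 - t\<^sup>2) * D t z powr (- l - 1))"
  have ez: "(e \<bullet> z) / r = 1 - (dist z y)\<^sup>2 / (2 * r\<^sup>2)" if "norm z = r" for z
  proof -
    have "(dist z y)\<^sup>2 = r\<^sup>2 + r\<^sup>2 - 2 * (r * (e \<bullet> z))"
    proof -
      have "(dist z y)\<^sup>2 = z \<bullet> z + y \<bullet> y - 2 * (y \<bullet> z)"
        unfolding dist_norm power2_norm_eq_inner
        by (simp add: inner_diff_left inner_diff_right inner_commute[of z y])
      moreover have "z \<bullet> z = r\<^sup>2" "y \<bullet> y = r\<^sup>2"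
        using that y by (simp_all flip: power2_norm_eq_inner)
      moreover have "y \<bullet> z = r * (e \<bullet> z)"
        by (subst ye) simp
      ultimately show ?thesis
        by simp
    qed
    then show ?thesis
      using r by (simp add: field_simps power2_eq_square)
  qed
  \<comment> \<open>both bounds on the kernel, for all points and for points far from \<open>y\<close>, are read off from this form\<close>
  have D1: "D t z = (1 - t)\<^sup>2 + 2 * t * ((dist z y)\<^sup>2 / (2 * r\<^sup>2))" if "norm z = r" for t z
  proof -
    have "D t z = 1 - 2 * t * ((e \<bullet> z) / r) + t\<^sup>2"
      by (simp add: D_def)
    then show ?thesis
      unfolding ez[OF that] by (simp add: power2_eq_square algebra_simps)
  qed
  have H0: "H t z \<ge> 0" if "0 \<le> t" "t < 1" for t z
    using that by (simp add: H_def power_le_one)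
  have Hm: "H t \<in> borel_measurable S" for t
  proof -
    have "(\<lambda>z. e \<bullet> z) \<in> borel_measurable S"
      unfolding S_def by (simp add: borel_measurable_continuous_onI continuous_intros)
    then show ?thesis
      unfolding H_def D_def by simp
  qed
  have Hb: "H t z \<le> (1 - t\<^sup>2) * b powr (- l - 1)" if "0 \<le> t" "t < 1" "0 < b" "b \<le> D t z" for t z b
    unfolding H_def using that l by (intro mult_left_mono powr_mono2') (auto simp: power_le_one)
  have Hi: "integrable S (H t)" if t: "0 \<le> t" "t < 1" for t
  proof (rule integrable_const_bound[where B = "(1 - t\<^sup>2) * ((1 - t)\<^sup>2) powr (- l - 1)"])
    show "AE z in S. norm (H t z) \<le> (1 - t\<^sup>2) * ((1 - t)\<^sup>2) powr (- l - 1)"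
    proof (rule eventually_mono[OF AES])
      fix z :: "real^'n" assume "norm z = r"
      then have "(1 - t)\<^sup>2 \<le> D t z"
        using t by (simp add: D1)
      then show "norm (H t z) \<le> (1 - t\<^sup>2) * ((1 - t)\<^sup>2) powr (- l - 1)"
        using Hb[OF t, of "(1 - t)\<^sup>2" z] H0[OF t, of z] t by simp
    qed
  qed (rule Hm)
  have mass: "(\<integral>z. H t z \<partial>S) = m" if t: "0 \<le> t" "t < 1" for t
  proof -
    have "(\<lambda>k. (real k + l) / l * (\<integral>z. 1 * gegenbauer l (e \<bullet> z) (r\<^sup>2) k \<partial>S) / r ^ k * t ^ k) sums (\<integral>z. 1 * H t z \<partial>S)"
      using sphere_gegenbauer_sums[OF r e l(2) t, of "\<lambda>_. 1"] unfolding H_def D_def S_def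
      by (simp add: integrable_spherical_measure[OF r])
    moreover have "(\<lambda>k. (real k + l) / l * (\<integral>z. 1 * gegenbauer l (e \<bullet> z) (r\<^sup>2) k \<partial>S) / r ^ k * t ^ k) = (\<lambda>k. if k = 0 then m else 0)"
    proof
      fix k
      show "(real k + l) / l * (\<integral>z. 1 * gegenbauer l (e \<bullet> z) (r\<^sup>2) k \<partial>S) / r ^ k * t ^ k = (if k = 0 then m else 0)"
      proof (cases "k = 0")
        case True
        then show ?thesis
          using l by (simp add: m_def S_def)
      next
        case False
        then have "(\<integral>z. gegenbauer l (e \<bullet> z) (r\<^sup>2) k \<partial>S) = 0"
          unfolding S_def by (intro integral_gegenbauer_sphere[OF r e l]) simp
        then show ?thesis
          using False by simp
      qed
    qed
    moreover have "(\<lambda>k::nat. if k = 0 then m else 0) sums m"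
      using sums_single[of 0 "\<lambda>_. m"] by simp
    ultimately show ?thesis
      using sums_unique2 by fastforce
  qed
  have ser: "(\<integral>z. f z * H t z \<partial>S) = (\<Sum>k. c k * t ^ k)" if t: "0 \<le> t" "t < 1" for t
    using sphere_gegenbauer_sums[OF r e l(2) t, of f] fi
    unfolding H_def D_def S_def c_def e_def f_def by (simp add: sums_iff)
  have fHi: "integrable S (\<lambda>z. f z * H t z)" if t: "0 \<le> t" "t < 1" for t
  proof (rule Bochner_Integration.integrable_bound[of _ "\<lambda>z. B * H t z"])
    show "AE z in S. norm (f z * H t z) \<le> norm (B * H t z)"
      by (rule eventually_mono[OF AES]) (use B f1 B0 in \<open>auto simp: abs_mult intro!: mult_right_mono\<close>)
  qed (use Hi[OF t] fm Hm in auto)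
  have lim1: "((\<lambda>t. \<integral>z. f z * H t z \<partial>S) \<longlongrightarrow> P y * m) (at_left 1)"
  proof (rule tendstoI)
    fix \<epsilon> :: real assume \<epsilon>: "\<epsilon> > 0"
    have m0: "m \<ge> 0"
      by (simp add: m_def)
    define \<epsilon>' where "\<epsilon>' = \<epsilon> / (2 * (m + 1))"
    have \<epsilon>': "\<epsilon>' > 0"
      using \<epsilon> m0 by (simp add: \<epsilon>'_def)
    have \<epsilon>m: "\<epsilon>' * m < \<epsilon>"
      using \<epsilon> m0 by (simp add: \<epsilon>'_def divide_simps)
    obtain \<delta> where \<delta>: "\<delta> > 0" "\<And>z. norm z = r \<Longrightarrow> dist z y < \<delta> \<Longrightarrow> \<bar>P z - P y\<bar> < \<epsilon>'"
      using P y \<epsilon>' unfolding continuous_on_iff by (metis dist_real_def mem_sphere_0)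
    define \<eta> where "\<eta> = \<delta>\<^sup>2 / (2 * r\<^sup>2)"
    have \<eta>: "\<eta> > 0"
      using \<delta> r by (simp add: \<eta>_def)
    define E where "E = \<eta> powr (- l - 1)"
    have pt: "\<bar>f z - P y\<bar> * H t z \<le> \<epsilon>' * H t z + 2 * B * ((1 - t\<^sup>2) * E)"
      if t: "1 / 2 < t" "t < 1" and z: "norm z = r" for t z
    proof (cases "dist z y < \<delta>")
      case True
      have "(1 - t\<^sup>2) * E \<ge> 0"
        using t by (simp add: E_def power_le_one)
      moreover have "\<bar>f z - P y\<bar> * H t z \<le> \<epsilon>' * H t z"
        using \<delta>(2)[OF z True] f1[OF z] H0[of t z] t by (intro mult_right_mono) auto
      ultimately show ?thesis
        using B0 by (smt (verit) mult_nonneg_nonneg)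
    next
      case False
      then have "\<eta> \<le> (dist z y)\<^sup>2 / (2 * r\<^sup>2)"
        using \<delta>(1) r unfolding \<eta>_def by (intro divide_right_mono power_mono) auto
      then have "1 * \<eta> \<le> 2 * t * ((dist z y)\<^sup>2 / (2 * r\<^sup>2))"
        using t \<eta> by (intro mult_mono) auto
      then have "\<eta> \<le> D t z"
        unfolding D1[OF z] by (smt (verit) zero_le_power2)
      then have h: "H t z \<le> (1 - t\<^sup>2) * E"
        using Hb[of t \<eta> z] t \<eta> by (simp add: E_def)
      have "\<bar>f z - P y\<bar> \<le> 2 * B"
        using B[OF z] B[OF y] f1[OF z] by linarith
      then have "\<bar>f z - P y\<bar> * H t z \<le> 2 * B * ((1 - t\<^sup>2) * E)"
        using h H0[of t z] t B0 by (intro mult_mono) auto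
      moreover have "\<epsilon>' * H t z \<ge> 0"
        using \<epsilon>' H0[of t z] t by simp
      ultimately show ?thesis
        by linarith
    qed
    have bd: "\<bar>(\<integral>z. f z * H t z \<partial>S) - P y * m\<bar> \<le> \<epsilon>' * m + 2 * B * ((1 - t\<^sup>2) * E) * m"
      if t: "1 / 2 < t" "t < 1" for t
    proof -
      have t': "0 \<le> t" "t < 1"
        using t by auto
      have "(\<integral>z. f z * H t z \<partial>S) - P y * m = (\<integral>z. f z * H t z - P y * H t z \<partial>S)"
        unfolding mass[OF t', symmetric] using fHi[OF t'] Hi[OF t'] by simp
      also have "\<bar>\<dots>\<bar> \<le> (\<integral>z. \<bar>f z * H t z - P y * H t z\<bar> \<partial>S)"
        by (rule integral_abs_bound)
      also have "\<dots> \<le> (\<integral>z. \<epsilon>' * H t z + 2 * B * ((1 - t\<^sup>2) * E) \<partial>S)"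
      proof (rule integral_mono_AE)
        show "AE z in S. \<bar>f z * H t z - P y * H t z\<bar> \<le> \<epsilon>' * H t z + 2 * B * ((1 - t\<^sup>2) * E)"
        proof (rule eventually_mono[OF AES])
          fix z :: "real^'n" assume z: "norm z = r"
          have "\<bar>f z * H t z - P y * H t z\<bar> = \<bar>f z - P y\<bar> * H t z"
            using H0[OF t', of z] by (simp add: left_diff_distrib[symmetric] abs_mult)
          then show "\<bar>f z * H t z - P y * H t z\<bar> \<le> \<epsilon>' * H t z + 2 * B * ((1 - t\<^sup>2) * E)"
            using pt[OF t z] by simp
        qed
      qed (use fHi[OF t'] Hi[OF t'] in auto)
      also have "\<dots> = \<epsilon>' * m + 2 * B * ((1 - t\<^sup>2) * E) * m"
        using Hi[OF t'] mass[OF t'] by (simp add: m_def sp)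
      finally show ?thesis .
    qed
    have "((\<lambda>t. \<epsilon>' * m + 2 * B * ((1 - t\<^sup>2) * E) * m) \<longlongrightarrow> \<epsilon>' * m + 2 * B * ((1 - 1\<^sup>2) * E) * m) (at_left 1)"
      by (intro tendsto_intros)
    then have "\<forall>\<^sub>F t in at_left 1. \<epsilon>' * m + 2 * B * ((1 - t\<^sup>2) * E) * m < \<epsilon>"
      by (rule order_tendstoD) (use \<epsilon>m in simp)
    moreover have "\<forall>\<^sub>F t::real in at_left 1. 1 / 2 < t \<and> t < 1"
      by (auto simp: eventually_at_left_field intro!: exI[of _ "1/2"])
    ultimately show "\<forall>\<^sub>F t in at_left 1. dist (\<integral>z. f z * H t z \<partial>S) (P y * m) < \<epsilon>"
    proof eventually_elim
      case (elim t)
      then show ?case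
        using bd[of t] by (simp add: dist_real_def)
    qed
  qed
  have "isCont (\<lambda>t. \<Sum>k. c k * t ^ k) 1"
    by (rule isCont_powser[OF K(2)]) (use K(1) in simp)
  then have "((\<lambda>t. \<Sum>k. c k * t ^ k) \<longlongrightarrow> (\<Sum>k. c k)) (at_left 1)"
    by (auto simp: isCont_def intro: filterlim_mono at_le)
  moreover have "\<forall>\<^sub>F t::real in at_left 1. (\<Sum>k. c k * t ^ k) = (\<integral>z. f z * H t z \<partial>S)"
    using ser by (auto simp: eventually_at_left_field intro!: exI[of _ 0])
  ultimately have "((\<lambda>t. \<integral>z. f z * H t z \<partial>S) \<longlongrightarrow> (\<Sum>k. c k)) (at_left 1)"
    by (rule Lim_transform_eventually)
  with lim1 have "P y * m = (\<Sum>k. c k)"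
    by (rule tendsto_unique[OF trivial_limit_at_left_real])
  then show ?thesis
    by (simp add: m_def S_def)
qed

section \<open>Moments of the exit distribution\<close>

text \<open>The density of the exit position vanishes off the sphere. In particular almost all paths exit.\<close>

lemma exit_position_AE_sphere:
  assumes P: "is_Poisson_kernel M X r P"
  shows "AE \<omega> in M. norm (exit_position X r \<omega>) = r"
proof -
  have d: "distributed M (spherical_measure r) (exit_position X r) (\<lambda>y. ennreal (indicator (sphere 0 r) y * P y))"
    using P by (simp add: is_Poisson_kernel_def)
  have m: "exit_position X r \<in> measurable M (spherical_measure r)"
    using d by (simp add: distributed_def)
  have f: "(\<lambda>y. ennreal (indicator (sphere 0 r) y * P y)) \<in> borel_measurable (spherical_measure r)"
    using d by (simp add: distributed_def)
  have "AE y in density (spherical_measure r) (\<lambda>y. ennreal (indicator (sphere 0 r) y * P y)). norm y = r"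
    unfolding AE_density[OF f] by (rule AE_I2) (auto simp: indicator_def split: if_splits)
  then have "AE y in distr M (spherical_measure r) (exit_position X r). norm y = r"
    unfolding distributed_distr_eq_density[OF d] .
  then show ?thesis
    by (rule AE_distrD[OF m])
qed

text \<open>The mean value property at the exit time for the test function built from \<open>Z\<^sub>k\<close>, read on the sphere, where its
  radial factor is constant.\<close>

lemma Poisson_kernel_gegenbauer_moment:
  fixes X :: "real \<Rightarrow> 'w \<Rightarrow> real^'n::finite" and e :: "real^'n" and k :: nat
  assumes n: "CARD('n) > 2" and r: "0 < r" "r < 1" and x: "norm x < r" and e: "norm e = 1"
    and X: "hyperbolic_BM M X x" and P: "is_Poisson_kernel M X r P"
  defines "\<phi> \<equiv> eval_fps (hypergeo_fps (real k) (- rho CARD('n)) (real k + real CARD('n) / 2))"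
  shows "(\<integral>z. (indicator (sphere 0 r) z * P z) * gegenbauer (rho CARD('n)) (e \<bullet> z) (r\<^sup>2) k \<partial>spherical_measure r) * \<phi> (r\<^sup>2)
     = gegenbauer (rho CARD('n)) (e \<bullet> x) ((norm x)\<^sup>2) k * \<phi> ((norm x)\<^sup>2)"
proof -
  obtain u where u: "C2_compact_support u"
    "\<And>z. norm z \<le> r \<Longrightarrow> u z = gegenbauer (rho CARD('n)) (e \<bullet> z) ((norm z)\<^sup>2) k * \<phi> ((norm z)\<^sup>2)"
    "\<And>z. norm z \<le> r \<Longrightarrow> hyp_laplacian u z = 0"
    using hyp_harmonic_test_function[OF e n r, of k] unfolding \<phi>_def by blast
  define Z where "Z = (\<lambda>z. gegenbauer (rho CARD('n)) (e \<bullet> z) (r\<^sup>2) k)"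
  have d: "distributed M (spherical_measure r) (exit_position X r) (\<lambda>y. ennreal (indicator (sphere 0 r) y * P y))"
    and P0: "\<And>y. y \<in> sphere 0 r \<Longrightarrow> 0 \<le> P y"
    using P by (auto simp: is_Poisson_kernel_def)
  have m: "exit_position X r \<in> borel_measurable M"
    using d measurable_cong_sets[OF refl sets_spherical_measure] by (auto simp: distributed_def)
  have ae: "AE \<omega> in M. norm (exit_position X r \<omega>) = r"
    by (rule exit_position_AE_sphere[OF P])
  have Zc: "continuous_on UNIV Z"
    unfolding Z_def poly_gegenbauer_poly[symmetric] by (intro continuous_intros)
  then have Zm: "Z \<in> borel_measurable borel"
    by (rule borel_measurable_continuous_onI)
  have uc: "u \<in> borel_measurable borel"
    using u(1) unfolding C2_compact_support_def
    by (intro borel_measurable_continuous_onI continuous_at_imp_continuous_on) (auto intro: differentiable_imp_continuous_within)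
  have "u x = (\<integral>\<omega>. u (exit_position X r \<omega>) \<partial>M)"
    by (rule exit_mean_value[OF X u(1,3) x m ae, symmetric])
  also have "\<dots> = (\<integral>\<omega>. Z (exit_position X r \<omega>) * \<phi> (r\<^sup>2) \<partial>M)"
  proof (rule integral_cong_AE)
    show "AE \<omega> in M. u (exit_position X r \<omega>) = Z (exit_position X r \<omega>) * \<phi> (r\<^sup>2)"
      by (rule eventually_mono[OF ae]) (simp add: u(2) Z_def)
  qed (use measurable_compose[OF m uc] measurable_compose[OF m Zm] in auto)
  also have "\<dots> = (\<integral>\<omega>. Z (exit_position X r \<omega>) \<partial>M) * \<phi> (r\<^sup>2)"
    by (rule integral_mult_left_zero)
  also have "(\<integral>\<omega>. Z (exit_position X r \<omega>) \<partial>M) = (\<integral>z. (indicator (sphere 0 r) z * P z) * Z z \<partial>spherical_measure r)"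
    by (rule distributed_integral[OF d, symmetric]) (use Zm P0 in \<open>auto simp: indicator_def\<close>)
  finally show ?thesis
    using u(2)[of x] x by (simp add: Z_def)
qed

section \<open>The functions H and w\<close>

text \<open>At \<open>k = -n/2\<close> the factor \<open>1 / \<Gamma>(k + n/2)\<close> kills the constant term, and the remaining series is, shifted by
  one, a multiple of the series at \<open>k = 1 - \<rho>\<close>.\<close>

lemma f_z_half_dim:
  assumes n: "n > 2" and z: "\<bar>z\<bar> < 1"
  shows "f_z n z (of_real (- (real n / 2))) = of_real (real n / 2 * rho n * z) * f_z n z (of_real (1 - rho n))"
proof -
  define l where "l = complex_of_real (rho n)"
  have nl: "complex_of_real (real n / 2) = l + 1" "(of_nat n :: complex) / 2 = l + 1"
    by (simp_all add: l_def rho_def add_divide_distrib diff_divide_distrib)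
  define T where "T = (\<lambda>i. pochhammer (1 - l) i * pochhammer (- l) i / (fact (Suc i) * fact i) * complex_of_real z ^ i)"
  have rG: "rGamma (of_nat (Suc i) :: complex) = 1 / fact i" for i
    by (simp add: rGamma_inverse_Gamma Gamma_fact[symmetric] divide_inverse add.commute)
  have 1: "f_z n z (of_real (1 - rho n)) = (\<Sum>i. T i)"
    unfolding f_z_def
  proof (rule suminf_cong)
    fix i
    have "of_real (1 - rho n) + of_nat n / 2 + of_nat i = (of_nat (Suc (Suc i)) :: complex)"
      unfolding nl by (simp add: l_def)
    then show "pochhammer (complex_of_real (1 - rho n)) i * pochhammer (- of_real (rho n)) i *
       rGamma (of_real (1 - rho n) + of_nat n / 2 + of_nat i) / fact i * of_real z ^ i = T i"
      by (simp only: rG T_def) (simp add: l_def mult_ac)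
  qed
  define U where "U = (\<lambda>i. pochhammer (- (l + 1)) i * pochhammer (- l) i * rGamma (of_nat i) / fact i * complex_of_real z ^ i)"
  have 2: "f_z n z (of_real (- (real n / 2))) = (\<Sum>i. U i)"
    unfolding f_z_def U_def of_real_minus nl l_def[symmetric] by (simp add: mult_ac)
  have U0: "U 0 = 0"
    by (simp add: U_def)
  have US: "U (Suc i) = (l + 1) * l * of_real z * T i" for i
  proof -
    have p: "pochhammer (- (l + 1)) (Suc i) = - (l + 1) * pochhammer (- l) i" "pochhammer (- l) (Suc i) = - l * pochhammer (1 - l) i"
      by (simp_all add: pochhammer_rec add.commute[of 1])
    show ?thesis
      unfolding U_def T_def p rG by (simp add: field_simps)
  qed
  have "summable T"
  proof -
    have "summable (\<lambda>i. pochhammer (1 - l) i * pochhammer (- l) i / (pochhammer 2 i * fact i) * complex_of_real z ^ i)"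
      by (rule summable_hypergeo) (use z in \<open>auto elim!: nonpos_Ints_cases simp: complex_eq_iff\<close>)
    moreover have "pochhammer (2::complex) i = fact (Suc i)" for i
    proof -
      have "fact (Suc i) = pochhammer (1::complex) (Suc i)"
        by (rule pochhammer_fact)
      also have "\<dots> = pochhammer 2 i"
        by (subst pochhammer_rec) simp
      finally show ?thesis by simp
    qed
    ultimately show ?thesis
      unfolding T_def by simp
  qed
  then have "(\<lambda>i. U (Suc i)) sums ((l + 1) * l * of_real z * (\<Sum>i. T i))"
    unfolding US by (intro sums_mult summable_sums)
  then have "U sums ((l + 1) * l * of_real z * (\<Sum>i. T i))"
    using U0 by (subst (asm) sums_Suc_iff) simp
  then show ?thesis
    unfolding 1 2 by (simp only: sums_iff of_real_mult nl l_def)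
qed

text \<open>The combination in the second statement is the one that \<open>\<rho> h\<close> produces. In it the quotients of
  hypergeometric functions at \<open>1 - \<rho>\<close> and at \<open>-n/2\<close> cancel, by \<open>f_z_half_dim\<close>. This remains true if
  the denominators vanish, since then both quotients are zero.\<close>

lemma H_fun_special_values:
  fixes s R :: real
  assumes n: "n > 2" and s: "0 \<le> s" "s < R" "R < 1"
  defines "l \<equiv> rho n" and "A \<equiv> ((1 - s) / (1 - R)) powr rho n"
    and "E \<equiv> real n / 2 * ((R - s) / ((1 - R) * (1 - s)))" and "C \<equiv> (1 - R) ^ (n - 2) / (R - s)"
  shows "H_fun n s R (of_real (- l)) = of_real (C * (A * E))"
    and "of_real l * (of_real s * (H_fun n s R (of_real (1 - l)) - H_fun n s R (of_real (- l)))
       + of_real R * (H_fun n s R (of_real (- (real n / 2))) - H_fun n s R (of_real (- l)))) = of_real (C * (A * (R - s)))"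
proof -
  have l: "l > 0"
    using n by (simp add: l_def rho_def)
  then have lc: "complex_of_real l \<noteq> 0"
    by simp
  have R: "complex_of_real R \<noteq> 0"
    using s by simp
  show 1: "H_fun n s R (of_real (- l)) = of_real (C * (A * E))"
    unfolding H_fun_def by (fold l_def A_def E_def C_def) simp
  define Q where "Q = f_z n s (of_real (1 - l)) / f_z n R (of_real (1 - l))"
  define a e c where "a = complex_of_real A" and "e = complex_of_real E" and "c = complex_of_real C"
  have 2: "H_fun n s R (of_real (1 - l)) = c * (Q / of_real l - a * (1 / of_real l - e))"
    unfolding H_fun_def Q_def a_def e_def c_def by (fold l_def A_def E_def C_def) simp
  have nl: "real n / 2 = l + 1"
    by (simp add: l_def rho_def diff_divide_distrib)
  \<comment> \<open>all factors of \<open>f_z_half_dim\<close> other than \<open>s\<close> and \<open>R\<close> cancel, even if the denominator is zero\<close>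
  have q: "f_z n s (of_real (- (real n / 2))) / f_z n R (of_real (- (real n / 2))) = of_real s / of_real R * Q"
  proof -
    have c0: "complex_of_real (real n / 2 * rho n) \<noteq> 0"
      using n l by (simp add: l_def)
    have "(k * u * f) / (k * v * g) = u / v * (f / g)" if "k \<noteq> 0" for k u v f g :: complex
      using that by simp
    note cancel = this[OF c0]
    have fs: "f_z n z (of_real (- (real n / 2))) = of_real (real n / 2 * rho n) * of_real z * f_z n z (of_real (1 - l))"
      if "\<bar>z\<bar> < 1" for z
      using f_z_half_dim[OF n that] by (simp only: of_real_mult l_def)
    have "\<bar>s\<bar> < 1" "\<bar>R\<bar> < 1"
      using s by auto
    then show ?thesis
      unfolding Q_def by (simp only: fs cancel)
  qed
  have 3: "H_fun n s R (of_real (- (real n / 2))) = c * (- (of_real s / of_real R * Q) / of_real l - a * (- 1 / of_real l - e))"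
  proof -
    have "(of_real (- (real n / 2)) + of_real l) / of_real l = (- 1 / of_real l :: complex)"
      unfolding nl by simp
    then show ?thesis
      unfolding H_fun_def q a_def e_def c_def by (fold l_def A_def E_def C_def) simp
  qed
  show "of_real l * (of_real s * (H_fun n s R (of_real (1 - l)) - H_fun n s R (of_real (- l)))
       + of_real R * (H_fun n s R (of_real (- (real n / 2))) - H_fun n s R (of_real (- l)))) = of_real (C * (A * (R - s)))"
    unfolding 1 2 3 using lc R by (simp add: a_def[symmetric] e_def[symmetric] c_def[symmetric] field_simps)
qed

text \<open>The representation of \<open>H\<close> at real arguments of the half-plane down to \<open>-n/2\<close>, in real terms.\<close>

lemma real_Laplace_of_H:
  assumes w: "inverse_Laplace_of_H n s R w" and a: "a \<le> real n / 2"
  shows "set_integrable lborel {0<..} (\<lambda>v. exp (a * v) * w v)"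
    and "H_fun n s R (of_real (- a)) = of_real (LINT v:{0<..}|lborel. exp (a * v) * w v)"
proof -
  obtain \<epsilon> where \<epsilon>: "\<epsilon> > 0" "\<And>k. Re k \<ge> - real n / 2 - \<epsilon> \<Longrightarrow>
        set_integrable lborel {0<..} (\<lambda>v. exp (- k * of_real v) * of_real (w v)) \<and>
        H_fun n s R k = (LINT v:{0<..}|lborel. exp (- k * of_real v) * of_real (w v))"
    using w unfolding inverse_Laplace_of_H_def by blast
  have k: "Re (of_real (- a)) \<ge> - real n / 2 - \<epsilon>"
    using a \<epsilon>(1) by simp
  have e: "indicator {0<..} v *\<^sub>R (exp (- of_real (- a) * of_real v) * of_real (w v)) =
     complex_of_real (indicator {0<..} v *\<^sub>R (exp (a * v) * w v))" for v
    by (simp add: scaleR_conv_of_real flip: exp_of_real)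
  show "set_integrable lborel {0<..} (\<lambda>v. exp (a * v) * w v)"
    using \<epsilon>(2)[OF k] unfolding set_integrable_def e complex_of_real_integrable_eq by simp
  show "H_fun n s R (of_real (- a)) = of_real (LINT v:{0<..}|lborel. exp (a * v) * w v)"
    using \<epsilon>(2)[OF k] unfolding set_lebesgue_integral_def e integral_complex_of_real by simp
qed

lemma of_nat_add_half_notin_nonpos_Ints:
  assumes "n > 0"
  shows "(of_nat k :: complex) + of_nat n / 2 \<notin> \<int>\<^sub>\<le>\<^sub>0"
proof
  assume "(of_nat k :: complex) + of_nat n / 2 \<in> \<int>\<^sub>\<le>\<^sub>0"
  moreover have "(of_nat k :: complex) + of_nat n / 2 = of_real (real k + real n / 2)"
    by simp
  ultimately have "real k + real n / 2 \<in> \<int>\<^sub>\<le>\<^sub>0"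
    by (simp only: of_real_in_nonpos_Ints_iff)
  then show False
    using nonpos_Ints_nonpos[of "real k + real n / 2"] assms by auto
qed

text \<open>The equation defining \<open>H\<close> at \<open>k \<in> \<nat>\<close>, where the Gamma factors in \<open>f\<^sub>z\<close> cancel in the quotient.\<close>

lemma F_k_ratio_Laplace:
  fixes n k :: nat and s R :: real
  assumes n: "n > 2" and s: "0 \<le> s" "s < R" "R < 1" and w: "inverse_Laplace_of_H n s R w"
  defines "\<phi> \<equiv> (\<lambda>z. eval_fps (hypergeo_fps (real k) (- rho n) (real k + real n / 2)) z)"
  shows "(real k + rho n) / rho n * (\<phi> s / \<phi> R) =
    ((1 - s) / (1 - R)) powr rho n * ((real k + rho n) / rho n - real n / 2 * ((R - s) / ((1 - R) * (1 - s))))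
     + (R - s) / (1 - R) ^ (n - 2) * (LINT v:{0<..}|lborel. exp (- real k * v) * w v)"
proof -
  have k0: "(of_nat k :: complex) + of_nat n / 2 \<notin> \<int>\<^sub>\<le>\<^sub>0"
    by (rule of_nat_add_half_notin_nonpos_Ints) (use n in simp)
  have f: "f_z n z (of_nat k) = of_real (\<phi> z) / Gamma (of_nat k + of_nat n / 2)" if "\<bar>z\<bar> < 1" for z
    using f_z_eq[OF that k0] F_k_of_nat[OF that, of n k] n by (simp add: \<phi>_def)
  have G: "Gamma ((of_nat k :: complex) + of_nat n / 2) \<noteq> 0"
    using k0 by (simp add: Gamma_eq_zero_iff)
  have "\<bar>s\<bar> < 1" "\<bar>R\<bar> < 1"
    using s by auto
  then have ratio: "f_z n s (of_nat k) / f_z n R (of_nat k) = of_real (\<phi> s / \<phi> R)"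
    using G by (simp add: f)
  have "H_fun n s R (of_real (- (- real k))) = of_real (LINT v:{0<..}|lborel. exp (- real k * v) * w v)"
    by (rule real_Laplace_of_H(2)[OF w]) simp
  then have H: "H_fun n s R (of_nat k) = of_real (LINT v:{0<..}|lborel. exp (- real k * v) * w v)"
    by simp
  have "complex_of_real ((real k + rho n) / rho n * (\<phi> s / \<phi> R)) =
    of_real (((1 - s) / (1 - R)) powr rho n * ((real k + rho n) / rho n - real n / 2 * ((R - s) / ((1 - R) * (1 - s))))
     + (R - s) / (1 - R) ^ (n - 2) * (LINT v:{0<..}|lborel. exp (- real k * v) * w v))"
    using H_fun_eq[OF s(2,3), of "of_nat k" n] unfolding ratio H by simp
  then show ?thesis
    by (simp only: of_real_eq_iff)
qed

section \<open>Summation of the series and the formula for the Poisson kernel\<close>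

text \<open>The sum of the zonal expansion once its coefficients are known to be an affine function of \<open>k\<close> plus a
  Laplace transform: the affine part is summed by the two generating functions, and under the integral
  the factor \<open>e\<^bsup>-kv\<^esup>\<close> rescales the variable of the generating function. Since \<open>b < r\<^sup>2\<close>, there is room for a radius of
  convergence larger than \<open>1\<close>.\<close>

lemma Gegenbauer_series_identity:
  fixes a b r A B E :: real
  assumes l: "l > 0" and r: "r > 0" and ab: "a\<^sup>2 \<le> b" "b < r\<^sup>2"
    and W: "set_integrable lborel {0<..} w"
  defines "\<Lambda> \<equiv> (\<lambda>k. LINT v:{0<..}|lborel. exp (- real k * v) * w v)"
  defines "c \<equiv> (\<lambda>k. (A * ((real k + l) / l - E) + B * \<Lambda> k) * gegenbauer l a b k / r ^ k)"
  shows "\<exists>K>1. summable (\<lambda>k. c k * K ^ k)"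
    and "set_integrable lborel {0<..} (\<lambda>v. w v * (1 - 2 * exp (- v) * a / r + exp (- v) ^ 2 * b / r\<^sup>2) powr (- l))"
    and "(\<Sum>k. c k) = A * (1 - b / r\<^sup>2) * (1 - 2 * a / r + b / r\<^sup>2) powr (- l - 1)
       - A * E * (1 - 2 * a / r + b / r\<^sup>2) powr (- l)
       + B * (LINT v:{0<..}|lborel. w v * (1 - 2 * exp (- v) * a / r + exp (- v) ^ 2 * b / r\<^sup>2) powr (- l))"
proof -
  have b: "b \<ge> 0"
    using ab zero_le_power2[of a] by linarith
  define Z where "Z = gegenbauer l a b"
  define Y where "Y = gegenbauer l (sqrt b) b"
  have ZY: "\<bar>Z k\<bar> \<le> Y k" for k
    unfolding Z_def Y_def by (rule gegenbauer_abs_le[OF l ab(1)])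
  have Y0: "Y k \<ge> 0" for k
    using ZY[of k] by linarith
  \<comment> \<open>chosen so that \<open>1 < K\<^sup>2\<close> and \<open>K\<^sup>2 b < r\<^sup>2\<close>\<close>
  define K where "K = sqrt (2 * r\<^sup>2 / (r\<^sup>2 + b))"
  have r2: "r\<^sup>2 > 0"
    using r by simp
  have K2: "K\<^sup>2 = 2 * r\<^sup>2 / (r\<^sup>2 + b)"
    unfolding K_def using r2 b by (intro real_sqrt_pow2) simp
  have K1: "K > 1"
    unfolding K_def using ab r2 b by (simp add: divide_simps)
  have Kb: "(K / r)\<^sup>2 * b < 1"
  proof -
    have "(K / r)\<^sup>2 * b = 2 * b / (r\<^sup>2 + b)"
      using r2 by (simp add: power_divide K2)
    also have "\<dots> < 1"
      using ab r2 b by (simp add: divide_simps)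
    finally show ?thesis .
  qed
  have wi: "set_integrable lborel {0<..} (\<lambda>v. \<bar>w v\<bar>)"
    using W by (rule set_integrable_abs)
  define I where "I = (LINT v:{0<..}|lborel. \<bar>w v\<bar>)"
  have wm: "(\<lambda>v. indicator {0<..} v *\<^sub>R w v) \<in> borel_measurable lborel"
    using W by (simp add: set_integrable_def borel_measurable_integrable)
  have exi: "set_integrable lborel {0<..} (\<lambda>v. exp (- real k * v) * w v)" for k
  proof -
    have "integrable lborel (\<lambda>v. exp (- real k * v) * (indicator {0<..} v *\<^sub>R w v))"
    proof (rule Bochner_Integration.integrable_bound)
      show "integrable lborel (\<lambda>v. indicator {0<..} v *\<^sub>R w v)"
        using W by (simp add: set_integrable_def)
      show "AE v in lborel. norm (exp (- real k * v) * (indicator {0<..} v *\<^sub>R w v)) \<le> norm (indicator {0<..} v *\<^sub>R w v)"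
        by (rule AE_I2) (auto simp: indicator_def abs_mult intro!: mult_left_le_one_le)
    qed (use wm in measurable)
    then show ?thesis
      by (simp add: set_integrable_def mult_ac)
  qed
  have \<Lambda>I: "\<bar>\<Lambda> k\<bar> \<le> I" for k
  proof -
    have "\<bar>\<Lambda> k\<bar> \<le> (LINT v:{0<..}|lborel. \<bar>exp (- real k * v) * w v\<bar>)"
      unfolding \<Lambda>_def set_lebesgue_integral_def
      by (rule order_trans[OF integral_abs_bound]) (auto simp: abs_mult intro!: Bochner_Integration.integral_mono_AE)
    also have "\<dots> \<le> I"
      unfolding I_def by (rule set_integral_mono[OF set_integrable_abs[OF exi] wi]) (auto simp: abs_mult intro!: mult_left_le_one_le)
    finally show ?thesis .
  qed
  have I0: "I \<ge> 0"
    using \<Lambda>I[of 0] by linarith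
  have sb: "(sqrt b)\<^sup>2 \<le> b"
    using b by simp
  have "summable (\<lambda>k. \<bar>A\<bar> * ((real k + l) / l * Y k * (K / r) ^ k) + (\<bar>A * E\<bar> + \<bar>B\<bar> * I) * (Y k * (K / r) ^ k))"
    using gegenbauer_poisson_sums[OF l sb Kb] gegenbauer_sums[OF sb Kb, of l] unfolding Y_def
    by (intro summable_add summable_mult) (auto simp: sums_iff)
  then have "summable (\<lambda>k. c k * K ^ k)"
  proof (rule summable_comparison_test'[of _ 0])
    fix k
    have "\<bar>A * ((real k + l) / l - E) + B * \<Lambda> k\<bar> \<le> \<bar>A\<bar> * ((real k + l) / l) + (\<bar>A * E\<bar> + \<bar>B\<bar> * I)"
    proof -
      have "A * ((real k + l) / l - E) + B * \<Lambda> k = A * ((real k + l) / l) - A * E + B * \<Lambda> k"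
        by (simp add: right_diff_distrib)
      moreover have "\<bar>A * ((real k + l) / l)\<bar> = \<bar>A\<bar> * ((real k + l) / l)"
        using l by (simp add: abs_mult)
      moreover have "\<bar>B * \<Lambda> k\<bar> \<le> \<bar>B\<bar> * I"
        using \<Lambda>I[of k] by (simp add: abs_mult mult_left_mono)
      ultimately show ?thesis
        by linarith
    qed
    then have "\<bar>A * ((real k + l) / l - E) + B * \<Lambda> k\<bar> * \<bar>Z k\<bar> \<le> (\<bar>A\<bar> * ((real k + l) / l) + (\<bar>A * E\<bar> + \<bar>B\<bar> * I)) * Y k"
      using ZY[of k] Y0[of k] by (intro mult_mono) auto
    then have "\<bar>A * ((real k + l) / l - E) + B * \<Lambda> k\<bar> * \<bar>Z k\<bar> * (K / r) ^ k \<le> (\<bar>A\<bar> * ((real k + l) / l) + (\<bar>A * E\<bar> + \<bar>B\<bar> * I)) * Y k * (K / r) ^ k"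
      using K1 r by (intro mult_right_mono) auto
    moreover have "norm (c k * K ^ k) = \<bar>A * ((real k + l) / l - E) + B * \<Lambda> k\<bar> * \<bar>Z k\<bar> * (K / r) ^ k"
      using K1 r by (simp add: c_def Z_def abs_mult power_divide)
    ultimately show "norm (c k * K ^ k) \<le> \<bar>A\<bar> * ((real k + l) / l * Y k * (K / r) ^ k) + (\<bar>A * E\<bar> + \<bar>B\<bar> * I) * (Y k * (K / r) ^ k)"
      by (simp add: algebra_simps)
  qed
  then show "\<exists>K>1. summable (\<lambda>k. c k * K ^ k)"
    using K1 by blast
  have rb: "(1 / r)\<^sup>2 * b < 1"
    using ab r2 by (simp add: power_divide)
  define g where "g = (\<lambda>k v. indicator {0<..} v *\<^sub>R (exp (- real k * v) * w v) * (Z k / r ^ k))"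
  have gi: "integrable lborel (g k)" for k
    using exi[of k] unfolding g_def set_integrable_def by (rule integrable_mult_left)
  have gb: "\<bar>g k v\<bar> \<le> (indicator {0<..} v *\<^sub>R \<bar>w v\<bar>) * (Y k / r ^ k)" for k v
  proof -
    have "\<bar>indicator {0<..} v *\<^sub>R (exp (- real k * v) * w v)\<bar> \<le> indicator {0<..} v *\<^sub>R \<bar>w v\<bar>"
      by (auto simp: indicator_def abs_mult intro!: mult_left_le_one_le)
    moreover have "\<bar>Z k / r ^ k\<bar> \<le> Y k / r ^ k"
      using ZY[of k] r by (simp add: divide_right_mono)
    ultimately show ?thesis
      unfolding g_def abs_mult by (intro mult_mono) auto
  qed
  have Ys: "summable (\<lambda>k. Y k / r ^ k)"
    using gegenbauer_sums[OF sb rb, of l] by (simp add: Y_def sums_iff power_divide)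
  have s1: "AE v in lborel. summable (\<lambda>k. norm (g k v))"
    by (rule AE_I2, rule summable_comparison_test'[OF summable_mult[OF Ys], of 0]) (use gb in auto)
  have s2: "summable (\<lambda>k. \<integral>v. norm (g k v) \<partial>lborel)"
  proof (rule summable_comparison_test'[OF summable_mult[OF Ys, of I], of 0])
    fix k
    have "(\<integral>v. norm (g k v) \<partial>lborel) \<le> (\<integral>v. (indicator {0<..} v *\<^sub>R \<bar>w v\<bar>) * (Y k / r ^ k) \<partial>lborel)"
      by (rule integral_mono) (use gi gb wi in \<open>auto simp: set_integrable_def intro!: integrable_mult_left\<close>)
    also have "\<dots> = I * (Y k / r ^ k)"
      unfolding I_def set_lebesgue_integral_def by (rule integral_mult_left_zero)
    finally show "norm (\<integral>v. norm (g k v) \<partial>lborel) \<le> I * (Y k / r ^ k)"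
      by simp
  qed
  define q where "q = (\<lambda>v. (1 - 2 * exp (- v) * a / r + exp (- v) ^ 2 * b / r\<^sup>2) powr (- l))"
  have gs: "(\<Sum>k. g k v) = indicator {0<..} v *\<^sub>R (w v * q v)" for v
  proof (cases "v > 0")
    case True
    have "(exp (- v) / r)\<^sup>2 * b \<le> (1 / r)\<^sup>2 * b"
      using True r b by (intro mult_right_mono power_mono divide_right_mono) auto
    then have "(exp (- v) / r)\<^sup>2 * b < 1"
      using rb by linarith
    from sums_mult[OF gegenbauer_sums[OF ab(1) this, of l], of "w v"]
    have "(\<lambda>k. w v * (Z k * (exp (- v) / r) ^ k)) sums (w v * q v)"
      by (simp add: Z_def q_def power_divide)
    moreover have "g k v = w v * (Z k * (exp (- v) / r) ^ k)" for k
      using True by (simp add: g_def power_divide exp_of_nat_mult[symmetric] mult_ac)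
    ultimately show ?thesis
      using True by (simp add: sums_iff)
  qed (simp add: g_def)
  have "integrable lborel (\<lambda>v. \<Sum>k. g k v)"
    by (rule integrable_suminf[OF gi s1 s2])
  then show "set_integrable lborel {0<..} (\<lambda>v. w v * (1 - 2 * exp (- v) * a / r + exp (- v) ^ 2 * b / r\<^sup>2) powr (- l))"
    unfolding gs set_integrable_def q_def .
  have "(\<lambda>k. \<integral>v. g k v \<partial>lborel) sums (\<integral>v. (\<Sum>k. g k v) \<partial>lborel)"
    by (rule sums_integral[OF gi s1 s2])
  also have "(\<integral>v. (\<Sum>k. g k v) \<partial>lborel) = (LINT v:{0<..}|lborel. w v * q v)"
    unfolding gs set_lebesgue_integral_def ..
  also have "(\<lambda>k. \<integral>v. g k v \<partial>lborel) = (\<lambda>k. \<Lambda> k * (Z k / r ^ k))"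
    unfolding g_def \<Lambda>_def set_lebesgue_integral_def by (rule ext, rule integral_mult_left_zero)
  finally have 3: "(\<lambda>k. \<Lambda> k * (Z k / r ^ k)) sums (LINT v:{0<..}|lborel. w v * q v)" .
  have 2: "(\<lambda>k. Z k / r ^ k) sums ((1 - 2 * a / r + b / r\<^sup>2) powr (- l))"
    using gegenbauer_sums[OF ab(1) rb, of l] by (simp add: Z_def power_divide)
  have 1: "(\<lambda>k. (real k + l) / l * (Z k / r ^ k)) sums ((1 - b / r\<^sup>2) * (1 - 2 * a / r + b / r\<^sup>2) powr (- l - 1))"
    using gegenbauer_poisson_sums[OF l ab(1) rb] by (simp add: Z_def power_divide)
  have "(\<lambda>k. A * ((real k + l) / l * (Z k / r ^ k)) - A * E * (Z k / r ^ k) + B * (\<Lambda> k * (Z k / r ^ k))) sums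
     (A * ((1 - b / r\<^sup>2) * (1 - 2 * a / r + b / r\<^sup>2) powr (- l - 1)) - A * E * (1 - 2 * a / r + b / r\<^sup>2) powr (- l)
      + B * (LINT v:{0<..}|lborel. w v * q v))"
    by (intro sums_add sums_diff sums_mult 1 2 3)
  also have "(\<lambda>k. A * ((real k + l) / l * (Z k / r ^ k)) - A * E * (Z k / r ^ k) + B * (\<Lambda> k * (Z k / r ^ k))) = c"
  proof
    fix k
    have h: "(A * (p - E) + B * G) * z = A * (p * z) - A * E * z + B * (G * z)" for p G z
      by (simp add: algebra_simps)
    show "A * ((real k + l) / l * (Z k / r ^ k)) - A * E * (Z k / r ^ k) + B * (\<Lambda> k * (Z k / r ^ k)) = c k"
      unfolding c_def Z_def[symmetric] times_divide_eq_right[symmetric] by (simp only: h)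
  qed
  finally show "(\<Sum>k. c k) = A * (1 - b / r\<^sup>2) * (1 - 2 * a / r + b / r\<^sup>2) powr (- l - 1)
       - A * E * (1 - 2 * a / r + b / r\<^sup>2) powr (- l)
       + B * (LINT v:{0<..}|lborel. w v * (1 - 2 * exp (- v) * a / r + exp (- v) ^ 2 * b / r\<^sup>2) powr (- l))"
    unfolding q_def by (simp add: sums_iff mult.assoc)
qed

lemma powr_square_ratio:
  assumes "q > 0" "r > 0" "n \<ge> 2"
  shows "(q\<^sup>2 / r\<^sup>2) powr (- rho n) = r ^ (n - 2) / q ^ (n - 2)"
    and "(q\<^sup>2 / r\<^sup>2) powr (- rho n - 1) = r ^ n / q ^ n"
proof -
  have h: "(q\<^sup>2 / r\<^sup>2) powr (- (real m / 2)) = r ^ m / q ^ m" for m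
  proof -
    have "(q\<^sup>2 / r\<^sup>2) powr (- (real m / 2)) = ((q / r) powr 2) powr (- (real m / 2))"
      using assms by (simp add: power_divide)
    also have "\<dots> = (q / r) powr (- real m)"
      by (simp only: powr_powr) simp
    also have "\<dots> = r ^ m / q ^ m"
      using assms by (simp add: powr_minus powr_realpow power_divide)
    finally show ?thesis .
  qed
  have "- rho n = - (real (n - 2) / 2)" "- rho n - 1 = - (real n / 2)"
    using assms by (simp_all add: rho_def of_nat_diff diff_divide_distrib)
  then show "(q\<^sup>2 / r\<^sup>2) powr (- rho n) = r ^ (n - 2) / q ^ (n - 2)"
    "(q\<^sup>2 / r\<^sup>2) powr (- rho n - 1) = r ^ n / q ^ n"
    by (simp_all only: h)
qed

text \<open>From \<open>x e\<^bsup>-v/2\<^esup> - y e\<^bsup>v/2\<^esup> = e\<^bsup>v/2\<^esup> (x e\<^bsup>-v\<^esup> - y)\<close>: the power with exponent \<open>2\<rho> = n - 2\<close> in \<open>L\<close> cancels the denominator up to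
  \<open>e\<^bsup>\<rho>v\<^esup>\<close>.\<close>

lemma L_fun_split:
  fixes x y :: "real^'n::finite"
  assumes n: "CARD('n) > 2" and xy: "norm x < norm y" and v: "v > 0"
  defines "l \<equiv> rho CARD('n)" and "q \<equiv> norm (exp (- v) *\<^sub>R x - y)" and "N \<equiv> norm (x - y)"
  shows "L_fun x y v / q ^ (CARD('n) - 2) =
     exp (l * v) * (l * ((norm x)\<^sup>2 * (exp (- v) - 1) + (norm y)\<^sup>2 * (exp v - 1)) - N\<^sup>2)
       + N ^ CARD('n) / q ^ (CARD('n) - 2)"
proof -
  have "norm (exp (- v) *\<^sub>R x) < norm y"
    using xy v by (simp add: less_le_trans) (smt (verit) exp_le_one_iff mult_left_le_one_le norm_ge_zero exp_ge_zero)
  then have q: "q > 0"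
    unfolding q_def by auto
  have N: "N > 0"
    using xy unfolding N_def by auto
  have "exp (- v / 2) *\<^sub>R x - exp (v / 2) *\<^sub>R y = exp (v / 2) *\<^sub>R (exp (- v) *\<^sub>R x - y)"
    by (simp add: scaleR_diff_right flip: exp_add)
  then have nv: "norm (exp (- v / 2) *\<^sub>R x - exp (v / 2) *\<^sub>R y) = exp (v / 2) * q"
    by (simp add: q_def)
  have l2: "2 * l = real (CARD('n) - 2)"
    using n by (simp add: l_def rho_def of_nat_diff)
  have p1: "(exp (v / 2) * q) powr (2 * l) = exp (l * v) * q ^ (CARD('n) - 2)"
  proof -
    have "(exp (v / 2) * q) powr (2 * l) = exp (v / 2) powr (2 * l) * q powr (2 * l)"
      using q by (simp add: powr_mult)
    also have "exp (v / 2) powr (2 * l) = exp (l * v)"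
      by (simp add: powr_def mult_ac)
    also have "q powr (2 * l) = q ^ (CARD('n) - 2)"
      unfolding l2 using q by (rule powr_realpow)
    finally show ?thesis .
  qed
  have p2: "N powr (2 * l) = N ^ (CARD('n) - 2)"
    unfolding l2 using N by (rule powr_realpow)
  have p3: "N ^ CARD('n) = N\<^sup>2 * N ^ (CARD('n) - 2)"
    using n by (metis le_add_diff_inverse less_imp_le_nat power_add)
  show ?thesis
    unfolding L_fun_def nv h_fun_eq[OF refl] l_def[symmetric] N_def[symmetric] p1 p2 p3
    using q by (simp add: field_simps)
qed

text \<open>The quadratic of the generating function, in geometric terms.\<close>

lemma distance_factor:
  fixes x y :: "real^'n::finite"
  assumes "norm y = r" "r > 0"
  shows "1 - 2 * t * ((y /\<^sub>R r) \<bullet> x) / r + t\<^sup>2 * (norm x)\<^sup>2 / r\<^sup>2 = (norm (t *\<^sub>R x - y))\<^sup>2 / r\<^sup>2"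
proof -
  have "(norm (t *\<^sub>R x - y))\<^sup>2 = t\<^sup>2 * (norm x)\<^sup>2 - 2 * t * (y \<bullet> x) + r\<^sup>2"
    unfolding assms(1)[symmetric] power2_norm_eq_inner
    by (simp add: inner_diff_left inner_diff_right inner_commute[of x y] power2_eq_square algebra_simps)
  then show ?thesis
    using assms(2) by (simp add: field_simps power2_eq_square)
qed

theorem theorem5p1:
  fixes n :: nat and r :: real and x y :: "real^'n::finite"
    and M :: "'w measure" and X :: "real \<Rightarrow> 'w \<Rightarrow> real^'n"
    and P :: "real^'n \<Rightarrow> real" and w :: "real \<Rightarrow> real"
  assumes n: "n = CARD('n)" "n > 2"
    and hyp: "\<And>z::real. 0 < z \<Longrightarrow> z < 1 \<Longrightarrow> \<exists>\<epsilon>>0.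
        (\<lambda>k::complex. F_k n k z
            - (of_real ((1 - z) powr rho n)
               + of_real (real n / 2 * rho n) / (k + of_nat n / 2)
                 * of_real (z * (1 - z) powr (rho n - 1))))
          \<in> O[inf at_infinity (principal {k. Re k \<ge> - real n / 2 - \<epsilon>})](\<lambda>k. 1 / k\<^sup>2)
        \<and> (\<forall>k::complex. Re k \<ge> - real n / 2 - \<epsilon> \<and> k + of_nat n / 2 \<notin> \<int>\<^sub>\<le>\<^sub>0 \<longrightarrow> F_k n k z \<noteq> 0)"
    and r: "0 < r" "r < 1"
    and x: "norm x < r"
    and y: "norm y = r"
    and X: "hyperbolic_BM M X x"
    and P: "is_Poisson_kernel M X r P"
    and w: "inverse_Laplace_of_H n ((norm x)\<^sup>2) (r\<^sup>2) w"
  shows "set_integrable lborel {0<..}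
           (\<lambda>v. w v * L_fun x y v / norm (exp (- v) *\<^sub>R x - y) ^ (n - 2)) \<and>
         P y = Gamma (real n / 2) / (2 * pi powr (real n / 2) * r * (1 - r\<^sup>2) ^ (n - 2))
             * ((r\<^sup>2 - (norm x)\<^sup>2) / norm (x - y) ^ n)
             * (LINT v:{0<..}|lborel. w v * L_fun x y v / norm (exp (- v) *\<^sub>R x - y) ^ (n - 2))"
proof -
  define l s R N q e where "l = rho n" and "s = (norm x)\<^sup>2" and "R = r\<^sup>2" and "N = norm (x - y)"
    and "q = (\<lambda>v. norm (exp (- v) *\<^sub>R x - y))" and "e = y /\<^sub>R r"
  have l: "l > 0" "real CARD('n) = 2 * l + 2" "real n / 2 = l + 1"
    using n by (simp_all add: l_def rho_def diff_divide_distrib)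
  have e: "norm e = 1"
    using y r by (simp add: e_def)
  have sR: "0 \<le> s" "s < R" "R < 1" "R > 0"
    using x r by (auto simp: s_def R_def power_strict_mono power_less_one_iff)
  have N0: "N > 0"
    using x y by (auto simp: N_def)
  have q0: "q v > 0" if "v > 0" for v
  proof -
    have "norm (exp (- v) *\<^sub>R x) \<le> norm x"
      using that by (simp add: mult_left_le_one_le)
    then show ?thesis
      using x y unfolding q_def by auto
  qed
  have w': "inverse_Laplace_of_H n s R w"
    using w by (simp add: s_def R_def)
  define \<phi> where "\<phi> = (\<lambda>k::nat. eval_fps (hypergeo_fps (real k) (- rho n) (real k + real n / 2)))"
  have \<phi>0: "\<phi> k R \<noteq> 0" for k
  proof -
    obtain \<epsilon> where \<epsilon>: "\<epsilon> > 0" "\<And>k::complex. Re k \<ge> - real n / 2 - \<epsilon> \<Longrightarrow> k + of_nat n / 2 \<notin> \<int>\<^sub>\<le>\<^sub>0 \<Longrightarrow> F_k n k R \<noteq> 0"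
      using hyp[OF sR(4,3)] by blast
    have "(of_nat k :: complex) + of_nat n / 2 \<notin> \<int>\<^sub>\<le>\<^sub>0"
      by (rule of_nat_add_half_notin_nonpos_Ints) (use n in simp)
    then have "F_k n (of_nat k) R \<noteq> 0"
      using \<epsilon>(1) by (intro \<epsilon>(2)) (auto intro: order_trans[of _ 0])
    then show ?thesis
      using F_k_of_nat[of R n k] sR n by (simp add: \<phi>_def)
  qed
  define A E B where "A = ((1 - s) / (1 - R)) powr rho n"
    and "E = real n / 2 * ((R - s) / ((1 - R) * (1 - s)))" and "B = (R - s) / (1 - R) ^ (n - 2)"
  define W where "W = (\<lambda>a. LINT v:{0<..}|lborel. exp (a * v) * w v)"
  have Wi: "set_integrable lborel {0<..} (\<lambda>v. exp (a * v) * w v)" if "a \<le> real n / 2" for a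
    by (rule real_Laplace_of_H(1)[OF w' that])
  have WH: "H_fun n s R (of_real (- a)) = of_real (W a)" if "a \<le> real n / 2" for a
    unfolding W_def by (rule real_Laplace_of_H(2)[OF w' that])
  have w0: "set_integrable lborel {0<..} w"
    using Wi[of 0] by simp
  define a where "a = e \<bullet> x"
  have as: "a\<^sup>2 \<le> s"
    using Cauchy_Schwarz_ineq[of e x] e by (simp add: a_def s_def power2_norm_eq_inner[symmetric])
  define c where "c = (\<lambda>k. (A * ((real k + l) / l - E) + B * (LINT v:{0<..}|lborel. exp (- real k * v) * w v))
     * gegenbauer l a s k / r ^ k)"
  note series = Gegenbauer_series_identity[OF l(1) r(1) as sR(2)[unfolded R_def] w0]
  have ser1: "\<exists>K>1. summable (\<lambda>k. c k * K ^ k)"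
    unfolding c_def by (rule series(1))
  have ser3: "(\<Sum>k. c k) = A * (1 - s / r\<^sup>2) * (1 - 2 * a / r + s / r\<^sup>2) powr (- l - 1)
      - A * E * (1 - 2 * a / r + s / r\<^sup>2) powr (- l)
      + B * (LINT v:{0<..}|lborel. w v * (1 - 2 * exp (- v) * a / r + exp (- v) ^ 2 * s / r\<^sup>2) powr (- l))"
    unfolding c_def by (rule series(3))
  define S where "S = (spherical_measure r :: (real^'n) measure)"
  have c_eq: "(real k + l) / l * (\<integral>z. (indicator (sphere 0 r) z * P z) * gegenbauer l (e \<bullet> z) (r\<^sup>2) k \<partial>S) / r ^ k = c k" for k
  proof -
    define m where "m = (\<integral>z. (indicator (sphere 0 r) z * P z) * gegenbauer l (e \<bullet> z) (r\<^sup>2) k \<partial>S)"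
    have "m * \<phi> k R = gegenbauer l a s k * \<phi> k s"
      using Poisson_kernel_gegenbauer_moment[OF _ r x e X P, of k] n
      unfolding m_def S_def \<phi>_def R_def s_def a_def l_def by simp
    then have m: "m = gegenbauer l a s k * (\<phi> k s / \<phi> k R)"
      using \<phi>0[of k] by (simp add: field_simps)
    have "(real k + l) / l * m / r ^ k = ((real k + l) / l * (\<phi> k s / \<phi> k R)) * gegenbauer l a s k / r ^ k"
      unfolding m by simp
    also have "(real k + l) / l * (\<phi> k s / \<phi> k R) =
       A * ((real k + l) / l - E) + B * (LINT v:{0<..}|lborel. exp (- real k * v) * w v)"
      using F_k_ratio_Laplace[OF n(2) sR(1-3) w', of k] unfolding \<phi>_def l_def A_def E_def B_def .
    finally show ?thesis
      unfolding m_def c_def .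
  qed
  obtain K where K: "K > 1" "summable (\<lambda>k. c k * K ^ k)"
    using ser1 by (elim exE conjE) (rule that)
  have Pc: "continuous_on (sphere 0 r) P"
    using P by (simp add: is_Poisson_kernel_def)
  have "P y * measure S UNIV = (\<Sum>k. c k)"
    by (rule sphere_density_expansion[OF r(1) Pc y l(2,1), of K, folded S_def e_def, unfolded c_eq]) (rule K)+
  moreover have "measure S UNIV = 2 * pi powr (real n / 2) / Gamma (real n / 2) * r ^ (n - 1)"
    unfolding measure_def S_def spherical_measure_total[OF r(1)] using n r Gamma_real_pos[of "real n / 2"]
    by (subst enn2real_ennreal) auto
  moreover have factor: "1 - 2 * a / r + s / r\<^sup>2 = N\<^sup>2 / r\<^sup>2"
    using distance_factor[OF y r(1), of 1 x] by (simp add: a_def e_def s_def N_def)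
  moreover have factor': "1 - 2 * exp (- v) * a / r + exp (- v) ^ 2 * s / r\<^sup>2 = (q v)\<^sup>2 / r\<^sup>2" for v
    using distance_factor[OF y r(1), of "exp (- v)" x] by (simp add: a_def e_def s_def q_def)
  moreover define T where "T = (LINT v:{0<..}|lborel. w v * ((q v)\<^sup>2 / r\<^sup>2) powr (- l))"
  ultimately have P1: "P y * (2 * pi powr (real n / 2) / Gamma (real n / 2) * r ^ (n - 1)) =
     A * (1 - s / R) * (r ^ n / N ^ n) - A * E * (r ^ (n - 2) / N ^ (n - 2)) + B * T"
    using ser3 n powr_square_ratio[OF N0 r(1), of n] by (simp add: l_def R_def)
  have Ti: "set_integrable lborel {0<..} (\<lambda>v. w v * ((q v)\<^sup>2 / r\<^sup>2) powr (- l))"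
    using series(2) by (simp add: factor')
  have Wl: "W l = A * E / B"
    and Wc: "l * (s * (W (l - 1) - W l) + R * (W (l + 1) - W l)) = A * (R - s) / B"
  proof -
    have C: "(1 - R) ^ (n - 2) / (R - s) = 1 / B"
      by (simp add: B_def)
    note sv = H_fun_special_values[OF n(2) sR(1-3), folded l_def A_def E_def, unfolded C]
    have Wl1: "H_fun n s R (of_real (- l)) = of_real (W l)"
      by (rule WH) (simp add: l(3))
    have Wl2: "H_fun n s R (of_real (1 - l)) = of_real (W (l - 1))"
      using WH[of "l - 1"] l(3) by simp
    have Wl3: "H_fun n s R (of_real (- (real n / 2))) = of_real (W (l + 1))"
      using WH[of "real n / 2"] unfolding l(3) by simp
    have "of_real (W l) = complex_of_real (1 / B * (A * E))"
      using sv(1) unfolding Wl1 .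
    then show "W l = A * E / B"
      by (simp only: of_real_eq_iff) simp
    have "complex_of_real (l * (s * (W (l - 1) - W l) + R * (W (l + 1) - W l))) = of_real (1 / B * (A * (R - s)))"
      using sv(2) unfolding Wl1 Wl2 Wl3 by simp
    then show "l * (s * (W (l - 1) - W l) + R * (W (l + 1) - W l)) = A * (R - s) / B"
      by (simp only: of_real_eq_iff) simp
  qed
  \<comment> \<open>the integrand of the theorem, split into the parts whose integrals are \<open>W (l - 1)\<close>, \<open>W (l + 1)\<close>, \<open>W l\<close> and \<open>T\<close>\<close>
  define g where "g = (\<lambda>v. l * s * (exp ((l - 1) * v) * w v) + l * R * (exp ((l + 1) * v) * w v)
      - (l * s + l * R + N\<^sup>2) * (exp (l * v) * w v) + N ^ n / r ^ (n - 2) * (w v * ((q v)\<^sup>2 / r\<^sup>2) powr (- l)))"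
  have L: "w v * L_fun x y v / norm (exp (- v) *\<^sub>R x - y) ^ (n - 2) = g v" if v: "v \<in> {0<..}" for v
  proof -
    have v': "v > 0"
      using v by simp
    have ex: "exp ((l - 1) * v) = exp (l * v) * exp (- v)" "exp ((l + 1) * v) = exp (l * v) * exp v"
      by (simp_all add: algebra_simps flip: exp_add)
    have pq: "((q v)\<^sup>2 / r\<^sup>2) powr (- l) = r ^ (n - 2) / q v ^ (n - 2)"
      unfolding l_def by (rule powr_square_ratio(1)[OF q0[OF v'] r(1)]) (use n in simp)
    have Lq: "L_fun x y v / q v ^ (n - 2) =
       exp (l * v) * (l * (s * (exp (- v) - 1) + R * (exp v - 1)) - N\<^sup>2) + N ^ n / q v ^ (n - 2)"
      using L_fun_split[of x y v] n x y v' by (simp add: l_def q_def s_def R_def N_def)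
    have "w v * L_fun x y v / norm (exp (- v) *\<^sub>R x - y) ^ (n - 2) = w v * (L_fun x y v / q v ^ (n - 2))"
      by (simp add: q_def)
    also have "\<dots> = w v * (exp (l * v) * (l * (s * (exp (- v) - 1) + R * (exp v - 1)) - N\<^sup>2) + N ^ n / q v ^ (n - 2))"
      unfolding Lq ..
    also have "\<dots> = g v"
      unfolding g_def ex pq using r by (simp add: algebra_simps)
    finally show ?thesis .
  qed
  have parts: "set_integrable lborel {0<..} (\<lambda>v. l * s * (exp ((l - 1) * v) * w v))"
    "set_integrable lborel {0<..} (\<lambda>v. l * R * (exp ((l + 1) * v) * w v))"
    "set_integrable lborel {0<..} (\<lambda>v. (l * s + l * R + N\<^sup>2) * (exp (l * v) * w v))"
    "set_integrable lborel {0<..} (\<lambda>v. N ^ n / r ^ (n - 2) * (w v * ((q v)\<^sup>2 / r\<^sup>2) powr (- l)))"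
    using Wi[of "l - 1"] Wi[of "l + 1"] Wi[of l] Ti l(3) by (auto intro!: set_integrable_mult_right)
  have gi: "set_integrable lborel {0<..} g"
    unfolding g_def by (intro set_integral_add set_integral_diff parts)
  have "(LINT v:{0<..}|lborel. g v) = l * s * W (l - 1) + l * R * W (l + 1) - (l * s + l * R + N\<^sup>2) * W l
      + N ^ n / r ^ (n - 2) * T"
    unfolding g_def W_def T_def
    by (subst set_integral_add set_integral_diff, (intro set_integral_add set_integral_diff parts)+)+
      (simp only: set_integral_mult_right)
  also have "\<dots> = A * (R - s) / B - N\<^sup>2 * (A * E / B) + N ^ n / r ^ (n - 2) * T"
    using Wc unfolding Wl[symmetric] by (simp add: algebra_simps)
  finally have gI: "(LINT v:{0<..}|lborel. g v) = A * (R - s) / B - N\<^sup>2 * (A * E / B) + N ^ n / r ^ (n - 2) * T" .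
  have B0: "B > 0"
    using sR by (simp add: B_def)
  have G0: "Gamma (real n / 2) > 0"
    using n by (intro Gamma_real_pos) simp
  have "P y = Gamma (real n / 2) / (2 * pi powr (real n / 2) * r * (1 - r\<^sup>2) ^ (n - 2))
             * ((r\<^sup>2 - (norm x)\<^sup>2) / N ^ n) * (LINT v:{0<..}|lborel. g v)"
  proof -
    define p u where "p = 2 * pi powr (real n / 2)" and "u = r ^ (n - 2)"
    have u1: "r ^ n = R * u"
      unfolding u_def R_def using n(2) by (metis le_add_diff_inverse less_imp_le_nat power_add)
    have "n - 1 = Suc (n - 2)"
      using n(2) by simp
    then have u2: "r ^ (n - 1) = r * u"
      by (simp only: u_def power_Suc)
    note u = u1 u2
    have Nn: "N ^ n = N\<^sup>2 * N ^ (n - 2)"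
      using n by (metis le_add_diff_inverse less_imp_le_nat power_add)
    have pos: "p > 0" "u > 0" "N ^ (n - 2) > 0"
      using r N0 by (simp_all add: p_def u_def)
    have "A * (1 - s / R) * (R * u / N ^ n) - A * E * (u / N ^ (n - 2)) + B * T
       = u / N ^ n * (A * (R - s) - N\<^sup>2 * (A * E) + N ^ n / u * (B * T))"
      unfolding Nn using pos sR(4) N0 by (simp add: field_simps)
    then have "P y * (p / Gamma (real n / 2) * (r * u)) = u / N ^ n * (A * (R - s) - N\<^sup>2 * (A * E) + N ^ n / u * (B * T))"
      using P1 unfolding u p_def[symmetric] u_def[symmetric] by simp
    moreover have solve: "z = Gamma (real n / 2) / (p * r) * Q / m"
      if "z * (p / Gamma (real n / 2) * (r * u)) = u / m * Q" "m > 0" for z Q m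
      using that pos r G0 by (simp add: field_simps)
    ultimately have "P y = Gamma (real n / 2) / (p * r) * (A * (R - s) - N\<^sup>2 * (A * E) + N ^ n / u * (B * T)) / N ^ n"
      using N0 by (intro solve) simp_all
    also have "A * (R - s) - N\<^sup>2 * (A * E) + N ^ n / u * (B * T) = B * (LINT v:{0<..}|lborel. g v)"
      unfolding gI u_def[symmetric] using B0 by (simp add: field_simps)
    also have "Gamma (real n / 2) / (p * r) * (B * (LINT v:{0<..}|lborel. g v)) / N ^ n =
      Gamma (real n / 2) / (p * r * (1 - R) ^ (n - 2)) * ((R - s) / N ^ n) * (LINT v:{0<..}|lborel. g v)"
      by (simp add: B_def)
    finally show ?thesis
      unfolding p_def R_def s_def .
  qed
  moreover have "set_integrable lborel {0<..} (\<lambda>v. w v * L_fun x y v / norm (exp (- v) *\<^sub>R x - y) ^ (n - 2)) \<longleftrightarrow>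
      set_integrable lborel {0<..} g"
    by (rule set_integrable_cong) (simp_all add: L)
  moreover have "(LINT v:{0<..}|lborel. w v * L_fun x y v / norm (exp (- v) *\<^sub>R x - y) ^ (n - 2)) =
      (LINT v:{0<..}|lborel. g v)"
    by (rule set_lebesgue_integral_cong) (simp_all add: L)
  ultimately show ?thesis
    using gi unfolding N_def by simp
qed

end
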